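(* Let $k\ge 1$, let $M$ be a stable $d\times d$ real matrix and let $Z=(Z_t)_{t\ge 0}$ be a $d$-dimensional Lévy process with finite $k$-th-order moment. Then the corresponding $M$-selfdecomposable distribution (the unique steady-state distribution of the SDE $dX_t = M X_t\,dt + dZ_t$) has finite $k$-th-order moment, and its $k$-th-order cumulant tensor $\mathcal{K}$ solves the equation $$\mathcal{K}\times_1 M + \cdots + \mathcal{K}\times_k M + \mathcal{C}_k = 0,$$ where $\mathcal{C}_k = \mathrm{cum}_k(Z_1)$ is the $k$-th-order cumulant tensor of $Z_1$.
   Context: A real square matrix is stable if all its eigenvalues have negative real part. A Lévy process $Z$ has finite $k$-th-order moment if $\mathbb{E}\|Z_1\|^k<\infty$. When $M$ is stable and $\mathbb{E}\log(1+\|Z_1\|)<\infty$, the SDE $dX_t = MX_t\,dt+dZ_t$ has a unique steady-state (stationary) distribution, called the $M$-selfdecomposable distribution determined by $M$ and $Z$; it is the law of $\int_0^\infty e^{sM}\,dZ_s$. For a random vector $X$ in $\mathbb{R}^d$ with finite $k$-th-order moment, $\mathrm{cum}_k(X)$ is the $d\times\cdots\times d$ ($k$ factors) symmetric tensor whose $(i_1,\dots,i_k)$ entry is the joint cumulant of $X_{i_1},\dots,X_{i_k}$. For a tensor $T\in\mathbb{R}^{I_1\times\cdots\times I_N}$ and a matrix $M\in\mathbb{R}^{J\times I_n}$ the $n$-mode product is $(T\times_n M)_{i_1\cdots i_{n-1}\,j\,i_{n+1}\cdots i_N} = \sum_{i_n=1}^{I_n} T_{i_1\cdots i_N}M_{j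 i_n}$. *)

theory Defs
  imports "HOL-Probability.Probability" "HOL-Library.Disjoint_Sets"
begin

section \<open>Stable matrices\<close>

text \<open>The eigenvalues of a real matrix are its complex eigenvalues, so the matrix is first mapped
  into the complex matrices.\<close>

definition eigenvalue :: "real^'n^'n \<Rightarrow> complex \<Rightarrow> bool" where
  "eigenvalue M z \<longleftrightarrow>
     (\<exists>v :: complex^'n. v \<noteq> 0 \<and> (\<chi> i j. complex_of_real (M $ i $ j)) *v v = z *s v)"

definition stable_matrix :: "real^'n^'n \<Rightarrow> bool" where
  "stable_matrix M \<longleftrightarrow> (\<forall>z. eigenvalue M z \<longrightarrow> Re z < 0)"

section \<open>Levy processes\<close>

text \<open>Time is \<open>{0..}\<close>; the values of \<open>Z\<close> at negative times are irrelevant.\<close>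

locale levy_process = prob_space P
  for P :: "'w measure" and Z :: "real \<Rightarrow> 'w \<Rightarrow> real^'n" +
  assumes measurable_at: "t \<ge> 0 \<Longrightarrow> Z t \<in> borel_measurable P"
    and starts_at_zero: "AE w in P. Z 0 w = 0"
    and indep_increments:
      "0 \<le> ts 0 \<Longrightarrow> (\<And>i. i < m \<Longrightarrow> ts i \<le> ts (Suc i)) \<Longrightarrow>
         indep_vars (\<lambda>_. borel) (\<lambda>i w. Z (ts (Suc i)) w - Z (ts i) w) {..<m::nat}"
    and stationary_increments:
      "0 \<le> s \<Longrightarrow> 0 \<le> t \<Longrightarrow> distr P borel (\<lambda>w. Z (s + t) w - Z s w) = distr P borel (Z t)"
    and stochastically_continuous:
      "0 \<le> t \<Longrightarrow> 0 < e \<Longrightarrow>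
         ((\<lambda>s. prob {w \<in> space P. norm (Z s w - Z t w) > e}) \<longlongrightarrow> 0) (at t within {0..})"
    and cadlag_paths:
      "AE w in P. \<forall>t\<ge>0. continuous (at_right t) (\<lambda>s. Z s w) \<and>
         (t > 0 \<longrightarrow> (\<exists>l. ((\<lambda>s. Z s w) \<longlongrightarrow> l) (at_left t)))"

section \<open>The linear equation driven by \<open>Z\<close> and its steady states\<close>

text \<open>The noise is additive, so \<open>dX = M X dt + dZ\<close> (with \<open>Z 0 = 0\<close>) is a pathwise integral
  equation.\<close>

definition sde_solution ::
    "real^'n^'n \<Rightarrow> 'a measure \<Rightarrow> (real \<Rightarrow> 'a \<Rightarrow> real^'n) \<Rightarrow> (real \<Rightarrow> 'a \<Rightarrow> real^'n) \<Rightarrow> bool" where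
  "sde_solution M N Z X \<longleftrightarrow>
     (\<forall>t\<ge>0. X t \<in> borel_measurable N) \<and>
     (AE w in N. \<forall>t\<ge>0. set_integrable lborel {0..t} (\<lambda>s. X s w) \<and>
        X t w = X 0 w + (LINT s:{0..t}|lborel. M *v X s w) + Z t w)"

text \<open>A steady-state distribution is a law \<open>\<mu>\<close> that is preserved when the equation is started
  in \<open>\<mu>\<close>, independently of \<open>Z\<close>. The space \<open>P\<close> need not carry such an initial value, so the
  equation is solved on \<open>\<mu> \<Otimes>\<^sub>M P\<close>, with the first coordinate as initial value and \<open>Z\<close> read off
  the second one.\<close>

definition steady_state_distribution ::
    "real^'n^'n \<Rightarrow> 'w measure \<Rightarrow> (real \<Rightarrow> 'w \<Rightarrow> real^'n) \<Rightarrow> (real^'n) measure \<Rightarrow> bool" where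
  "steady_state_distribution M P Z \<mu> \<longleftrightarrow>
     prob_space \<mu> \<and> sets \<mu> = sets borel \<and>
     (\<exists>X. sde_solution M (\<mu> \<Otimes>\<^sub>M P) (\<lambda>t (x, w). Z t w) X \<and>
          (AE (x, w) in \<mu> \<Otimes>\<^sub>M P. X 0 (x, w) = x) \<and>
          (\<forall>t\<ge>0. distr (\<mu> \<Otimes>\<^sub>M P) borel (X t) = \<mu>))"

section \<open>Moments and cumulants\<close>

definition finite_moment :: "nat \<Rightarrow> 'a measure \<Rightarrow> ('a \<Rightarrow> real^'n) \<Rightarrow> bool" where
  "finite_moment k N X \<longleftrightarrow> X \<in> borel_measurable N \<and> integrable N (\<lambda>w. norm (X w) ^ k)"

text \<open>The joint cumulant of the entries of a list of random variables (repetitions allowed), given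
  by the moment--cumulant formula: the sum runs over the set partitions of the list positions.\<close>

definition joint_cumulant :: "'a measure \<Rightarrow> ('a \<Rightarrow> real) list \<Rightarrow> real" where
  "joint_cumulant N Xs =
     (\<Sum>\<pi> | partition_on {..<length Xs} \<pi>.
        (-1) ^ (card \<pi> - 1) * fact (card \<pi> - 1) *
        (\<Prod>B\<in>\<pi>. LINT w|N. (\<Prod>i\<in>B. (Xs ! i) w)))"

text \<open>A tensor of order \<open>k\<close> with all dimensions indexed by \<open>'n\<close> is a function on index lists
  of length \<open>k\<close>; its values on other lists are irrelevant. The \<open>k\<close>-th cumulant tensor is the
  restriction of \<open>cumulant_tensor\<close> to such lists.\<close>

definition cumulant_tensor :: "'a measure \<Rightarrow> ('a \<Rightarrow> real^'n) \<Rightarrow> 'n list \<Rightarrow> real" where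
  "cumulant_tensor N X is = joint_cumulant N (map (\<lambda>i w. X w $ i) is)"

text \<open>Modes are counted from \<open>0\<close>: \<open>mode_product T m M\<close> is the usual \<open>(m+1)\<close>-mode product.\<close>

definition mode_product :: "('n::finite list \<Rightarrow> real) \<Rightarrow> nat \<Rightarrow> real^'n^'n \<Rightarrow> 'n list \<Rightarrow> real" where
  "mode_product T m M is = (\<Sum>i\<in>UNIV. T (is[m := i]) * M $ (is ! m) $ i)"

end

theory Submission
  imports Defs "HOL-Computational_Algebra.Fundamental_Theorem_Algebra"
begin

text \<open>
  Let \<open>\<xi>\<close> be the initial value of the stationary solution, so that \<open>\<xi>\<close> has law \<open>\<mu>\<close> and is independent
  of \<open>Z\<close>. No explicit solution formula is needed; the argument only uses short times \<open>t\<close> and the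
  decomposition
  \<open>X t = \<xi> + t M \<xi> + Z t + R t\<close>, where the remainder \<open>R t\<close> is the integral of \<open>M (X s - \<xi>)\<close> over
  \<open>{0..t}\<close> and satisfies, pathwise and for \<open>B t \<le> 1/2\<close>,
  \<open>\<parallel>R t\<parallel> \<le> 2 B W t + 2 B\<^sup>2 t\<^sup>2 \<parallel>\<xi>\<parallel>\<close> with \<open>B\<close> the operator norm of \<open>M\<close> and \<open>W t\<close> the integral of
  \<open>\<parallel>Z s\<parallel>\<close> over \<open>{0..t}\<close> (\<open>path_remainder_bound\<close>).

  The moments of \<open>Z t\<close> for small \<open>t\<close> are controlled by those of \<open>Z 1\<close>: the increment \<open>Z 1 - Z t\<close> is
  independent of \<open>Z t\<close> and stays in a fixed ball with probability at least \<open>1/2\<close>, so the tails of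
  \<open>\<parallel>Z t\<parallel>\<^sup>k\<close> are bounded uniformly in \<open>t\<close> by the tails of \<open>(\<parallel>Z 1\<parallel> + K)\<^sup>k\<close>; with stochastic
  continuity, the \<open>k\<close>-th moment of \<open>Z t\<close> tends to \<open>0\<close> (\<open>small_time_moment\<close>). By Jensen the \<open>k\<close>-th
  moment of \<open>W t\<close> is then \<open>o(t\<^sup>k)\<close>.

  Finiteness of the moment of \<open>\<mu>\<close>. For stable \<open>M\<close> there is a subadditive function \<open>V\<close>,
  bounded above and below by multiples of the norm, with
  \<open>V (x + h M x) \<le> (1 - c h) V x\<close> for small \<open>h\<close> (\<open>stable_matrix_lyapunov_norm\<close>). Hence
  \<open>V (X h) \<le> \<rho> V \<xi> + Y\<close> with \<open>\<rho> < 1\<close> and \<open>Y\<close> having a finite \<open>k\<close>-th moment. Since \<open>X h\<close> and \<open>\<xi>\<close>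
  have the same law, truncating and iterating this inequality bounds the \<open>k\<close>-th moment of \<open>V \<xi>\<close>
  (\<open>contraction_moment\<close>).

  The equation. Cumulants are multilinear in their arguments (\<open>cumulant_upto_linear\<close>), additive over
  independent summands (\<open>cumulant_tensor_add_indep\<close>) and continuous with respect to convergence in
  the \<open>k\<close>-th mean (\<open>cumulant_upto_tendsto\<close>). Write \<open>X t = F + t H\<close> with \<open>F = \<xi> + Z t\<close>
  and \<open>H = M \<xi> + R t / t\<close>. By stationarity \<open>X t\<close> has the cumulant tensor \<open>\<K>\<close> of \<open>\<mu>\<close>, and
  by independence \<open>F\<close> has the tensor \<open>\<K> + cum (Z t)\<close>, where \<open>cum (Z t) = t cum (Z 1)\<close> for
  \<open>t = 1 / n\<close>. Replacing \<open>X t\<close> by \<open>F\<close> in one slot at a time and dividing by \<open>t\<close> shows that \<open>cum (Z 1)\<close>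
  plus the sum over the slots \<open>m\<close> of the cumulants with entries \<open>F\<close> before slot \<open>m\<close>, \<open>H\<close> in slot \<open>m\<close> and
  \<open>X t\<close> after it vanishes (\<open>cumulant_increment\<close>). As \<open>t\<close> tends to \<open>0\<close>, these cumulants tend to those with
  \<open>M \<xi>\<close> in slot \<open>m\<close> and \<open>\<xi>\<close> elsewhere, which are the mode products of \<open>\<K>\<close> with \<open>M\<close>.
\<close>

section \<open>Cumulants of set functions\<close>

text \<open>The moments of finitely many random variables form a set function \<open>m\<close>, whose value at a set
  \<open>B\<close> of indices is the expectation of the product over \<open>B\<close>. Functions of finite sets form a
  commutative algebra under the convolution below, and the cumulants are the logarithm of the moments
  in this algebra. Additivity and linearity of the cumulants are obtained by differentiating this
  logarithm: \<open>containing s\<close> is a derivation, and the derivative of the logarithm of \<open>m\<close> is the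
  derivative of \<open>m\<close> times the inverse of \<open>m\<close>.\<close>

definition subset_conv :: "('a set \<Rightarrow> real) \<Rightarrow> ('a set \<Rightarrow> real) \<Rightarrow> 'a set \<Rightarrow> real" where
  "subset_conv f g S = (\<Sum>A\<in>Pow S. f A * g (S - A))"

text \<open>The unit of this convolution.\<close>

definition subset_conv_unit :: "'a set \<Rightarrow> real" where
  "subset_conv_unit S = (if S = {} then 1 else 0)"

text \<open>The derivation attached to an index \<open>s\<close>: keep only the values at sets that contain \<open>s\<close>.\<close>

definition containing :: "'a \<Rightarrow> ('a set \<Rightarrow> real) \<Rightarrow> 'a set \<Rightarrow> real" where
  "containing s f S = (if s \<in> S then f S else 0)"

text \<open>The inverse of a set function with value \<open>1\<close> at the empty set, that is, the geometric series
  in \<open>1 - m\<close>: the \<open>j\<close>-th power of a set function vanishing at the empty set is a sum over ordered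
  partitions into \<open>j\<close> blocks, and each unordered partition is counted \<open>j!\<close> times.\<close>

definition subset_conv_inverse :: "('a set \<Rightarrow> real) \<Rightarrow> 'a set \<Rightarrow> real" where
  "subset_conv_inverse m S =
     (\<Sum>\<pi> | partition_on S \<pi>. (-1) ^ card \<pi> * fact (card \<pi>) * (\<Prod>B\<in>\<pi>. m B))"

text \<open>The moment--cumulant formula for an arbitrary set function in place of the moments.\<close>

definition set_cumulant :: "('a set \<Rightarrow> real) \<Rightarrow> 'a set \<Rightarrow> real" where
  "set_cumulant m S =
     (\<Sum>\<pi> | partition_on S \<pi>. (-1) ^ (card \<pi> - 1) * fact (card \<pi> - 1) * (\<Prod>B\<in>\<pi>. m B))"

lemma subset_conv_commute: "subset_conv f g S = subset_conv g f S"
  unfolding subset_conv_def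
  by (rule sum.reindex_bij_witness[where i="\<lambda>A. S - A" and j="\<lambda>A. S - A"])
     (auto simp: double_diff mult.commute)

lemma subset_conv_assoc:
  assumes "finite S"
  shows "subset_conv (subset_conv f g) h S = subset_conv f (subset_conv g h) S"
proof -
  have "subset_conv (subset_conv f g) h S
      = (\<Sum>(A, B)\<in>Sigma (Pow S) Pow. f B * g (A - B) * h (S - A))"
    unfolding subset_conv_def using assms
    by (subst sum.Sigma[symmetric]) (auto simp: sum_distrib_right intro: finite_subset)
  also have "\<dots> = (\<Sum>(B, C)\<in>Sigma (Pow S) (\<lambda>B. Pow (S - B)). f B * (g C * h (S - B - C)))"
    by (rule sum.reindex_bij_witness[where i="\<lambda>(B, C). (B \<union> C, B)" and j="\<lambda>(A, B). (B, A - B)"])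
       (auto simp: Un_Diff Diff_Un intro!: arg_cong[where f=g] arg_cong[where f=h])
  also have "\<dots> = subset_conv f (subset_conv g h) S"
    unfolding subset_conv_def using assms
    by (subst sum.Sigma[symmetric]) (auto simp: sum_distrib_left intro: finite_subset)
  finally show ?thesis .
qed

lemma subset_conv_unit_left:
  assumes "finite S"
  shows "subset_conv subset_conv_unit f S = f S"
proof -
  have "subset_conv subset_conv_unit f S = (\<Sum>A\<in>Pow S. if A = {} then f (S - A) else 0)"
    unfolding subset_conv_def subset_conv_unit_def by (intro sum.cong) auto
  then show ?thesis
    using assms by simp
qed

lemma subset_conv_cong:
  assumes "\<And>A. A \<subseteq> S \<Longrightarrow> f A = f' A" "\<And>A. A \<subseteq> S \<Longrightarrow> g A = g' A"
  shows "subset_conv f g S = subset_conv f' g' S"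
  unfolding subset_conv_def using assms by (intro sum.cong) auto

lemma subset_conv_add_left: "subset_conv (\<lambda>A. f A + f' A) g S = subset_conv f g S + subset_conv f' g S"
  unfolding subset_conv_def by (simp add: distrib_right sum.distrib)

lemma containing_subset_conv:
  "containing s (subset_conv f g) S = subset_conv (containing s f) g S + subset_conv f (containing s g) S"
proof -
  have "containing s f A * g (S - A) + f A * containing s g (S - A)
      = (if s \<in> S then f A * g (S - A) else 0)" if "A \<in> Pow S" for A
    using that by (auto simp: containing_def)
  then show ?thesis
    unfolding subset_conv_def containing_def[of s "\<lambda>S. \<Sum>A\<in>Pow S. f A * g (S - A)"]
    by (simp flip: sum.distrib)
qed

text \<open>Choosing a block \<open>B\<close> and a partition of the rest is the same as choosing a partition and one of
  its blocks.\<close>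

lemma sum_partition_split_block:
  assumes "finite S"
  shows "(\<Sum>B | B \<subseteq> S \<and> B \<noteq> {} \<and> Q B. \<Sum>\<sigma> | partition_on (S - B) \<sigma>. g B \<sigma>)
    = (\<Sum>\<pi> | partition_on S \<pi>. \<Sum>B | B \<in> \<pi> \<and> Q B. g B (\<pi> - {B}))"
proof -
  have fin: "finite {\<sigma>. partition_on (S - B) \<sigma>}" for B
    using assms by (intro finitely_many_partition_on) auto
  have fin': "finite {B. B \<in> \<pi> \<and> Q B}" if "partition_on S \<pi>" for \<pi>
    using finite_elements[OF assms that] by auto
  have remove: "partition_on (S - B) (\<pi> - {B})" "B \<subseteq> S" "B \<noteq> {}"
    if "partition_on S \<pi>" "B \<in> \<pi>" for B \<pi>
  proof -
    have "disjnt B (\<Union>(\<pi> - {B}))"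
      using that by (auto simp: partition_on_def disjoint_def disjnt_def)
    from partition_on_insert[OF this, of S] that
    show "partition_on (S - B) (\<pi> - {B})" "B \<subseteq> S" "B \<noteq> {}"
      by (simp_all add: insert_absorb)
  qed
  have add: "partition_on S (insert B \<sigma>)" "B \<notin> \<sigma>"
    if "partition_on (S - B) \<sigma>" "B \<subseteq> S" "B \<noteq> {}" for B \<sigma>
  proof -
    have "disjnt B (\<Union>\<sigma>)"
      using that by (auto simp: partition_on_def disjnt_def)
    then show "partition_on S (insert B \<sigma>)"
      using partition_on_insert that by blast
    show "B \<notin> \<sigma>"
      using that by (auto simp: partition_on_def)
  qed
  have "(\<Sum>B | B \<subseteq> S \<and> B \<noteq> {} \<and> Q B. \<Sum>\<sigma> | partition_on (S - B) \<sigma>. g B \<sigma>)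
      = (\<Sum>(B, \<sigma>)\<in>Sigma {B. B \<subseteq> S \<and> B \<noteq> {} \<and> Q B} (\<lambda>B. {\<sigma>. partition_on (S - B) \<sigma>}). g B \<sigma>)"
    using assms fin by (subst sum.Sigma) auto
  also have "\<dots> = (\<Sum>(\<pi>, B)\<in>Sigma {\<pi>. partition_on S \<pi>} (\<lambda>\<pi>. {B. B \<in> \<pi> \<and> Q B}). g B (\<pi> - {B}))"
    by (rule sum.reindex_bij_witness[where
          i="\<lambda>(\<pi>, B). (B, \<pi> - {B})" and j="\<lambda>(B, \<sigma>). (insert B \<sigma>, B)"])
       (clarsimp simp: remove add insert_absorb)+
  also have "\<dots> = (\<Sum>\<pi> | partition_on S \<pi>. \<Sum>B | B \<in> \<pi> \<and> Q B. g B (\<pi> - {B}))"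
    using assms fin' by (subst sum.Sigma) (auto intro: finitely_many_partition_on)
  finally show ?thesis .
qed

text \<open>Marking one of the \<open>n\<close> blocks of a partition produces a factor \<open>n\<close>, which turns
  \<open>(n - 1)!\<close> into \<open>n!\<close>; the sign change gives the cancellation.\<close>

lemma subset_conv_inverse_left:
  assumes "finite S" "m {} = 1"
  shows "subset_conv (subset_conv_inverse m) m S = subset_conv_unit S"
proof (cases "S = {}")
  case True
  then show ?thesis
    using assms by (simp add: subset_conv_def subset_conv_inverse_def subset_conv_unit_def partition_on_empty)
next
  case False
  have "subset_conv m (subset_conv_inverse m) S
      = subset_conv_inverse m S + (\<Sum>B\<in>Pow S - {{}}. m B * subset_conv_inverse m (S - B))"
    unfolding subset_conv_def using assms by (subst sum.remove[of _ "{}"]) auto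
  also have "(\<Sum>B\<in>Pow S - {{}}. m B * subset_conv_inverse m (S - B))
      = (\<Sum>B | B \<subseteq> S \<and> B \<noteq> {} \<and> True. \<Sum>\<sigma> | partition_on (S - B) \<sigma>.
          m B * ((-1) ^ card \<sigma> * fact (card \<sigma>) * (\<Prod>C\<in>\<sigma>. m C)))"
    unfolding subset_conv_inverse_def by (intro sum.cong) (auto simp: sum_distrib_left)
  also have "\<dots> = (\<Sum>\<pi> | partition_on S \<pi>. \<Sum>B | B \<in> \<pi> \<and> True.
          m B * ((-1) ^ card (\<pi> - {B}) * fact (card (\<pi> - {B})) * (\<Prod>C\<in>\<pi> - {B}. m C)))"
    by (rule sum_partition_split_block[OF assms(1)])
  also have "\<dots> = (\<Sum>\<pi> | partition_on S \<pi>. - ((-1) ^ card \<pi> * fact (card \<pi>) * (\<Prod>B\<in>\<pi>. m B)))"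
  proof (intro sum.cong refl)
    fix \<pi> assume "\<pi> \<in> {\<pi>. partition_on S \<pi>}"
    then have \<pi>: "partition_on S \<pi>" by simp
    then have fin: "finite \<pi>" and ne: "\<pi> \<noteq> {}"
      using finite_elements[OF assms(1)] False by (auto simp: partition_on_def)
    then obtain n where n: "card \<pi> = Suc n"
      by (metis card_eq_0_iff not0_implies_Suc)
    have "m B * ((-1) ^ card (\<pi> - {B}) * fact (card (\<pi> - {B})) * (\<Prod>C\<in>\<pi> - {B}. m C))
        = (-1) ^ n * fact n * (\<Prod>B\<in>\<pi>. m B)" if "B \<in> \<pi>" for B
      using that fin n by (simp add: prod.remove)
    then have "(\<Sum>B | B \<in> \<pi> \<and> True.
          m B * ((-1) ^ card (\<pi> - {B}) * fact (card (\<pi> - {B})) * (\<Prod>C\<in>\<pi> - {B}. m C)))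
        = of_nat (card \<pi>) * ((-1) ^ n * fact n * (\<Prod>B\<in>\<pi>. m B))"
      by simp
    also have "\<dots> = - ((-1) ^ card \<pi> * fact (card \<pi>) * (\<Prod>B\<in>\<pi>. m B))"
      by (simp add: n algebra_simps)
    finally show "(\<Sum>B | B \<in> \<pi> \<and> True.
          m B * ((-1) ^ card (\<pi> - {B}) * fact (card (\<pi> - {B})) * (\<Prod>C\<in>\<pi> - {B}. m C)))
        = - ((-1) ^ card \<pi> * fact (card \<pi>) * (\<Prod>B\<in>\<pi>. m B))" .
  qed
  also have "\<dots> = - subset_conv_inverse m S"
    by (simp add: subset_conv_inverse_def sum_negf)
  finally show ?thesis
    using False by (simp add: subset_conv_commute[of m] subset_conv_unit_def)
qed

text \<open>The logarithmic derivative: each partition has exactly one block that contains \<open>s\<close>, and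
  removing it turns the coefficient of the cumulant into that of the inverse.\<close>

lemma containing_set_cumulant:
  assumes "finite S"
  shows "containing s (set_cumulant m) S = subset_conv (containing s m) (subset_conv_inverse m) S"
proof (cases "s \<in> S")
  case False
  then show ?thesis
    by (auto simp: containing_def subset_conv_def intro!: sum.neutral)
next
  case True
  have "subset_conv (containing s m) (subset_conv_inverse m) S
      = (\<Sum>B | B \<subseteq> S \<and> B \<noteq> {} \<and> s \<in> B. m B * subset_conv_inverse m (S - B))"
    unfolding subset_conv_def using assms
    by (intro sum.mono_neutral_cong_right) (auto simp: containing_def)
  also have "\<dots> = (\<Sum>B | B \<subseteq> S \<and> B \<noteq> {} \<and> s \<in> B. \<Sum>\<sigma> | partition_on (S - B) \<sigma>.
          m B * ((-1) ^ card \<sigma> * fact (card \<sigma>) * (\<Prod>C\<in>\<sigma>. m C)))"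
    unfolding subset_conv_inverse_def by (simp add: sum_distrib_left)
  also have "\<dots> = (\<Sum>\<pi> | partition_on S \<pi>. \<Sum>B | B \<in> \<pi> \<and> s \<in> B.
          m B * ((-1) ^ card (\<pi> - {B}) * fact (card (\<pi> - {B})) * (\<Prod>C\<in>\<pi> - {B}. m C)))"
    by (rule sum_partition_split_block[OF assms])
  also have "\<dots> = set_cumulant m S"
    unfolding set_cumulant_def
  proof (intro sum.cong refl)
    fix \<pi> assume "\<pi> \<in> {\<pi>. partition_on S \<pi>}"
    then have \<pi>: "partition_on S \<pi>" by simp
    then have fin: "finite \<pi>"
      using finite_elements[OF assms] by auto
    obtain B where B: "B \<in> \<pi>" "s \<in> B"
      using True partition_onD1[OF \<pi>] by auto
    have "{B. B \<in> \<pi> \<and> s \<in> B} = {B}"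
      using B partition_onD2[OF \<pi>] by (auto simp: disjoint_def)
    then show "(\<Sum>B | B \<in> \<pi> \<and> s \<in> B.
          m B * ((-1) ^ card (\<pi> - {B}) * fact (card (\<pi> - {B})) * (\<Prod>C\<in>\<pi> - {B}. m C)))
        = (-1) ^ (card \<pi> - 1) * fact (card \<pi> - 1) * (\<Prod>B\<in>\<pi>. m B)"
      using B fin by (simp add: prod.remove)
  qed
  finally show ?thesis
    using True by (simp add: containing_def)
qed

lemma subset_conv_containing_set_cumulant:
  assumes "finite S" "m {} = 1"
  shows "subset_conv (containing s (set_cumulant m)) m S = containing s m S"
proof -
  have "subset_conv (containing s (set_cumulant m)) m S = subset_conv (subset_conv (containing s m) (subset_conv_inverse m)) m S"
    using assms by (intro subset_conv_cong containing_set_cumulant) (auto intro: finite_subset)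
  also have "\<dots> = subset_conv (containing s m) (subset_conv (subset_conv_inverse m) m) S"
    by (rule subset_conv_assoc[OF assms(1)])
  also have "\<dots> = subset_conv (containing s m) subset_conv_unit S"
    using assms by (intro subset_conv_cong subset_conv_inverse_left) (auto intro: finite_subset)
  finally show ?thesis
    using assms by (simp add: subset_conv_commute[of _ subset_conv_unit] subset_conv_unit_left)
qed

text \<open>The logarithm turns convolutions into sums. Both sides have the same derivative, because
  \<open>containing s\<close> is a derivation; and at sets that contain \<open>s\<close> a set function agrees with its
  derivative.\<close>

lemma set_cumulant_subset_conv:
  assumes "finite S" "S \<noteq> {}" "m {} = 1" "m' {} = 1"
    and m''_eq: "\<And>A. A \<subseteq> S \<Longrightarrow> m'' A = subset_conv m m' A"
  shows "set_cumulant m'' S = set_cumulant m S + set_cumulant m' S"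
proof -
  obtain s where s: "s \<in> S"
    using assms by auto
  have m'': "m'' {} = 1"
    using m''_eq[of "{}"] assms by (simp add: subset_conv_def)
  let ?k = "containing s (set_cumulant m)" and ?k' = "containing s (set_cumulant m')"
    and ?k'' = "containing s (set_cumulant m'')"
  have fin: "finite A" if "A \<subseteq> S" for A
    using assms that finite_subset by blast
  have *: "subset_conv ?k'' m'' A = subset_conv (\<lambda>B. ?k B + ?k' B) m'' A" if A: "A \<subseteq> S" for A
  proof -
    note [simp] = fin[OF A]
    have sub: "subset_conv f m'' A = subset_conv f (subset_conv m m') A" for f
      using A by (intro subset_conv_cong m''_eq) auto
    have "subset_conv ?k'' m'' A = containing s m'' A"
      using m'' by (intro subset_conv_containing_set_cumulant) auto
    also have "\<dots> = containing s (subset_conv m m') A"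
      using m''_eq A by (simp add: containing_def)
    also have "\<dots> = subset_conv (containing s m) m' A + subset_conv (containing s m') m A"
      by (simp add: containing_subset_conv subset_conv_commute[of m])
    also have "subset_conv (containing s m) m' A = subset_conv (subset_conv ?k m) m' A"
      using assms A by (intro subset_conv_cong subset_conv_containing_set_cumulant[symmetric] fin) auto
    also have "\<dots> = subset_conv ?k (subset_conv m m') A"
      by (simp add: subset_conv_assoc)
    also have "subset_conv (containing s m') m A = subset_conv (subset_conv ?k' m') m A"
      using assms A by (intro subset_conv_cong subset_conv_containing_set_cumulant[symmetric] fin) auto
    also have "\<dots> = subset_conv ?k' (subset_conv m' m) A"
      by (simp add: subset_conv_assoc)
    also have "\<dots> = subset_conv ?k' (subset_conv m m') A"
      by (intro subset_conv_cong refl subset_conv_commute)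
    finally show ?thesis
      by (simp add: sub subset_conv_add_left)
  qed
  \<comment> \<open>The factor \<open>m''\<close> common to both sides of the previous identity is invertible.\<close>
  have cancel: "subset_conv (subset_conv f m'') (subset_conv_inverse m'') S = f S" for f
  proof -
    have "subset_conv (subset_conv f m'') (subset_conv_inverse m'') S = subset_conv f (subset_conv m'' (subset_conv_inverse m'')) S"
      using assms(1) by (rule subset_conv_assoc)
    also have "\<dots> = subset_conv f subset_conv_unit S"
      using m'' fin by (intro subset_conv_cong) (auto simp: subset_conv_commute[of m''] subset_conv_inverse_left)
    finally show ?thesis
      using assms by (simp add: subset_conv_commute[of _ subset_conv_unit] subset_conv_unit_left)
  qed
  have "?k'' S = subset_conv (subset_conv ?k'' m'') (subset_conv_inverse m'') S"
    by (simp add: cancel)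
  also have "\<dots> = subset_conv (subset_conv (\<lambda>B. ?k B + ?k' B) m'') (subset_conv_inverse m'') S"
    by (rule subset_conv_cong) (simp_all add: *)
  also have "\<dots> = ?k S + ?k' S"
    by (rule cancel)
  finally show ?thesis
    using s by (simp add: containing_def)
qed

text \<open>The cumulant is linear in the values of \<open>m\<close> at the sets containing \<open>s\<close>, since each partition
  uses exactly one such value.\<close>

lemma set_cumulant_linear:
  assumes "finite S" "s \<in> S"
    and s: "\<And>A. A \<subseteq> S \<Longrightarrow> s \<in> A \<Longrightarrow> m A = (\<Sum>i\<in>I. a i * m' i A)"
    and not_s: "\<And>A i. A \<subseteq> S \<Longrightarrow> s \<notin> A \<Longrightarrow> i \<in> I \<Longrightarrow> m' i A = m A"
  shows "set_cumulant m S = (\<Sum>i\<in>I. a i * set_cumulant (m' i) S)"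
proof -
  have inv: "subset_conv_inverse (m' i) (S - A) = subset_conv_inverse m (S - A)" if "s \<in> A" "i \<in> I" for A i
  proof -
    have "(\<Prod>B\<in>\<pi>. m' i B) = (\<Prod>B\<in>\<pi>. m B)" if "partition_on (S - A) \<pi>" for \<pi>
      using partition_onD1[OF that] \<open>s \<in> A\<close> \<open>i \<in> I\<close> by (intro prod.cong not_s) auto
    then show ?thesis
      unfolding subset_conv_inverse_def by (intro sum.cong) auto
  qed
  have "subset_conv (containing s m) (subset_conv_inverse m) S
      = (\<Sum>A\<in>Pow S. \<Sum>i\<in>I. a i * (containing s (m' i) A * subset_conv_inverse (m' i) (S - A)))"
    unfolding subset_conv_def using inv s
    by (intro sum.cong) (auto simp: containing_def sum_distrib_right mult.assoc)
  also have "\<dots> = (\<Sum>i\<in>I. a i * subset_conv (containing s (m' i)) (subset_conv_inverse (m' i)) S)"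
    unfolding subset_conv_def by (subst sum.swap) (simp add: sum_distrib_left)
  finally show ?thesis
    using assms(2) by (simp only: containing_set_cumulant[OF assms(1), symmetric])
      (simp add: containing_def)
qed

section \<open>A norm contracted by a stable matrix\<close>

text \<open>All roots of a polynomial of least degree that annihilates the complexified matrix are
  eigenvalues, so they have negative real parts. The norm is built by recursion over the factors of
  this polynomial; no Jordan form is needed.\<close>

lemma norm_vector_smult: "norm (c *s (v :: complex^'n)) = cmod c * norm v"
  by (simp add: norm_vec_def norm_mult L2_set_right_distrib)

text \<open>The vector \<open>p(A) v\<close> for a complex polynomial \<open>p\<close>.\<close>

definition poly_apply :: "complex^'n^'n \<Rightarrow> complex poly \<Rightarrow> complex^'n \<Rightarrow> complex^'n" where
  "poly_apply A p v = (\<Sum>i\<le>degree p. coeff p i *s (((*v) A ^^ i) v))"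

lemma poly_apply_0 [simp]: "poly_apply A 0 v = 0"
  by (simp add: poly_apply_def)

lemma poly_apply_pCons: "poly_apply A (pCons a p) v = a *s v + A *v poly_apply A p v"
proof (cases "p = 0")
  case False
  then have "poly_apply A (pCons a p) v = (\<Sum>i\<le>Suc (degree p). coeff (pCons a p) i *s (((*v) A ^^ i) v))"
    by (simp add: poly_apply_def)
  also have "\<dots> = a *s v + (\<Sum>i\<le>degree p. coeff p i *s (A *v (((*v) A ^^ i) v)))"
    by (subst sum.atMost_Suc_shift) simp
  also have "(\<Sum>i\<le>degree p. coeff p i *s (A *v (((*v) A ^^ i) v))) = A *v poly_apply A p v"
    by (simp add: poly_apply_def linear_sum[OF matrix_vector_mul_linear] vector_scalar_commute)
  finally show ?thesis .
qed (simp add: poly_apply_def)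

lemma poly_apply_add: "poly_apply A (p + q) v = poly_apply A p v + poly_apply A q v"
  by (induction p q rule: poly_induct2)
     (simp_all add: poly_apply_pCons vector_sadd_rdistrib matrix_vector_right_distrib)

lemma poly_apply_sum: "poly_apply A (\<Sum>i\<in>I. p i) v = (\<Sum>i\<in>I. poly_apply A (p i) v)"
  by (induction I rule: infinite_finite_induct) (simp_all add: poly_apply_add)

lemma poly_apply_smult: "poly_apply A (smult c p) v = c *s poly_apply A p v"
  by (induction p)
     (simp_all add: poly_apply_pCons vector_add_ldistrib vector_scalar_commute)

lemma poly_apply_monom: "poly_apply A (monom c i) v = c *s (((*v) A ^^ i) v)"
  by (induction i) (simp_all add: monom_0 monom_Suc poly_apply_pCons vector_scalar_commute)

lemma poly_apply_commute:
  "poly_apply A p (A *v v - c *s v) = A *v poly_apply A p v - c *s poly_apply A p v"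
proof (induction p)
  case (pCons a p)
  then show ?case
    by (simp add: poly_apply_pCons matrix_vector_mult_diff_distrib matrix_vector_right_distrib
       vector_scalar_commute vector_add_ldistrib vector_ssub_ldistrib mult.commute)
qed simp

lemma poly_apply_linear_factor:
  "poly_apply A ([:-c, 1:] * p) v = A *v poly_apply A p v - c *s poly_apply A p v"
proof -
  have "[:-c, 1:] * p = pCons 0 p + smult (-c) p"
    by simp
  then show ?thesis
    by (simp only: poly_apply_pCons poly_apply_add poly_apply_smult) simp
qed

text \<open>The space of complex matrices has finite real dimension, so the powers of \<open>A\<close> are linearly
  dependent. Two equal powers form a separate case, as linear dependence is a property of sets.\<close>

lemma exists_annihilating_poly:
  fixes A :: "complex^'n^'n"
  shows "\<exists>p. p \<noteq> 0 \<and> (\<forall>v. poly_apply A p v = 0)"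
proof -
  define f where "f i = ((**) A ^^ i) (mat 1)" for i
  define N where "N = DIM(complex^'n^'n)"
  have f: "f i *v v = ((*v) A ^^ i) v" for i v
    by (induction i) (simp_all add: f_def matrix_vector_mul_assoc[symmetric])
  have "\<exists>c :: nat \<Rightarrow> real. (\<exists>i\<le>N. c i \<noteq> 0) \<and> (\<Sum>i\<le>N. c i *\<^sub>R f i) = 0"
  proof (cases "inj_on f {..N}")
    case True
    then have "card (f ` {..N}) > N"
      by (simp add: card_image)
    then have "dependent (f ` {..N})"
      unfolding N_def by (intro dependent_biggerset) simp
    then obtain u where u: "\<exists>B\<in>f ` {..N}. u B \<noteq> 0" "(\<Sum>B\<in>f ` {..N}. u B *\<^sub>R B) = 0"
      by (subst (asm) real_vector.dependent_finite) auto
    then show ?thesis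
      using True by (intro exI[of _ "u \<circ> f"]) (auto simp: sum.reindex)
  next
    case False
    then obtain i j where ij: "i \<le> N" "j \<le> N" "i \<noteq> j" "f i = f j"
      by (auto simp: inj_on_def)
    have "(\<Sum>k\<le>N. (of_bool (k = i) - of_bool (k = j)) *\<^sub>R f k)
        = (\<Sum>k\<le>N. if k = i then f k else 0) - (\<Sum>k\<le>N. if k = j then f k else 0)"
      unfolding sum_subtractf[symmetric] by (intro sum.cong) auto
    also have "\<dots> = 0"
      using ij by simp
    finally show ?thesis
      using ij by (intro exI[of _ "\<lambda>k. of_bool (k = i) - of_bool (k = j)"]) auto
  qed
  then obtain c :: "nat \<Rightarrow> real" and k where k: "k \<le> N" "c k \<noteq> 0" and 0: "(\<Sum>i\<le>N. c i *\<^sub>R f i) = 0"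
    by auto
  define p where "p = (\<Sum>i\<le>N. monom (complex_of_real (c i)) i)"
  have "coeff p k = (\<Sum>i\<le>N. if i = k then complex_of_real (c i) else 0)"
    by (simp add: p_def coeff_sum)
  then have "coeff p k = of_real (c k)"
    using k by simp
  then have "p \<noteq> 0"
    using k by auto
  moreover have "poly_apply A p v = 0" for v
  proof -
    have scale: "complex_of_real a *s w = a *\<^sub>R w" for a and w :: "complex^'n"
      by (simp add: vec_eq_iff complex_eq_iff)
    have mult: "(a *\<^sub>R B) *v w = a *\<^sub>R (B *v w)" for a B and w :: "complex^'n"
      by (simp add: vec_eq_iff matrix_vector_mult_def scaleR_right.sum)
    have "poly_apply A p v = (\<Sum>i\<le>N. (c i *\<^sub>R f i) *v v)"
      by (simp add: p_def poly_apply_sum poly_apply_monom f scale mult)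
    also have "\<dots> = (\<Sum>i\<le>N. c i *\<^sub>R f i) *v v"
      by (induction N) (simp_all add: matrix_vector_mult_add_rdistrib)
    finally show ?thesis
      using 0 by simp
  qed
  ultimately show ?thesis
    by blast
qed

text \<open>If \<open>c\<close> is a root of an annihilating polynomial \<open>p = (x - c) q\<close> of least degree, then \<open>q(A)\<close>
  is not zero, and its nonzero values are eigenvectors for \<open>c\<close>.\<close>

lemma exists_annihilating_poly_eigenvalues:
  fixes A :: "complex^'n^'n"
  obtains p where "p \<noteq> 0" "\<And>v. poly_apply A p v = 0"
    "\<And>c. poly p c = 0 \<Longrightarrow> \<exists>v. v \<noteq> 0 \<and> A *v v = c *s v"
proof -
  let ?P = "\<lambda>p. p \<noteq> 0 \<and> (\<forall>v. poly_apply A p v = 0)"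
  obtain p where p: "?P p" and min: "\<And>q. ?P q \<Longrightarrow> degree p \<le> degree q"
    using exists_annihilating_poly[of A] ex_has_least_nat[of ?P _ degree] by blast
  show thesis
  proof (rule that[of p])
    fix c assume "poly p c = 0"
    then obtain q where q: "p = [:-c, 1:] * q"
      by (auto simp: poly_eq_0_iff_dvd)
    with p have "q \<noteq> 0" by auto
    then have "degree p = Suc (degree q)"
      unfolding q by (subst degree_mult_eq) auto
    with min[of q] \<open>q \<noteq> 0\<close> obtain v where v: "poly_apply A q v \<noteq> 0"
      by auto
    have "A *v poly_apply A q v - c *s poly_apply A q v = 0"
      using p unfolding q poly_apply_linear_factor by simp
    with v show "\<exists>v. v \<noteq> 0 \<and> A *v v = c *s v"
      by auto
  qed (use p in auto)
qed

text \<open>The product of the commuting factors \<open>A - c\<close> over a list of scalars \<open>c\<close>, applied to \<open>v\<close>.\<close>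

fun apply_factors :: "complex^'n^'n \<Rightarrow> complex list \<Rightarrow> complex^'n \<Rightarrow> complex^'n" where
  "apply_factors A [] v = v"
| "apply_factors A (c # cs) v = apply_factors A cs (A *v v - c *s v)"

lemma poly_apply_factors:
  assumes "p \<noteq> 0"
  shows "\<exists>a cs. a \<noteq> 0 \<and> (\<forall>c\<in>set cs. poly p c = 0) \<and>
    (\<forall>v. poly_apply A p v = a *s apply_factors A cs v)"
  using assms
proof (induction "degree p" arbitrary: p)
  case 0
  then obtain a where "p = [:a:]"
    by (metis degree_eq_zeroE)
  with 0 show ?case
    by (intro exI[of _ a] exI[of _ "[]"]) (simp add: poly_apply_pCons)
next
  case (Suc n)
  then have "\<not> constant (poly p)"
    by (simp add: constant_degree)
  then obtain c where c: "poly p c = 0"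
    using fundamental_theorem_of_algebra by blast
  then obtain q where q: "p = [:-c, 1:] * q"
    by (auto simp: poly_eq_0_iff_dvd)
  with Suc have "q \<noteq> 0" by auto
  then have "degree p = Suc (degree q)"
    unfolding q by (subst degree_mult_eq) auto
  with Suc \<open>q \<noteq> 0\<close> obtain a cs where *: "a \<noteq> 0" "\<forall>c\<in>set cs. poly q c = 0"
    "\<And>v. poly_apply A q v = a *s apply_factors A cs v"
    by (metis Suc_inject)
  have "poly_apply A p v = a *s apply_factors A (c # cs) v" for v
    unfolding q poly_apply_linear_factor poly_apply_commute[symmetric] by (simp add: *)
  then show ?case
    using * c q by (intro exI[of _ a] exI[of _ "c # cs"]) auto
qed

text \<open>The square of the modulus of \<open>1 + h z\<close> is \<open>1 + 2 h Re z + h\<^sup>2 \<bar>z\<bar>\<^sup>2\<close>. Half of the linear term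
  absorbs the quadratic one for small \<open>h\<close>; the other half gives the rate \<open>c = - Re z / 2\<close>.\<close>

lemma norm_one_plus_small:
  assumes "Re z < 0"
  obtains c h0 where "0 < c" "0 < h0" "\<And>h. 0 < h \<Longrightarrow> h \<le> h0 \<Longrightarrow> cmod (1 + of_real h * z) \<le> 1 - c * h"
proof (rule that)
  define c where "c = - Re z / 2"
  define h0 where "h0 = min (1 / c) (- Re z / (1 + (cmod z)\<^sup>2))"
  have pos: "0 < 1 + (cmod z)\<^sup>2"
    by (simp add: add_pos_nonneg)
  show "0 < c" using assms by (simp add: c_def)
  moreover have "0 < - Re z / (1 + (cmod z)\<^sup>2)"
    using assms pos by (intro divide_pos_pos) auto
  ultimately show "0 < h0" by (simp add: h0_def)
  fix h assume h: "0 < h" "h \<le> h0"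
  then have "c * h \<le> 1"
    using pos_le_divide_eq[OF \<open>0 < c\<close>, of h 1] by (simp add: h0_def mult.commute)
  have "h * (1 + (cmod z)\<^sup>2) \<le> - Re z"
    using pos_le_divide_eq[OF pos, of h "- Re z"] h by (simp add: h0_def)
  then have "h * (h * (1 + (cmod z)\<^sup>2)) \<le> h * (- Re z)"
    using h by (intro mult_left_mono) auto
  have "(cmod (1 + of_real h * z))\<^sup>2 = 1 + 2 * h * Re z + h\<^sup>2 * (cmod z)\<^sup>2"
    unfolding cmod_power2 by (simp add: power2_eq_square algebra_simps)
  also have "\<dots> \<le> 1 + h * Re z"
  proof -
    have "h * (h * (1 + (cmod z)\<^sup>2)) = h * h + h\<^sup>2 * (cmod z)\<^sup>2"
      by (simp add: power2_eq_square algebra_simps)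
    with \<open>h * (h * (1 + (cmod z)\<^sup>2)) \<le> h * (- Re z)\<close> zero_le_square[of h] show ?thesis
      by linarith
  qed
  also have "\<dots> \<le> (1 - c * h)\<^sup>2"
    using zero_le_square[of "h * Re z"] by (simp add: c_def power2_eq_square algebra_simps)
  finally show "cmod (1 + of_real h * z) \<le> 1 - c * h"
    using \<open>c * h \<le> 1\<close> by - (rule power2_le_imp_le, simp_all)
qed

text \<open>For an annihilating product of factors the last term vanishes and \<open>V\<close> is contracted. With
  \<open>D v = A v - l v\<close> for the first scalar \<open>l\<close> of the list, \<open>v + h A v = (1 + h l) v + h D v\<close>, and \<open>D v\<close> evolves by the same
  recursion with the remaining factors. So the norm of \<open>v\<close> decays up to the error \<open>h \<parallel>D v\<parallel>\<close>, which the
  decay of a sufficiently large multiple of the norm of \<open>D v\<close> compensates.\<close>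

lemma complex_lyapunov_norm:
  fixes A :: "complex^'n^'n"
  assumes "\<forall>c\<in>set cs. Re c < 0"
  shows "\<exists>V b c h0 C. 0 < c \<and> 0 < h0 \<and> 0 \<le> C \<and> (\<forall>v. norm v \<le> V v \<and> V v \<le> b * norm v) \<and>
    (\<forall>v w. V (v + w) \<le> V v + V w) \<and>
    (\<forall>h v. 0 < h \<longrightarrow> h \<le> h0 \<longrightarrow>
      V (v + h *\<^sub>R (A *v v)) \<le> (1 - c * h) * V v + h * C * norm (apply_factors A cs v))"
  using assms
proof (induction cs)
  case Nil
  obtain B where B: "norm (A *v v) \<le> norm v * B" for v
    using bounded_linear.bounded[OF matrix_vector_mul_bounded_linear, of A] by auto
  have "norm (v + h *\<^sub>R (A *v v)) \<le> (1 - 1 * h) * norm v + h * (1 + \<bar>B\<bar>) * norm v" if "0 < h" for h v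
  proof -
    have "norm (v + h *\<^sub>R (A *v v)) \<le> norm v + h * norm (A *v v)"
      using that by (intro order_trans[OF norm_triangle_ineq]) simp
    also have "\<dots> \<le> norm v + h * (norm v * \<bar>B\<bar>)"
      using that by (intro add_mono mult_left_mono order_trans[OF B]) auto
    finally show ?thesis by (simp add: algebra_simps)
  qed
  then show ?case
    by (intro exI[of _ norm] exI[of _ "1 :: real"] exI[of _ "1 + \<bar>B\<bar>"])
       (simp add: norm_triangle_ineq)
next
  case (Cons l cs)
  then have "\<forall>c\<in>set cs. Re c < 0" by simp
  from Cons.IH[OF this] obtain V b c h0 C where c: "0 < c" "0 < h0" "0 \<le> C"
    and V': "\<forall>v. norm v \<le> V v \<and> V v \<le> b * norm v" "\<forall>v w. V (v + w) \<le> V v + V w"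
    and contr': "\<forall>h v. 0 < h \<longrightarrow> h \<le> h0 \<longrightarrow>
      V (v + h *\<^sub>R (A *v v)) \<le> (1 - c * h) * V v + h * C * norm (apply_factors A cs v)"
    by blast
  have V: "\<And>v. norm v \<le> V v" "\<And>v. V v \<le> b * norm v" "\<And>v w. V (v + w) \<le> V v + V w"
    using V' by simp_all
  have contr: "V (v + h *\<^sub>R (A *v v)) \<le> (1 - c * h) * V v + h * C * norm (apply_factors A cs v)"
    if "0 < h" "h \<le> h0" for h v
    using contr' that by simp
  obtain c' h1 where c': "0 < c'" "0 < h1" and
    l: "\<And>h. 0 < h \<Longrightarrow> h \<le> h1 \<Longrightarrow> cmod (1 + of_real h * l) \<le> 1 - c' * h"
    using norm_one_plus_small[of l] Cons.prems by auto
  define D where "D v = A *v v - l *s v" for v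
  have "linear D"
    unfolding D_def
    by (intro linear_compose_sub matrix_vector_mul_linear linearI)
       (simp_all add: vec_eq_iff algebra_simps)
  then interpret D: linear D .
  obtain B where B: "norm (D v) \<le> norm v * B" "0 \<le> B" for v
    using bounded_linear.nonneg_bounded[OF linear_conv_bounded_linear[THEN iffD1, OF \<open>linear D\<close>]] by auto
  have comm: "D (v + h *\<^sub>R (A *v v)) = D v + h *\<^sub>R (A *v D v)" for h v
  proof -
    have "D (A *v v) = A *v D v"
      by (simp add: D_def matrix_vector_mult_diff_distrib vector_scalar_commute)
    then show ?thesis
      by (simp add: D.add D.scale)
  qed
  have V0: "0 \<le> V v" for v
    by (rule order_trans[OF norm_ge_zero V(1)])
  have b0: "0 \<le> b"
  proof (rule ccontr)
    assume "\<not> 0 \<le> b"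
    then have "b * norm (1 :: complex^'n) < 0"
      by (intro mult_neg_pos) auto
    with V0[of 1] V(2)[of 1] show False
      by linarith
  qed
  \<comment> \<open>With this weight, \<open>\<beta> V (D v)\<close> loses \<open>2 h V (D v)\<close>: one half pays for the error, the other
    half remains as decay.\<close>
  define \<beta> where "\<beta> = 2 / c"
  have \<beta>: "0 < \<beta>" "\<beta> * c = 2" using c by (auto simp: \<beta>_def)
  define W where "W v = norm v + \<beta> * V (D v)" for v
  define c2 where "c2 = min c' (c / 2)"
  have "W (v + h *\<^sub>R (A *v v)) \<le> (1 - c2 * h) * W v + h * (\<beta> * C) * norm (apply_factors A (l # cs) v)"
    if h: "0 < h" "h \<le> min h0 h1" for h v
  proof -
    have scale: "h *\<^sub>R w = complex_of_real h *s w" for w :: "complex^'n"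
      by (simp add: vec_eq_iff complex_eq_iff)
    have "v + h *\<^sub>R (A *v v) = (1 + of_real h * l) *s v + h *\<^sub>R D v"
      by (simp add: D_def scale vector_ssub_ldistrib vector_sadd_rdistrib)
    then have "norm (v + h *\<^sub>R (A *v v)) \<le> norm ((1 + of_real h * l) *s v) + norm (h *\<^sub>R D v)"
      by (metis norm_triangle_ineq)
    also have "\<dots> = cmod (1 + of_real h * l) * norm v + h * norm (D v)"
      using h by (simp only: norm_vector_smult norm_scaleR abs_of_pos)
    also have "\<dots> \<le> (1 - c' * h) * norm v + h * V (D v)"
      using h l V by (intro add_mono mult_right_mono mult_left_mono) auto
    finally have 1: "norm (v + h *\<^sub>R (A *v v)) \<le> (1 - c' * h) * norm v + h * V (D v)" .
    have "\<beta> * V (D v + h *\<^sub>R (A *v D v))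
        \<le> \<beta> * ((1 - c * h) * V (D v) + h * C * norm (apply_factors A cs (D v)))"
      using h \<beta> by (intro mult_left_mono contr) auto
    also have "\<dots> = \<beta> * V (D v) - 2 * h * V (D v) + h * (\<beta> * C) * norm (apply_factors A cs (D v))"
      using \<beta>(2) by (simp add: algebra_simps)
    finally have 2: "\<beta> * V (D v + h *\<^sub>R (A *v D v))
        \<le> \<beta> * V (D v) - 2 * h * V (D v) + h * (\<beta> * C) * norm (apply_factors A cs (D v))" .
    have "c2 * h * norm v \<le> c' * h * norm v"
      using h by (intro mult_right_mono) (auto simp: c2_def)
    moreover have "c2 * h * (\<beta> * V (D v)) \<le> c / 2 * h * (\<beta> * V (D v))"
      using h V0 \<beta> by (intro mult_right_mono) (auto simp: c2_def)
    moreover have "c / 2 * h * (\<beta> * V (D v)) = h * V (D v)"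
      using c by (simp add: \<beta>_def)
    ultimately have 3: "c2 * h * norm v \<le> c' * h * norm v" "c2 * h * (\<beta> * V (D v)) \<le> h * V (D v)"
      by linarith+
    have "a + b \<le> (1 - c2 * h) * (n + \<beta> * y) + h * (\<beta> * C) * z"
      if "a \<le> (1 - c' * h) * n + h * y" "b \<le> \<beta> * y - 2 * h * y + h * (\<beta> * C) * z"
        "c2 * h * n \<le> c' * h * n" "c2 * h * (\<beta> * y) \<le> h * y" for a b n y z :: real
      using that by (simp add: algebra_simps)
    from this[OF 1 2 3] show ?thesis
      by (simp only: W_def comm apply_factors.simps D_def[symmetric])
  qed
  moreover have "norm v \<le> W v" for v
    using V0 \<beta> by (simp add: W_def)
  moreover have "W v \<le> (1 + \<beta> * (b * B)) * norm v" for v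
  proof -
    have "V (D v) \<le> b * (norm v * B)"
      by (rule order_trans[OF V(2) mult_left_mono[OF B(1) b0]])
    then have "\<beta> * V (D v) \<le> \<beta> * (b * (norm v * B))"
      using \<beta> by (intro mult_left_mono) auto
    then show ?thesis
      by (simp add: W_def algebra_simps)
  qed
  moreover have "W (v + w) \<le> W v + W w" for v w
  proof -
    have "\<beta> * V (D v + D w) \<le> \<beta> * (V (D v) + V (D w))"
      using \<beta> V by (intro mult_left_mono) auto
    then show ?thesis
      using norm_triangle_ineq[of v w] by (simp add: W_def D.add algebra_simps)
  qed
  ultimately show ?case
    using c c' \<beta>
    by - (rule exI[of _ W], rule exI[of _ "1 + \<beta> * (b * B)"], rule exI[of _ c2],
        rule exI[of _ "min h0 h1"], rule exI[of _ "\<beta> * C"],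
        simp add: c2_def del: apply_factors.simps)
qed

lemma stable_matrix_lyapunov_norm:
  fixes M :: "real^'n^'n"
  assumes "stable_matrix M"
  obtains V b c h0 where "0 < c" "0 < h0" "\<And>x. norm x \<le> V x" "\<And>x. V x \<le> b * norm x"
    "\<And>x y. V (x + y) \<le> V x + V y"
    "\<And>h x. 0 < h \<Longrightarrow> h \<le> h0 \<Longrightarrow> V (x + h *\<^sub>R (M *v x)) \<le> (1 - c * h) * V x"
proof -
  define A where "A = (\<chi> i j. complex_of_real (M $ i $ j))"
  define \<iota> :: "real^'n \<Rightarrow> complex^'n" where "\<iota> x = (\<chi> i. complex_of_real (x $ i))" for x
  have norm_\<iota>: "norm (\<iota> x) = norm x" for x
    by (simp add: norm_vec_def \<iota>_def)
  have \<iota>_add: "\<iota> (x + y) = \<iota> x + \<iota> y" and \<iota>_scale: "\<iota> (h *\<^sub>R x) = h *\<^sub>R \<iota> x" for x y h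
    by (simp_all add: \<iota>_def vec_eq_iff complex_eq_iff)
  have \<iota>_M: "\<iota> (M *v x) = A *v \<iota> x" for x
    by (simp add: \<iota>_def A_def vec_eq_iff matrix_vector_mult_def)
  obtain p where p: "p \<noteq> 0" "\<And>v. poly_apply A p v = 0"
    "\<And>c. poly p c = 0 \<Longrightarrow> \<exists>v. v \<noteq> 0 \<and> A *v v = c *s v"
    using exists_annihilating_poly_eigenvalues[of A] by blast
  have neg: "Re c < 0" if "poly p c = 0" for c
    using assms p(3)[OF that] by (auto simp: stable_matrix_def eigenvalue_def A_def)
  obtain a cs where a: "a \<noteq> 0" and cs: "\<forall>c\<in>set cs. poly p c = 0"
    and eq: "\<And>v. poly_apply A p v = a *s apply_factors A cs v"
    using poly_apply_factors[OF p(1), of A] by blast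
  have zero: "apply_factors A cs v = 0" for v
    using eq[of v] p(2)[of v] a by simp
  have "\<forall>c\<in>set cs. Re c < 0"
    using cs neg by blast
  from complex_lyapunov_norm[OF this, of A] obtain V b c h0 C where c: "0 < c" "0 < h0" "0 \<le> C"
    and V': "\<forall>v. norm v \<le> V v \<and> V v \<le> b * norm v" "\<forall>v w. V (v + w) \<le> V v + V w"
    and contr': "\<forall>h v. 0 < h \<longrightarrow> h \<le> h0 \<longrightarrow>
      V (v + h *\<^sub>R (A *v v)) \<le> (1 - c * h) * V v + h * C * norm (apply_factors A cs v)"
    by blast
  show thesis
  proof (rule that[of c h0 "V \<circ> \<iota>" b])
    show "norm x \<le> (V \<circ> \<iota>) x" "(V \<circ> \<iota>) x \<le> b * norm x" for x
      using V'(1)[rule_format, of "\<iota> x"] by (simp_all add: norm_\<iota>)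
    show "(V \<circ> \<iota>) (x + y) \<le> (V \<circ> \<iota>) x + (V \<circ> \<iota>) y" for x y
      using V'(2) by (simp add: \<iota>_add)
    show "(V \<circ> \<iota>) (x + h *\<^sub>R (M *v x)) \<le> (1 - c * h) * (V \<circ> \<iota>) x" if "0 < h" "h \<le> h0" for h x
      using contr'[rule_format, OF that, of "\<iota> x"] by (simp add: \<iota>_add \<iota>_scale \<iota>_M zero)
  qed (use c in auto)
qed

section \<open>Cumulants of random variables with finite moments\<close>

lemma prod_le_one_plus_sum_powers:
  fixes y :: "'i \<Rightarrow> real"
  assumes "finite B" "card B \<le> k" "\<And>i. i \<in> B \<Longrightarrow> 0 \<le> y i"
  shows "(\<Prod>i\<in>B. y i) \<le> 1 + (\<Sum>i\<in>B. y i ^ k)"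
proof -
  define c where "c = Max (insert 1 (y ` B))"
  have c: "1 \<le> c" "\<And>i. i \<in> B \<Longrightarrow> y i \<le> c"
    using assms(1) by (auto simp: c_def)
  have "c \<in> insert 1 (y ` B)"
    unfolding c_def using assms(1) by (intro Max_in) auto
  then have "c ^ k \<le> 1 + (\<Sum>i\<in>B. y i ^ k)"
  proof
    assume "c \<in> y ` B"
    then obtain i where "i \<in> B" "c = y i" by auto
    then show ?thesis
      using member_le_sum[of i B "\<lambda>i. y i ^ k"] assms by simp
  qed (use assms in \<open>auto intro!: sum_nonneg\<close>)
  moreover have "(\<Prod>i\<in>B. y i) \<le> (\<Prod>i\<in>B. c)"
    using assms c by (intro prod_mono) auto
  moreover have "c ^ card B \<le> c ^ k"
    using c assms by (intro power_increasing) auto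
  ultimately show ?thesis
    by simp
qed

text \<open>Expanding the product, every term other than the product of the \<open>b i\<close> contains a factor \<open>d i\<close>.
  Writing \<open>d i = \<epsilon> (d i / \<epsilon>)\<close> extracts at least one factor \<open>\<epsilon>\<close>; this replaces an appeal to
  Hoelder's inequality for several factors.\<close>

lemma prod_perturbation_le:
  fixes b d :: "'i \<Rightarrow> real"
  assumes "finite B" "card B \<le> k" "0 < \<epsilon>" "\<epsilon> \<le> 1"
  shows "\<bar>(\<Prod>i\<in>B. b i + d i) - (\<Prod>i\<in>B. b i)\<bar>
    \<le> \<epsilon> * (2 ^ card B * (1 + (\<Sum>i\<in>B. \<bar>b i\<bar> ^ k) + (\<Sum>i\<in>B. \<bar>d i / \<epsilon>\<bar> ^ k)))"
proof -
  let ?s = "1 + (\<Sum>i\<in>B. \<bar>b i\<bar> ^ k) + (\<Sum>i\<in>B. \<bar>d i / \<epsilon>\<bar> ^ k)"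
  have "(\<Prod>i\<in>B. b i + d i) = (\<Sum>X\<in>Pow B. (\<Prod>i\<in>X. d i) * (\<Prod>i\<in>B - X. b i))"
    using prod_add[OF assms(1), of d b] by (simp add: add.commute)
  also have "\<dots> = (\<Prod>i\<in>B. b i) + (\<Sum>X\<in>Pow B - {{}}. (\<Prod>i\<in>X. d i) * (\<Prod>i\<in>B - X. b i))"
    using assms(1) by (subst sum.remove[of _ "{}"]) auto
  finally have "\<bar>(\<Prod>i\<in>B. b i + d i) - (\<Prod>i\<in>B. b i)\<bar>
      \<le> (\<Sum>X\<in>Pow B - {{}}. \<bar>(\<Prod>i\<in>X. d i) * (\<Prod>i\<in>B - X. b i)\<bar>)"
    by simp
  also have "\<dots> \<le> (\<Sum>X\<in>Pow B - {{}}. \<epsilon> * ?s)"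
  proof (intro sum_mono)
    fix X assume X: "X \<in> Pow B - {{}}"
    then have finX: "finite X"
      using assms(1) by (auto intro: finite_subset)
    with X have "card X \<noteq> 0"
      by auto
    have "\<epsilon> ^ card X \<le> \<epsilon> ^ 1"
      using \<open>card X \<noteq> 0\<close> assms by (intro power_decreasing) auto
    have "\<bar>\<Prod>i\<in>X. d i\<bar> = \<epsilon> ^ card X * (\<Prod>i\<in>X. \<bar>d i / \<epsilon>\<bar>)"
      using assms by (simp add: abs_prod prod_dividef)
    also have "\<dots> \<le> \<epsilon> * (\<Prod>i\<in>X. \<bar>d i / \<epsilon>\<bar>)"
      using \<open>\<epsilon> ^ card X \<le> \<epsilon> ^ 1\<close> by (intro mult_right_mono prod_nonneg) auto
    finally have "\<bar>(\<Prod>i\<in>X. d i) * (\<Prod>i\<in>B - X. b i)\<bar>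
        \<le> \<epsilon> * (\<Prod>i\<in>X. \<bar>d i / \<epsilon>\<bar>) * (\<Prod>i\<in>B - X. \<bar>b i\<bar>)"
      unfolding abs_mult abs_prod by (intro mult_right_mono prod_nonneg) auto
    also have "\<dots> = \<epsilon> * (\<Prod>i\<in>B. if i \<in> X then \<bar>d i / \<epsilon>\<bar> else \<bar>b i\<bar>)"
      using X assms(1) by (simp add: prod.If_cases Int_absorb1 Diff_eq mult.assoc)
    also have "\<dots> \<le> \<epsilon> * (1 + (\<Sum>i\<in>B. (if i \<in> X then \<bar>d i / \<epsilon>\<bar> else \<bar>b i\<bar>) ^ k))"
      using assms by (intro mult_left_mono prod_le_one_plus_sum_powers) auto
    also have "\<dots> \<le> \<epsilon> * (1 + (\<Sum>i\<in>B. \<bar>b i\<bar> ^ k + \<bar>d i / \<epsilon>\<bar> ^ k))"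
      using assms by (intro mult_left_mono add_left_mono sum_mono) auto
    finally show "\<bar>(\<Prod>i\<in>X. d i) * (\<Prod>i\<in>B - X. b i)\<bar> \<le> \<epsilon> * ?s"
      by (simp add: sum.distrib add.assoc)
  qed
  also have "\<dots> = card (Pow B - {{}}) * (\<epsilon> * ?s)"
    by simp
  also have "\<dots> \<le> 2 ^ card B * (\<epsilon> * ?s)"
  proof (intro mult_right_mono)
    have "card (Pow B - {{}}) \<le> card (Pow B)"
      using assms by (intro card_mono) auto
    then show "real (card (Pow B - {{}})) \<le> 2 ^ card B"
      using assms by (simp add: card_Pow flip: of_nat_power_eq_of_nat_cancel_iff of_nat_le_iff)
    show "0 \<le> \<epsilon> * ?s"
      using assms by (intro mult_nonneg_nonneg add_nonneg_nonneg sum_nonneg) auto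
  qed
  finally show ?thesis
    by (simp add: mult_ac)
qed

lemma (in finite_measure) integrable_prod_powers:
  fixes Y :: "'i \<Rightarrow> 'a \<Rightarrow> real"
  assumes "finite B" "card B \<le> k" "\<And>i. i \<in> B \<Longrightarrow> Y i \<in> borel_measurable M"
    "\<And>i. i \<in> B \<Longrightarrow> integrable M (\<lambda>w. \<bar>Y i w\<bar> ^ k)"
  shows "integrable M (\<lambda>w. \<Prod>i\<in>B. Y i w)"
proof (rule Bochner_Integration.integrable_bound)
  show "integrable M (\<lambda>w. 1 + (\<Sum>i\<in>B. \<bar>Y i w\<bar> ^ k))"
    using assms by auto
  show "(\<lambda>w. \<Prod>i\<in>B. Y i w) \<in> borel_measurable M"
    using assms by measurable
  show "AE w in M. norm (\<Prod>i\<in>B. Y i w) \<le> norm (1 + (\<Sum>i\<in>B. \<bar>Y i w\<bar> ^ k))"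
  proof (intro always_eventually allI)
    fix w
    have "(\<Prod>i\<in>B. \<bar>Y i w\<bar>) \<le> 1 + (\<Sum>i\<in>B. \<bar>Y i w\<bar> ^ k)"
      using assms by (intro prod_le_one_plus_sum_powers) auto
    then show "norm (\<Prod>i\<in>B. Y i w) \<le> norm (1 + (\<Sum>i\<in>B. \<bar>Y i w\<bar> ^ k))"
      by (simp add: abs_prod)
  qed
qed

lemma power_add_le:
  assumes "0 \<le> a" "0 \<le> (b :: real)"
  shows "(a + b) ^ k \<le> 2 ^ k * (a ^ k + b ^ k)"
proof -
  have "(a + b) ^ k \<le> (2 * max a b) ^ k"
    using assms by (intro power_mono) auto
  also have "\<dots> \<le> 2 ^ k * (a ^ k + b ^ k)"
    using assms by (auto simp: power_mult_distrib max_def)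
  finally show ?thesis .
qed

lemma (in prob_space) expectation_prod_tendsto:
  fixes Y :: "'i \<Rightarrow> 'a \<Rightarrow> real" and Yn :: "nat \<Rightarrow> 'i \<Rightarrow> 'a \<Rightarrow> real"
  assumes B: "finite B" "card B \<le> k"
    and Y: "\<And>i. i \<in> B \<Longrightarrow> Y i \<in> borel_measurable M"
      "\<And>i. i \<in> B \<Longrightarrow> integrable M (\<lambda>w. \<bar>Y i w\<bar> ^ k)"
    and Yn: "\<And>n i. i \<in> B \<Longrightarrow> Yn n i \<in> borel_measurable M"
      "\<And>n i. i \<in> B \<Longrightarrow> integrable M (\<lambda>w. \<bar>Yn n i w\<bar> ^ k)"
    and lim: "\<And>i. i \<in> B \<Longrightarrow> (\<lambda>n. expectation (\<lambda>w. \<bar>Yn n i w - Y i w\<bar> ^ k)) \<longlonglongrightarrow> 0"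
  shows "(\<lambda>n. expectation (\<lambda>w. \<Prod>i\<in>B. Yn n i w)) \<longlonglongrightarrow> expectation (\<lambda>w. \<Prod>i\<in>B. Y i w)"
proof -
  have intD: "integrable M (\<lambda>w. \<bar>Yn n i w - Y i w\<bar> ^ k)" if i: "i \<in> B" for n i
  proof (rule Bochner_Integration.integrable_bound)
    show "integrable M (\<lambda>w. 2 ^ k * (\<bar>Yn n i w\<bar> ^ k + \<bar>Y i w\<bar> ^ k))"
      using Y(2)[OF i] Yn(2)[OF i] by auto
    show "(\<lambda>w. \<bar>Yn n i w - Y i w\<bar> ^ k) \<in> borel_measurable M"
      using Y(1)[OF i] Yn(1)[OF i] by measurable
    have "\<bar>Yn n i w - Y i w\<bar> ^ k \<le> 2 ^ k * (\<bar>Yn n i w\<bar> ^ k + \<bar>Y i w\<bar> ^ k)" for w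
      by (rule order_trans[OF power_mono[OF abs_triangle_ineq4] power_add_le]) auto
    then show "AE w in M. norm (\<bar>Yn n i w - Y i w\<bar> ^ k) \<le> norm (2 ^ k * (\<bar>Yn n i w\<bar> ^ k + \<bar>Y i w\<bar> ^ k))"
      by simp
  qed
  define S where "S = 1 + (\<Sum>i\<in>B. expectation (\<lambda>w. \<bar>Y i w\<bar> ^ k))"
  define \<delta> where "\<delta> n = (\<Sum>i\<in>B. expectation (\<lambda>w. \<bar>Yn n i w - Y i w\<bar> ^ k))" for n
  have \<delta>: "\<delta> \<longlonglongrightarrow> 0"
    unfolding \<delta>_def using lim by (intro tendsto_null_sum) auto
  have S: "1 \<le> S"
    unfolding S_def by (simp add: sum_nonneg)
  have bound: "\<bar>expectation (\<lambda>w. \<Prod>i\<in>B. Yn n i w) - expectation (\<lambda>w. \<Prod>i\<in>B. Y i w)\<bar>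
      \<le> \<epsilon> * (2 ^ card B * S) + \<epsilon> * 2 ^ card B / \<epsilon> ^ k * \<delta> n"
    if \<epsilon>: "0 < \<epsilon>" "\<epsilon> \<le> 1" for \<epsilon> n
  proof -
    let ?D = "\<lambda>w. (\<Prod>i\<in>B. Yn n i w) - (\<Prod>i\<in>B. Y i w)"
    let ?R = "\<lambda>w. \<epsilon> * (2 ^ card B * (1 + (\<Sum>i\<in>B. \<bar>Y i w\<bar> ^ k) + (\<Sum>i\<in>B. \<bar>Yn n i w - Y i w\<bar> ^ k / \<epsilon> ^ k)))"
    have int: "integrable M (\<lambda>w. \<Prod>i\<in>B. Yn n i w)" "integrable M (\<lambda>w. \<Prod>i\<in>B. Y i w)"
      using B Y Yn by (intro integrable_prod_powers[where k=k]; simp)+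
    have "\<bar>expectation (\<lambda>w. \<Prod>i\<in>B. Yn n i w) - expectation (\<lambda>w. \<Prod>i\<in>B. Y i w)\<bar> = \<bar>expectation ?D\<bar>"
      using int by simp
    also have "\<dots> \<le> expectation (\<lambda>w. \<bar>?D w\<bar>)"
      by (rule integral_abs_bound)
    also have "\<dots> \<le> expectation ?R"
    proof (rule integral_mono)
      show "integrable M (\<lambda>w. \<bar>?D w\<bar>)" using int by auto
      show "integrable M ?R" using Y intD by auto
      show "\<bar>?D w\<bar> \<le> ?R w" for w
        using prod_perturbation_le[OF B \<epsilon>, of "\<lambda>i. Y i w" "\<lambda>i. Yn n i w - Y i w"] \<epsilon>
        by (simp add: power_divide)
    qed
    also have "\<dots> = \<epsilon> * (2 ^ card B * (S + \<delta> n / \<epsilon> ^ k))"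
      unfolding S_def \<delta>_def using Y intD by (simp add: prob_space sum_divide_distrib)
    finally show ?thesis
      by (simp add: algebra_simps)
  qed
  show ?thesis
  proof (rule LIMSEQ_I)
    \<comment> \<open>First \<open>\<epsilon>\<close> is chosen so that the term without \<open>\<delta>\<close> is small, then \<open>n\<close> for this \<open>\<epsilon>\<close>.\<close>
    fix e :: real assume e: "0 < e"
    define \<epsilon> where "\<epsilon> = min 1 (e / (2 * (2 ^ card B * S)))"
    have \<epsilon>: "0 < \<epsilon>" "\<epsilon> \<le> 1" "\<epsilon> * (2 ^ card B * S) \<le> e / 2"
    proof -
      have p: "0 < 2 ^ card B * S" using S by simp
      then show "0 < \<epsilon>" "\<epsilon> \<le> 1" using e by (auto simp: \<epsilon>_def)
      have "\<epsilon> \<le> e / (2 * (2 ^ card B * S))" by (simp add: \<epsilon>_def)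
      then show "\<epsilon> * (2 ^ card B * S) \<le> e / 2"
        using p by (simp add: pos_le_divide_eq mult_ac)
    qed
    have "(\<lambda>n. \<epsilon> * 2 ^ card B / \<epsilon> ^ k * \<delta> n) \<longlonglongrightarrow> 0"
      using tendsto_mult_left[OF \<delta>, of "\<epsilon> * 2 ^ card B / \<epsilon> ^ k"] by simp
    then have "\<forall>\<^sub>F n in sequentially. \<epsilon> * 2 ^ card B / \<epsilon> ^ k * \<delta> n < e / 2"
      using e by (intro order_tendstoD(2)[where y=0]) auto
    then obtain N where N: "\<And>n. n \<ge> N \<Longrightarrow> \<epsilon> * 2 ^ card B / \<epsilon> ^ k * \<delta> n < e / 2"
      by (auto simp: eventually_sequentially)
    show "\<exists>N. \<forall>n\<ge>N. norm (expectation (\<lambda>w. \<Prod>i\<in>B. Yn n i w) - expectation (\<lambda>w. \<Prod>i\<in>B. Y i w)) < e"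
    proof (intro exI allI impI)
      fix n assume "N \<le> n"
      from bound[OF \<epsilon>(1,2), of n] N[OF this] \<epsilon>(3)
      show "norm (expectation (\<lambda>w. \<Prod>i\<in>B. Yn n i w) - expectation (\<lambda>w. \<Prod>i\<in>B. Y i w)) < e"
        unfolding real_norm_def by linarith
    qed
  qed
qed

text \<open>The joint cumulant of \<open>f 0, \<dots>, f (k - 1)\<close>.\<close>

definition cumulant_upto :: "nat \<Rightarrow> 'a measure \<Rightarrow> (nat \<Rightarrow> 'a \<Rightarrow> real) \<Rightarrow> real" where
  "cumulant_upto k N f = set_cumulant (\<lambda>B. LINT w|N. (\<Prod>i\<in>B. f i w)) {..<k}"

lemma joint_cumulant_eq: "joint_cumulant N (map f [0..<k]) = cumulant_upto k N f"
  unfolding joint_cumulant_def cumulant_upto_def set_cumulant_def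
proof (simp only: length_map length_upt diff_zero, intro sum.cong refl)
  fix \<pi> assume "\<pi> \<in> {\<pi>. partition_on {..<k} \<pi>}"
  then have \<pi>: "B \<subseteq> {..<k}" if "B \<in> \<pi>" for B
    using that by (auto dest: partition_onD1)
  have "(\<Prod>i\<in>B. (map f [0..<k] ! i) w) = (\<Prod>i\<in>B. f i w)" if "B \<in> \<pi>" for B w
    using \<pi>[OF that] by (intro prod.cong) auto
  then show "(-1) ^ (card \<pi> - 1) * fact (card \<pi> - 1) * (\<Prod>B\<in>\<pi>. LINT w|N. (\<Prod>i\<in>B. (map f [0..<k] ! i) w))
     = (-1) ^ (card \<pi> - 1) * fact (card \<pi> - 1) * (\<Prod>B\<in>\<pi>. LINT w|N. (\<Prod>i\<in>B. f i w))"
    by simp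
qed

lemma cumulant_tensor_eq:
  "cumulant_tensor N X is = cumulant_upto (length is) N (\<lambda>j w. X w $ (is ! j))"
proof -
  have "map (\<lambda>i w. X w $ i) is = map (\<lambda>j w. X w $ (is ! j)) [0..<length is]"
    by (intro nth_equalityI) auto
  then show ?thesis
    unfolding cumulant_tensor_def by (simp only: joint_cumulant_eq)
qed

lemma cumulant_upto_cong_moments:
  assumes "\<And>B. B \<subseteq> {..<k} \<Longrightarrow> (LINT w|N. (\<Prod>i\<in>B. f i w)) = (LINT w|N'. (\<Prod>i\<in>B. g i w))"
  shows "cumulant_upto k N f = cumulant_upto k N' g"
  unfolding cumulant_upto_def set_cumulant_def
proof (intro sum.cong arg_cong2[where f="(*)"] refl)
  fix \<pi> assume "\<pi> \<in> {\<pi>. partition_on {..<k} \<pi>}"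
  then show "(\<Prod>B\<in>\<pi>. LINT w|N. (\<Prod>i\<in>B. f i w)) = (\<Prod>B\<in>\<pi>. LINT w|N'. (\<Prod>i\<in>B. g i w))"
    by (intro prod.cong refl assms) (auto dest: partition_onD1)
qed

lemma cumulant_tensor_distr:
  assumes "X \<in> borel_measurable N"
  shows "cumulant_tensor (distr N borel X) (\<lambda>x. x) is = cumulant_tensor N X is"
  unfolding cumulant_tensor_eq using assms
  by (intro cumulant_upto_cong_moments) (simp add: integral_distr)

lemma finite_moment_distr:
  assumes "X \<in> borel_measurable N"
  shows "finite_moment k (distr N borel X) (\<lambda>x. x) \<longleftrightarrow> finite_moment k N X"
  using assms by (simp add: finite_moment_def integrable_distr_eq)

lemma (in prob_space) cumulant_upto_linear:
  assumes j: "j < k" and fin: "finite I"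
    and f: "\<And>i. i < k \<Longrightarrow> i \<noteq> j \<Longrightarrow> f i \<in> borel_measurable M"
      "\<And>i. i < k \<Longrightarrow> i \<noteq> j \<Longrightarrow> integrable M (\<lambda>w. \<bar>f i w\<bar> ^ k)"
    and g: "\<And>i. i \<in> I \<Longrightarrow> g i \<in> borel_measurable M"
      "\<And>i. i \<in> I \<Longrightarrow> integrable M (\<lambda>w. \<bar>g i w\<bar> ^ k)"
    and fj: "AE w in M. f j w = (\<Sum>i\<in>I. a i * g i w)" and fj': "f j \<in> borel_measurable M"
  shows "cumulant_upto k M f = (\<Sum>i\<in>I. a i * cumulant_upto k M (f(j := g i)))"
  unfolding cumulant_upto_def
proof (rule set_cumulant_linear[where s=j])
  fix A :: "nat set" assume A: "A \<subseteq> {..<k}" "j \<in> A"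
  then have finA: "finite A" by (auto intro: finite_subset)
  have rest: "(\<Prod>l\<in>A. (f(j := g i)) l w) = g i w * (\<Prod>l\<in>A - {j}. f l w)" for i w
    using A finA by (simp add: prod.remove)
  have int: "integrable M (\<lambda>w. \<Prod>l\<in>A. (f(j := g i)) l w)" if "i \<in> I" for i
  proof (rule integrable_prod_powers[where k=k])
    show "card A \<le> k"
      using card_mono[OF _ A(1)] by simp
  qed (use A f g finA that in auto)
  have "AE w in M. (\<Prod>i\<in>A. f i w) = (\<Sum>i\<in>I. a i * (\<Prod>l\<in>A. (f(j := g i)) l w))"
    using fj
  proof eventually_elim
    case (elim w)
    have "(\<Prod>i\<in>A. f i w) = f j w * (\<Prod>l\<in>A - {j}. f l w)"
      using A finA by (simp add: prod.remove)
    then show ?case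
      by (simp only: elim rest sum_distrib_right mult.assoc)
  qed
  moreover have "(\<lambda>w. \<Prod>i\<in>A. f i w) \<in> borel_measurable M"
    using A f fj' by (intro borel_measurable_prod) (metis lessThan_iff subsetD)
  moreover have "(\<lambda>w. \<Sum>i\<in>I. a i * (\<Prod>l\<in>A. (f(j := g i)) l w)) \<in> borel_measurable M"
    using int by (intro borel_measurable_sum borel_measurable_times) auto
  ultimately have "expectation (\<lambda>w. \<Prod>i\<in>A. f i w)
      = expectation (\<lambda>w. \<Sum>i\<in>I. a i * (\<Prod>l\<in>A. (f(j := g i)) l w))"
    by (intro integral_cong_AE)
  also have "\<dots> = (\<Sum>i\<in>I. a i * expectation (\<lambda>w. \<Prod>l\<in>A. (f(j := g i)) l w))"
    using int by simp
  finally show "expectation (\<lambda>w. \<Prod>i\<in>A. f i w)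
      = (\<Sum>i\<in>I. a i * expectation (\<lambda>w. \<Prod>l\<in>A. (f(j := g i)) l w))" .
next
  fix A :: "nat set" and i assume "j \<notin> A"
  then have "(\<Prod>l\<in>A. (f(j := g i)) l w) = (\<Prod>l\<in>A. f l w)" for w
    by (intro prod.cong) auto
  then show "expectation (\<lambda>w. \<Prod>l\<in>A. (f(j := g i)) l w) = expectation (\<lambda>w. \<Prod>i\<in>A. f i w)"
    by simp
qed (use j in auto)

lemma (in prob_space) cumulant_upto_tendsto:
  fixes Y :: "nat \<Rightarrow> 'a \<Rightarrow> real" and Yn :: "nat \<Rightarrow> nat \<Rightarrow> 'a \<Rightarrow> real"
  assumes Y: "\<And>i. i < k \<Longrightarrow> Y i \<in> borel_measurable M"
      "\<And>i. i < k \<Longrightarrow> integrable M (\<lambda>w. \<bar>Y i w\<bar> ^ k)"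
    and Yn: "\<And>n i. i < k \<Longrightarrow> Yn n i \<in> borel_measurable M"
      "\<And>n i. i < k \<Longrightarrow> integrable M (\<lambda>w. \<bar>Yn n i w\<bar> ^ k)"
    and lim: "\<And>i. i < k \<Longrightarrow> (\<lambda>n. expectation (\<lambda>w. \<bar>Yn n i w - Y i w\<bar> ^ k)) \<longlonglongrightarrow> 0"
  shows "(\<lambda>n. cumulant_upto k M (Yn n)) \<longlonglongrightarrow> cumulant_upto k M Y"
  unfolding cumulant_upto_def set_cumulant_def
proof (intro tendsto_sum tendsto_mult tendsto_const tendsto_prod)
  fix \<pi> B assume "\<pi> \<in> {\<pi>. partition_on {..<k} \<pi>}" "B \<in> \<pi>"
  then have B: "B \<subseteq> {..<k}"
    by (auto dest: partition_onD1)
  then have "card B \<le> k" "finite B"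
    using card_mono[OF _ B] by (auto intro: finite_subset)
  with B show "(\<lambda>n. expectation (\<lambda>w. \<Prod>i\<in>B. Yn n i w)) \<longlonglongrightarrow> expectation (\<lambda>w. \<Prod>i\<in>B. Y i w)"
    by (intro expectation_prod_tendsto[where k=k] Y Yn lim) auto
qed

lemma finite_moment_component:
  fixes X :: "'a \<Rightarrow> real^'b"
  assumes "finite_moment k N X"
  shows "(\<lambda>w. X w $ i) \<in> borel_measurable N" "integrable N (\<lambda>w. \<bar>X w $ i\<bar> ^ k)"
proof -
  have [measurable]: "X \<in> borel_measurable N"
    using assms by (simp add: finite_moment_def)
  have "(\<lambda>x :: real^'b. x $ i) \<in> borel_measurable borel"
    by (intro borel_measurable_continuous_onI continuous_intros)
  then show [measurable]: "(\<lambda>w. X w $ i) \<in> borel_measurable N"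
    by (rule measurable_compose[rotated]) fact
  show "integrable N (\<lambda>w. \<bar>X w $ i\<bar> ^ k)"
  proof (rule Bochner_Integration.integrable_bound)
    show "integrable N (\<lambda>w. norm (X w) ^ k)"
      using assms by (simp add: finite_moment_def)
    show "AE w in N. norm (\<bar>X w $ i\<bar> ^ k) \<le> norm (norm (X w) ^ k)"
      by (simp add: power_mono component_le_norm_cart power_abs)
  qed measurable
qed

lemma finite_moment_add:
  assumes "finite_moment k N X" "finite_moment k N Y"
  shows "finite_moment k N (\<lambda>w. X w + Y w)"
proof -
  have [measurable]: "X \<in> borel_measurable N" "Y \<in> borel_measurable N"
    using assms by (simp_all add: finite_moment_def)
  have "integrable N (\<lambda>w. norm (X w + Y w) ^ k)"
  proof (rule Bochner_Integration.integrable_bound)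
    show "integrable N (\<lambda>w. 2 ^ k * (norm (X w) ^ k + norm (Y w) ^ k))"
      using assms by (auto simp: finite_moment_def)
    have "norm (X w + Y w) ^ k \<le> 2 ^ k * (norm (X w) ^ k + norm (Y w) ^ k)" for w
      by (rule order_trans[OF power_mono[OF norm_triangle_ineq] power_add_le]) auto
    then show "AE w in N. norm (norm (X w + Y w) ^ k) \<le> norm (2 ^ k * (norm (X w) ^ k + norm (Y w) ^ k))"
      by simp
  qed measurable
  then show ?thesis
    by (simp add: finite_moment_def)
qed

text \<open>By independence the moments of \<open>U + V\<close> are the convolution of the moments of \<open>U\<close> and \<open>V\<close>.\<close>

lemma (in prob_space) cumulant_tensor_add_indep:
  fixes U V :: "'a \<Rightarrow> real^'n"
  assumes indep: "indep_var borel U borel V"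
    and U: "finite_moment (length is) M U" and V: "finite_moment (length is) M V"
    and "is \<noteq> []"
  shows "cumulant_tensor M (\<lambda>w. U w + V w) is = cumulant_tensor M U is + cumulant_tensor M V is"
  unfolding cumulant_tensor_eq cumulant_upto_def
proof (rule set_cumulant_subset_conv)
  fix A assume A: "A \<subseteq> {..<length is}"
  then have finA: "finite A" by (auto intro: finite_subset)
  let ?u = "\<lambda>B w. \<Prod>j\<in>B. U w $ (is ! j)" and ?v = "\<lambda>B w. \<Prod>j\<in>B. V w $ (is ! j)"
  have int: "integrable M (?u B)" "integrable M (?v B)" if "B \<subseteq> A" for B
    using that A finA card_mono[of "{..<length is}" B]
    by (auto intro!: integrable_prod_powers[where k="length is"] finite_moment_component[OF U]
          finite_moment_component[OF V] intro: finite_subset)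
  have ind: "indep_var borel (?u B) borel (?v C)" for B C
  proof -
    have "indep_var borel ((\<lambda>x :: real^'n. \<Prod>j\<in>B. x $ (is ! j)) \<circ> U)
        borel ((\<lambda>x :: real^'n. \<Prod>j\<in>C. x $ (is ! j)) \<circ> V)"
      by (rule indep_var_compose[OF indep]) measurable
    then show ?thesis
      by (simp add: comp_def)
  qed
  have "expectation (\<lambda>w. \<Prod>j\<in>A. (U w + V w) $ (is ! j))
      = expectation (\<lambda>w. \<Sum>B\<in>Pow A. ?u B w * ?v (A - B) w)"
    by (simp add: prod_add[OF finA])
  also have "\<dots> = (\<Sum>B\<in>Pow A. expectation (\<lambda>w. ?u B w * ?v (A - B) w))"
    by (intro Bochner_Integration.integral_sum indep_var_integrable[OF ind] int) auto
  also have "\<dots> = (\<Sum>B\<in>Pow A. expectation (?u B) * expectation (?v (A - B)))"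
    by (intro sum.cong refl indep_var_lebesgue_integral[OF ind] int) auto
  finally show "expectation (\<lambda>w. \<Prod>j\<in>A. (U w + V w) $ (is ! j))
      = subset_conv (\<lambda>B. expectation (?u B)) (\<lambda>B. expectation (?v B)) A"
    by (simp add: subset_conv_def)
qed (use \<open>is \<noteq> []\<close> in \<open>auto simp: prob_space\<close>)

section \<open>Levy processes at small times\<close>

lemma (in prob_space) indep_vars_pair:
  assumes "indep_vars (\<lambda>_. N) X I" "i \<in> I" "j \<in> I" "i \<noteq> j"
  shows "indep_var N (X i) N (X j)"
proof -
  have "indep_var N ((\<lambda>f. f i) \<circ> (\<lambda>\<omega>. \<lambda>l\<in>{i}. X l \<omega>)) N ((\<lambda>f. f j) \<circ> (\<lambda>\<omega>. \<lambda>l\<in>{j}. X l \<omega>))"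
    using assms
    by (intro indep_var_compose[OF indep_var_restrict[OF assms(1)]] measurable_component_singleton) auto
  then show ?thesis
    by (simp add: comp_def)
qed

lemma (in prob_space) indep_var_nn_integral_mult:
  assumes indep: "indep_var S U T V"
    and f: "f \<in> borel_measurable S" and g: "g \<in> borel_measurable T"
  shows "(\<integral>\<^sup>+ w. f (U w) * g (V w) \<partial>M) = (\<integral>\<^sup>+ w. f (U w) \<partial>M) * (\<integral>\<^sup>+ w. g (V w) \<partial>M)"
proof -
  have U: "U \<in> M \<rightarrow>\<^sub>M S" and V: "V \<in> M \<rightarrow>\<^sub>M T"
    and eq: "distr M S U \<Otimes>\<^sub>M distr M T V = distr M (S \<Otimes>\<^sub>M T) (\<lambda>x. (U x, V x))"
    using indep by (auto simp: indep_var_distribution_eq)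
  interpret T: prob_space "distr M T V"
    by (rule prob_space_distr[OF V])
  have f': "f \<in> borel_measurable (distr M S U)" and g': "g \<in> borel_measurable (distr M T V)"
    using f g by simp_all
  have "(\<integral>\<^sup>+ w. f (U w) * g (V w) \<partial>M)
      = (\<integral>\<^sup>+ z. f (fst z) * g (snd z) \<partial>distr M (S \<Otimes>\<^sub>M T) (\<lambda>x. (U x, V x)))"
    using U V f g by (subst nn_integral_distr) (auto intro!: measurable_Pair)
  also have "\<dots> = (\<integral>\<^sup>+ x. \<integral>\<^sup>+ y. f x * g y \<partial>distr M T V \<partial>distr M S U)"
    unfolding eq[symmetric] using f' g' by (subst T.nn_integral_fst[symmetric]) auto
  also have "\<dots> = (\<integral>\<^sup>+ x. f x \<partial>distr M S U) * (\<integral>\<^sup>+ y. g y \<partial>distr M T V)"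
    using f' g' by (simp add: nn_integral_cmult nn_integral_multc)
  finally show ?thesis
    using U V f g by (simp add: nn_integral_distr)
qed

context levy_process
begin

lemma law_increment:
  assumes "0 \<le> s" "0 \<le> t"
  shows "distr P borel (\<lambda>w. Z (s + t) w - Z s w) = distr P borel (Z t)"
  using stationary_increments[OF assms] .

lemma indep_increments_pair:
  assumes "0 \<le> s" "0 \<le> t"
  shows "indep_var borel (\<lambda>w. Z s w - Z 0 w) borel (\<lambda>w. Z (s + t) w - Z s w)"
proof -
  define ts where "ts i = (if i = 0 then 0 else if i = Suc 0 then s else s + t)" for i :: nat
  have "indep_vars (\<lambda>_. borel) (\<lambda>i w. Z (ts (Suc i)) w - Z (ts i) w) {..<2}"
    using assms by (intro indep_increments) (auto simp: ts_def)
  from indep_vars_pair[OF this, of 0 "Suc 0"] show ?thesis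
    by (simp add: ts_def)
qed

lemma nn_integral_increment:
  assumes "0 \<le> s" "0 \<le> t" "f \<in> borel_measurable borel"
  shows "(\<integral>\<^sup>+ w. f (Z (s + t) w - Z s w) \<partial>P) = (\<integral>\<^sup>+ w. f (Z t w) \<partial>P)"
proof -
  have [measurable]: "Z s \<in> borel_measurable P" "Z (s + t) \<in> borel_measurable P" "Z t \<in> borel_measurable P"
    using assms by (auto intro: measurable_at)
  have "(\<integral>\<^sup>+ w. f (Z (s + t) w - Z s w) \<partial>P)
      = (\<integral>\<^sup>+ x. f x \<partial>distr P borel (\<lambda>w. Z (s + t) w - Z s w))"
    using assms by (subst nn_integral_distr) auto
  also have "\<dots> = (\<integral>\<^sup>+ w. f (Z t w) \<partial>P)"
    using assms by (simp only: law_increment) (subst nn_integral_distr, auto)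
  finally show ?thesis .
qed

lemma small_increment_bounded:
  obtains \<delta> K where "0 < \<delta>" "\<delta> \<le> 1" "0 < K"
    "\<And>t. 0 \<le> t \<Longrightarrow> t \<le> \<delta> \<Longrightarrow> 1/2 \<le> prob {w \<in> space P. norm (Z 1 w - Z t w) \<le> K}"
proof -
  have "\<forall>\<^sub>F s in at 0 within {0..}. prob {w \<in> space P. norm (Z s w - Z 0 w) > 1} < 1 / 4"
    using stochastically_continuous[of 0 1] by (intro order_tendstoD(2)[where y=0]) auto
  then obtain d where d: "0 < d" and
    dd: "\<And>s. s \<ge> 0 \<Longrightarrow> s \<noteq> 0 \<Longrightarrow> s < d \<Longrightarrow> prob {w \<in> space P. norm (Z s w - Z 0 w) > 1} < 1 / 4"
    by (auto simp: eventually_at dist_real_def)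
  have [measurable]: "Z 1 \<in> borel_measurable P" "Z 0 \<in> borel_measurable P"
    by (auto intro: measurable_at)
  have "(\<lambda>n. prob {w \<in> space P. norm (Z 1 w - Z 0 w) > real n}) \<longlonglongrightarrow> prob (\<Inter>n. {w \<in> space P. norm (Z 1 w - Z 0 w) > real n})"
    by (intro finite_Lim_measure_decseq) (auto simp: decseq_def)
  moreover have "(\<Inter>n. {w \<in> space P. norm (Z 1 w - Z 0 w) > real n}) = {}"
  proof (rule equals0I)
    fix w assume w: "w \<in> (\<Inter>n. {w \<in> space P. norm (Z 1 w - Z 0 w) > real n})"
    obtain n where "norm (Z 1 w - Z 0 w) < real n"
      using reals_Archimedean2 by blast
    with w show False
      by (auto dest!: spec[of _ n])
  qed
  ultimately have "\<forall>\<^sub>F n in sequentially. prob {w \<in> space P. norm (Z 1 w - Z 0 w) > real n} < 1 / 4"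
    by (intro order_tendstoD(2)[where y=0]) auto
  then obtain n where n: "prob {w \<in> space P. norm (Z 1 w - Z 0 w) > real n} < 1 / 4"
    by (auto simp: eventually_sequentially)
  show thesis
  proof (rule that[of "min 1 (d / 2)" "real n + 1"])
    fix t :: real assume t: "0 \<le> t" "t \<le> min 1 (d / 2)"
    have [measurable]: "Z t \<in> borel_measurable P"
      using t by (auto intro: measurable_at)
    have 1: "prob {w \<in> space P. norm (Z t w - Z 0 w) > 1} < 1 / 4"
      using dd[of t] t d by (cases "t = 0") auto
    have "1 - prob {w \<in> space P. norm (Z 1 w - Z t w) \<le> real n + 1}
        = prob (space P - {w \<in> space P. norm (Z 1 w - Z t w) \<le> real n + 1})"
      by (intro prob_compl[symmetric]) measurable
    also have "\<dots> \<le> prob ({w \<in> space P. norm (Z t w - Z 0 w) > 1} \<union> {w \<in> space P. norm (Z 1 w - Z 0 w) > real n})"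
    proof (rule finite_measure_mono)
      have "norm (Z 1 w - Z t w) \<le> norm (Z 1 w - Z 0 w) + norm (Z t w - Z 0 w)" for w
        using norm_triangle_ineq4[of "Z 1 w - Z 0 w" "Z t w - Z 0 w"] by simp
      then show "space P - {w \<in> space P. norm (Z 1 w - Z t w) \<le> real n + 1}
          \<subseteq> {w \<in> space P. norm (Z t w - Z 0 w) > 1} \<union> {w \<in> space P. norm (Z 1 w - Z 0 w) > real n}"
        by (auto simp: not_le) (smt (verit))
    qed measurable
    also have "\<dots> \<le> prob {w \<in> space P. norm (Z t w - Z 0 w) > 1} + prob {w \<in> space P. norm (Z 1 w - Z 0 w) > real n}"
      by (intro measure_Un_le) measurable
    finally show "1/2 \<le> prob {w \<in> space P. norm (Z 1 w - Z t w) \<le> real n + 1}"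
      using 1 n by linarith
  qed (use d in auto)
qed

end

text \<open>Tails of the \<open>k\<close>-th moment; the shift by \<open>K\<close> leaves room for an increment of size \<open>K\<close>.\<close>

lemma (in prob_space) nn_integral_tail_tendsto_0:
  assumes X: "finite_moment k M X" and K: "0 \<le> K"
  shows "(\<lambda>n. \<integral>\<^sup>+ w. ennreal ((norm (X w) + K) ^ k) * indicator {real n<..} (norm (X w)) \<partial>M) \<longlonglongrightarrow> 0"
proof -
  have [measurable]: "X \<in> borel_measurable M"
    using X by (simp add: finite_moment_def)
  have "integrable M (\<lambda>w. 2 ^ k * (norm (X w) ^ k + K ^ k))"
    using X by (auto simp: finite_moment_def)
  then have fin: "(\<integral>\<^sup>+ w. ennreal (2 ^ k * (norm (X w) ^ k + K ^ k)) \<partial>M) < \<infinity>"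
    using K by (subst nn_integral_eq_integral) auto
  have "(\<lambda>n. \<integral>\<^sup>+ w. ennreal ((norm (X w) + K) ^ k) * indicator {real n<..} (norm (X w)) \<partial>M)
      \<longlonglongrightarrow> (\<integral>\<^sup>+ w. 0 \<partial>M)"
  proof (rule nn_integral_dominated_convergence[where w="\<lambda>w. ennreal (2 ^ k * (norm (X w) ^ k + K ^ k))"])
    show "AE w in M. ennreal ((norm (X w) + K) ^ k) * indicator {real n<..} (norm (X w))
        \<le> ennreal (2 ^ k * (norm (X w) ^ k + K ^ k))" for n
      using K by (auto intro!: always_eventually ennreal_leI power_add_le split: split_indicator)
    show "AE w in M. (\<lambda>n. ennreal ((norm (X w) + K) ^ k) * indicator {real n<..} (norm (X w))) \<longlonglongrightarrow> 0"
    proof (rule always_eventually, rule allI, rule tendsto_eventually)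
      fix w
      have "\<forall>\<^sub>F n in sequentially. norm (X w) \<le> real n"
        by (rule eventually_sequentiallyI[of "nat \<lceil>norm (X w)\<rceil>"]) linarith
      then show "\<forall>\<^sub>F n in sequentially. ennreal ((norm (X w) + K) ^ k) * indicator {real n<..} (norm (X w)) = 0"
        by eventually_elim auto
    qed
  qed (use fin in auto)
  then show ?thesis
    by simp
qed

context levy_process
begin

lemma finite_moment_increment:
  assumes "0 \<le> s" "0 \<le> t"
  shows "finite_moment k P (\<lambda>w. Z (s + t) w - Z s w) \<longleftrightarrow> finite_moment k P (Z t)"
proof -
  have [measurable]: "Z s \<in> borel_measurable P" "Z (s + t) \<in> borel_measurable P" "Z t \<in> borel_measurable P"
    using assms by (auto intro: measurable_at)
  show ?thesis
    using finite_moment_distr[of "\<lambda>w. Z (s + t) w - Z s w" P k] finite_moment_distr[of "Z t" P k]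
      law_increment[OF assms] by simp
qed

lemma cumulant_tensor_increment:
  assumes "0 \<le> s" "0 \<le> t"
  shows "cumulant_tensor P (\<lambda>w. Z (s + t) w - Z s w) is = cumulant_tensor P (Z t) is"
proof -
  have [measurable]: "Z s \<in> borel_measurable P" "Z (s + t) \<in> borel_measurable P" "Z t \<in> borel_measurable P"
    using assms by (auto intro: measurable_at)
  show ?thesis
    using cumulant_tensor_distr[of "\<lambda>w. Z (s + t) w - Z s w" P "is"] cumulant_tensor_distr[of "Z t" P "is"]
      law_increment[OF assms] by simp
qed

text \<open>The starting value \<open>Z 0\<close> vanishes only almost surely, so increments \<open>Z t - Z 0\<close> take the place of
  \<open>Z t\<close>. If the norm of \<open>Z t - Z 0\<close> is larger than \<open>r + K\<close> and that of the independent increment \<open>Z 1 - Z t\<close> is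
  at most \<open>K\<close>, an event of probability at least \<open>1/2\<close>, then the norm of \<open>Z 1 - Z 0\<close> is larger than \<open>r\<close> and
  falls short of that of \<open>Z t - Z 0\<close> by at most \<open>K\<close>.\<close>

lemma nn_integral_tail_le:
  assumes t: "0 \<le> t" "t \<le> 1" and K: "1/2 \<le> prob {w \<in> space P. norm (Z 1 w - Z t w) \<le> K}"
    and "0 \<le> r"
  shows "(\<integral>\<^sup>+ w. ennreal (norm (Z t w - Z 0 w) ^ k) * indicator {r + K<..} (norm (Z t w - Z 0 w)) \<partial>P)
    \<le> 2 * (\<integral>\<^sup>+ w. ennreal ((norm (Z 1 w - Z 0 w) + K) ^ k) * indicator {r<..} (norm (Z 1 w - Z 0 w)) \<partial>P)"
    (is "?I \<le> 2 * ?J")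
proof -
  have [measurable]: "Z t \<in> borel_measurable P" "Z 0 \<in> borel_measurable P" "Z 1 \<in> borel_measurable P"
    using t by (auto intro: measurable_at)
  have indep: "indep_var borel (\<lambda>w. Z t w - Z 0 w) borel (\<lambda>w. Z 1 w - Z t w)"
    using indep_increments_pair[of t "1 - t"] t by simp
  have "ennreal (1/2) \<le> emeasure P {w \<in> space P. norm (Z 1 w - Z t w) \<le> K}"
    unfolding emeasure_eq_measure using K by (intro ennreal_leI) auto
  also have "\<dots> = (\<integral>\<^sup>+ w. indicator {w \<in> space P. norm (Z 1 w - Z t w) \<le> K} w \<partial>P)"
    by (subst nn_integral_indicator) measurable
  also have "\<dots> = (\<integral>\<^sup>+ w. indicator {x. norm x \<le> K} (Z 1 w - Z t w) \<partial>P)"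
    by (intro nn_integral_cong) (auto split: split_indicator)
  finally have half: "ennreal (1/2) \<le> (\<integral>\<^sup>+ w. indicator {x. norm x \<le> K} (Z 1 w - Z t w) \<partial>P)" .
  have "?I * ennreal (1/2) \<le> ?I * (\<integral>\<^sup>+ w. indicator {x. norm x \<le> K} (Z 1 w - Z t w) \<partial>P)"
    using half by (intro mult_left_mono) auto
  also have "\<dots> = (\<integral>\<^sup>+ w. ennreal (norm (Z t w - Z 0 w) ^ k) * indicator {r + K<..} (norm (Z t w - Z 0 w))
        * indicator {x. norm x \<le> K} (Z 1 w - Z t w) \<partial>P)"
    by (subst indep_var_nn_integral_mult[OF indep, symmetric]) auto
  also have "\<dots> \<le> ?J"
  proof (intro nn_integral_mono)
    fix w
    have "norm (Z t w - Z 0 w) \<le> norm (Z 1 w - Z 0 w) + norm (Z 1 w - Z t w)"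
      using norm_triangle_ineq4[of "Z 1 w - Z 0 w" "Z 1 w - Z t w"] by simp
    then show "ennreal (norm (Z t w - Z 0 w) ^ k) * indicator {r + K<..} (norm (Z t w - Z 0 w))
        * indicator {x. norm x \<le> K} (Z 1 w - Z t w)
        \<le> ennreal ((norm (Z 1 w - Z 0 w) + K) ^ k) * indicator {r<..} (norm (Z 1 w - Z 0 w))"
      by (auto split: split_indicator intro!: ennreal_leI power_mono)
  qed
  finally have "?I * ennreal (1/2) \<le> ?J" .
  then have "2 * (?I * ennreal (1/2)) \<le> 2 * ?J"
    by (rule mult_left_mono) simp
  moreover have "2 * (?I * ennreal (1/2)) = ?I * (2 * ennreal (1/2))"
    by (simp add: mult_ac)
  moreover have "2 * ennreal (1/2) = 1"
    using ennreal_mult[of 2 "1/2"] by simp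
  ultimately show ?thesis
    by simp
qed

text \<open>Uniform integrability from the tail bound, combined with stochastic continuity at time \<open>0\<close>.\<close>

lemma small_time_moment:
  assumes k: "1 \<le> k" and fin: "finite_moment k P (Z 1)" and e: "0 < e"
  obtains \<delta> where "0 < \<delta>" "\<And>t. 0 \<le> t \<Longrightarrow> t \<le> \<delta> \<Longrightarrow> finite_moment k P (Z t)"
    "\<And>t. 0 \<le> t \<Longrightarrow> t \<le> \<delta> \<Longrightarrow> expectation (\<lambda>w. norm (Z t w) ^ k) \<le> e"
proof -
  obtain \<delta> K where \<delta>: "0 < \<delta>" "\<delta> \<le> 1" and K: "0 < K"
    and half: "\<And>t. 0 \<le> t \<Longrightarrow> t \<le> \<delta> \<Longrightarrow> 1/2 \<le> prob {w \<in> space P. norm (Z 1 w - Z t w) \<le> K}"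
    by (rule small_increment_bounded, rule that)
  have "finite_moment k P (\<lambda>w. Z 1 w - Z 0 w)"
    using finite_moment_increment[of 0 1 k] fin by simp
  from nn_integral_tail_tendsto_0[OF this, of K] K
  have "\<forall>\<^sub>F n in sequentially. (\<integral>\<^sup>+ w. ennreal ((norm (Z 1 w - Z 0 w) + K) ^ k)
      * indicator {real n<..} (norm (Z 1 w - Z 0 w)) \<partial>P) < ennreal (e / 8)"
    using e by (intro order_tendstoD(2)) auto
  then obtain n where n: "(\<integral>\<^sup>+ w. ennreal ((norm (Z 1 w - Z 0 w) + K) ^ k)
      * indicator {real n<..} (norm (Z 1 w - Z 0 w)) \<partial>P) < ennreal (e / 8)"
    by (auto simp: eventually_sequentially)
  define L where "L = real n + K"
  have L: "0 < L" using K by (simp add: L_def)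
  define \<eta> where "\<eta> = min 1 (e / 4)"
  have \<eta>: "0 < \<eta>" "\<eta> \<le> 1" "\<eta> \<le> e / 4" using e by (auto simp: \<eta>_def)
  have "\<forall>\<^sub>F s in at 0 within {0..}. prob {w \<in> space P. norm (Z s w - Z 0 w) > \<eta>} < e / (4 * L ^ k)"
    using stochastically_continuous[of 0 \<eta>] \<eta> e L by (intro order_tendstoD(2)[where y=0]) auto
  then obtain d where d: "0 < d" and
    dd: "\<And>s. s \<ge> 0 \<Longrightarrow> s \<noteq> 0 \<Longrightarrow> s < d \<Longrightarrow> prob {w \<in> space P. norm (Z s w - Z 0 w) > \<eta>} < e / (4 * L ^ k)"
    by (auto simp: eventually_at dist_real_def)
  have bound: "(\<integral>\<^sup>+ w. ennreal (norm (Z t w) ^ k) \<partial>P) \<le> ennreal e" if t: "0 \<le> t" "t \<le> min \<delta> (d / 2)" for t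
  proof -
    have [measurable]: "Z t \<in> borel_measurable P" "Z 0 \<in> borel_measurable P"
      using t by (auto intro: measurable_at)
    let ?U = "\<lambda>w. norm (Z t w - Z 0 w)"
    have 1: "prob {w \<in> space P. ?U w > \<eta>} \<le> e / (4 * L ^ k)"
      using dd[of t] t d \<eta> e L by (cases "t = 0") (auto intro: less_imp_le)
    have "(\<integral>\<^sup>+ w. ennreal (norm (Z t w) ^ k) \<partial>P) = (\<integral>\<^sup>+ w. ennreal (?U w ^ k) \<partial>P)"
      using nn_integral_increment[of 0 t "\<lambda>x. ennreal (norm x ^ k)"] t by simp
    also have "\<dots> \<le> (\<integral>\<^sup>+ w. ennreal \<eta> + ennreal (L ^ k) * indicator {w \<in> space P. ?U w > \<eta>} w
        + ennreal (?U w ^ k) * indicator {L<..} (?U w) \<partial>P)"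
    proof (intro nn_integral_mono)
      fix w assume w: "w \<in> space P"
      consider "?U w \<le> \<eta>" | "\<eta> < ?U w" "?U w \<le> L" | "L < ?U w" by linarith
      then show "ennreal (?U w ^ k) \<le> ennreal \<eta> + ennreal (L ^ k) * indicator {w \<in> space P. ?U w > \<eta>} w
        + ennreal (?U w ^ k) * indicator {L<..} (?U w)"
      proof cases
        case 1
        then have "?U w ^ k \<le> \<eta> ^ 1"
          using \<eta> k order_trans[OF power_mono[of "?U w" \<eta> k] power_decreasing[of 1 k \<eta>]] by auto
        then have "ennreal (?U w ^ k) \<le> ennreal \<eta>"
          by (intro ennreal_leI) simp
        then show ?thesis
          by (simp add: add_increasing2 add.assoc)
      next
        case 2
        then have "ennreal (?U w ^ k) \<le> ennreal (L ^ k)"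
          by (intro ennreal_leI power_mono) auto
        then show ?thesis
          using 2 w by (simp add: add_increasing2 add_increasing)
      next
        case 3
        then show ?thesis
          by (simp add: add_increasing)
      qed
    qed
    also have "\<dots> = ennreal \<eta> + ennreal (L ^ k) * emeasure P {w \<in> space P. ?U w > \<eta>}
        + (\<integral>\<^sup>+ w. ennreal (?U w ^ k) * indicator {L<..} (?U w) \<partial>P)"
      by (simp add: nn_integral_add nn_integral_cmult emeasure_space_1)
    also have "\<dots> \<le> ennreal (e / 4) + ennreal (L ^ k) * ennreal (e / (4 * L ^ k)) + 2 * ennreal (e / 8)"
    proof (intro add_mono mult_left_mono)
      show "emeasure P {w \<in> space P. ?U w > \<eta>} \<le> ennreal (e / (4 * L ^ k))"
        unfolding emeasure_eq_measure using 1 by (rule ennreal_leI)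
      have "(\<integral>\<^sup>+ w. ennreal (?U w ^ k) * indicator {L<..} (?U w) \<partial>P)
        \<le> 2 * (\<integral>\<^sup>+ w. ennreal ((norm (Z 1 w - Z 0 w) + K) ^ k) * indicator {real n<..} (norm (Z 1 w - Z 0 w)) \<partial>P)"
        unfolding L_def using t \<delta> by (intro nn_integral_tail_le half) auto
      also have "\<dots> \<le> 2 * ennreal (e / 8)"
        using n by (intro mult_left_mono) auto
      finally show "(\<integral>\<^sup>+ w. ennreal (?U w ^ k) * indicator {L<..} (?U w) \<partial>P) \<le> 2 * ennreal (e / 8)" .
    qed (use \<eta> in \<open>auto intro: ennreal_leI\<close>)
    also have "\<dots> = ennreal (e / 4 + L ^ k * (e / (4 * L ^ k)) + 2 * (e / 8))"
    proof -
      have "2 * ennreal (e / 8) = ennreal (2 * (e / 8))"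
        using ennreal_mult[of 2 "e / 8"] e by simp
      moreover have "ennreal (L ^ k) * ennreal (e / (4 * L ^ k)) = ennreal (L ^ k * (e / (4 * L ^ k)))"
        using e L by (intro ennreal_mult[symmetric]) auto
      ultimately show ?thesis
        using e L by (simp only:) (subst ennreal_plus[symmetric]; simp)+
    qed
    also have "\<dots> \<le> ennreal e"
      using e L by (intro ennreal_leI) (simp add: field_simps)
    finally show ?thesis .
  qed
  show thesis
  proof (rule that[of "min \<delta> (d / 2)"])
    fix t assume t: "0 \<le> t" "t \<le> min \<delta> (d / 2)"
    have [measurable]: "Z t \<in> borel_measurable P"
      using t by (auto intro: measurable_at)
    have int: "integrable P (\<lambda>w. norm (Z t w) ^ k)"
      using bound[OF t] by (intro integrableI_bounded) (auto simp: le_less_trans)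
    then show "finite_moment k P (Z t)"
      by (simp add: finite_moment_def)
    show "expectation (\<lambda>w. norm (Z t w) ^ k) \<le> e"
      using bound[OF t] e int by (subst (asm) nn_integral_eq_integral) auto
  qed (use d \<delta> in auto)
qed

lemma finite_moment_multiple:
  assumes "0 \<le> t" "finite_moment k P (Z t)"
  shows "finite_moment k P (Z (real n * t))"
proof (induction n)
  case 0
  have "AE w in P. norm (Z 0 w) ^ k = (0 :: real) ^ k"
    using starts_at_zero by eventually_elim simp
  moreover have "Z 0 \<in> borel_measurable P"
    by (simp add: measurable_at)
  ultimately have "integrable P (\<lambda>w. norm (Z 0 w) ^ k) \<longleftrightarrow> integrable P (\<lambda>w. (0 :: real) ^ k)"
    by (intro integrable_cong_AE) auto
  then show ?case
    using \<open>Z 0 \<in> borel_measurable P\<close> by (simp add: finite_moment_def)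
next
  case (Suc n)
  have "finite_moment k P (\<lambda>w. Z (real n * t) w + (Z (real n * t + t) w - Z (real n * t) w))"
    using Suc assms by (intro finite_moment_add) (simp_all add: finite_moment_increment)
  then show ?case
    by (simp add: algebra_simps)
qed

lemma cumulant_tensor_add_time:
  assumes "0 \<le> s" "0 \<le> t" "is \<noteq> []"
    and "finite_moment (length is) P (Z s)" "finite_moment (length is) P (Z t)"
  shows "cumulant_tensor P (Z (s + t)) is = cumulant_tensor P (Z s) is + cumulant_tensor P (Z t) is"
proof -
  have "cumulant_tensor P (Z (s + t)) is
      = cumulant_tensor P (\<lambda>w. (Z s w - Z 0 w) + (Z (s + t) w - Z s w)) is"
    using cumulant_tensor_increment[of 0 "s + t" "is"] assms by simp
  also have "\<dots> = cumulant_tensor P (\<lambda>w. Z s w - Z 0 w) is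
      + cumulant_tensor P (\<lambda>w. Z (s + t) w - Z s w) is"
    using assms finite_moment_increment[of 0 s "length is"]
    by (intro cumulant_tensor_add_indep indep_increments_pair) (simp_all add: finite_moment_increment)
  finally show ?thesis
    using assms cumulant_tensor_increment[of 0 s "is"] by (simp add: cumulant_tensor_increment)
qed

lemma cumulant_tensor_multiple:
  assumes "0 \<le> t" "is \<noteq> []" "finite_moment (length is) P (Z t)"
  shows "cumulant_tensor P (Z (real (Suc n) * t)) is = real (Suc n) * cumulant_tensor P (Z t) is"
proof (induction n)
  case (Suc n)
  have "cumulant_tensor P (Z (real (Suc n) * t + t)) is
      = cumulant_tensor P (Z (real (Suc n) * t)) is + cumulant_tensor P (Z t) is"
    using assms by (intro cumulant_tensor_add_time finite_moment_multiple) auto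
  moreover have "real (Suc (Suc n)) * t = real (Suc n) * t + t"
    by (simp add: algebra_simps)
  ultimately show ?case
    by (simp only: Suc.IH) (simp add: algebra_simps)
qed simp

end

section \<open>Pathwise estimates\<close>

text \<open>Jensen's inequality for the \<open>k\<close>-th power and the uniform distribution on \<open>{0..t}\<close>, obtained by
  integrating the tangent inequality at the mean \<open>y\<close>.\<close>

lemma power_integral_le:
  fixes f :: "real \<Rightarrow> real"
  assumes "0 < t" "1 \<le> k" and f: "f \<in> borel_measurable borel" "\<And>s. 0 \<le> f s"
    and int: "set_integrable lborel {0..t} (\<lambda>s. f s ^ k)"
  shows "(LINT s:{0..t}|lborel. f s) ^ k \<le> t ^ (k - 1) * (LINT s:{0..t}|lborel. f s ^ k)"
proof -
  have const: "set_integrable lborel {0..t} (\<lambda>s. c)" for c :: real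
    unfolding set_integrable_def by (intro integrable_scaleR_left integrable_real_indicator) (auto simp: emeasure_lborel_Icc_eq)
  have int_const: "(LINT s:{0..t}|lborel. c) = t * c" for c :: real
    using assms by (simp add: set_lebesgue_integral_def)
  have int_f: "set_integrable lborel {0..t} f"
  proof (rule set_integrable_bound)
    show "set_integrable lborel {0..t} (\<lambda>s. 1 + f s ^ k)"
      using const[of 1] int by (rule set_integral_add)
    show "set_borel_measurable lborel {0..t} f"
      using f by (simp add: set_borel_measurable_def)
    have "f s \<le> 1 + f s ^ k" for s
      using prod_le_one_plus_sum_powers[of "{()}" k "\<lambda>_. f s"] assms by simp
    then have "norm (f s) \<le> norm (1 + f s ^ k)" for s
      using f(2)[of s] zero_le_power[OF f(2), of s k] unfolding real_norm_def
      by (metis abs_ge_self abs_of_nonneg order_trans)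
    then show "AE s in lborel. s \<in> {0..t} \<longrightarrow> norm (f s) \<le> norm (1 + f s ^ k)"
      by simp
  qed
  define y where "y = (LINT s:{0..t}|lborel. f s) / t"
  have "0 \<le> (LINT s:{0..t}|lborel. f s)"
    using f unfolding set_lebesgue_integral_def by (intro integral_nonneg_AE) auto
  then have y: "0 \<le> y" "(LINT s:{0..t}|lborel. f s) = t * y"
    using \<open>0 < t\<close> by (auto simp: y_def)
  have tangent: "y ^ k + real k * y ^ (k - 1) * (f s - y) \<le> f s ^ k" for s
  proof (cases "y = 0")
    case True
    then show ?thesis
      using f(2)[of s] \<open>1 \<le> k\<close> by (auto simp: power_0_left)
  next
    case False
    have "1 + real k * (f s / y - 1) \<le> (1 + (f s / y - 1)) ^ k"
      using f y by (intro Bernoulli_inequality) auto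
    then have "y ^ k * (1 + real k * (f s / y - 1)) \<le> y ^ k * (f s / y) ^ k"
      using y by (intro mult_left_mono) auto
    also have "y ^ k * (f s / y) ^ k = f s ^ k"
      using False by (simp add: power_divide)
    also have "y ^ k * (1 + real k * (f s / y - 1)) = y ^ k + real k * y ^ (k - 1) * (f s - y)"
      using False \<open>1 \<le> k\<close> by (cases k) (auto simp: field_simps)
    finally show ?thesis .
  qed
  have int': "set_integrable lborel {0..t} (\<lambda>s. real k * y ^ (k - 1) * (f s - y))"
    using int_f const by (intro set_integrable_mult_right set_integral_diff)
  have "t * y ^ k = (LINT s:{0..t}|lborel. y ^ k + real k * y ^ (k - 1) * (f s - y))"
    using const int' int_f by (simp add: set_integral_add set_integral_diff int_const y)
  also have "\<dots> \<le> (LINT s:{0..t}|lborel. f s ^ k)"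
    using const int' tangent int by (intro set_integral_mono set_integral_add) auto
  finally have "t ^ (k - 1) * (t * y ^ k) \<le> t ^ (k - 1) * (LINT s:{0..t}|lborel. f s ^ k)"
    using \<open>0 < t\<close> by (intro mult_left_mono) auto
  then show ?thesis
    using \<open>1 \<le> k\<close> by (cases k) (simp_all add: y power_mult_distrib mult_ac)
qed

text \<open>Since \<open>B t \<le> 1/2\<close>, the integral equation bounds the integral \<open>G\<close> of the norm of \<open>x\<close> by
  \<open>2 (W + t \<parallel>x 0\<parallel>)\<close>, with \<open>W\<close> the integral of the norm of \<open>z\<close>; Gronwall's lemma is not needed. The
  Borel function \<open>z'\<close> agrees with \<open>z\<close> on \<open>{0..t}\<close>; outside this interval \<open>z\<close> is arbitrary.\<close>

lemma path_remainder_bound: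
  fixes x z z' :: "real \<Rightarrow> real^'n" and M :: "real^'n^'n"
  assumes B: "\<And>v. norm (M *v v) \<le> B * norm v" "0 \<le> B" and t: "0 < t" "B * t \<le> 1 / 2"
    and x_int: "set_integrable lborel {0..t} x"
    and x: "\<And>s. 0 \<le> s \<Longrightarrow> s \<le> t \<Longrightarrow> x s = x 0 + (LINT u:{0..s}|lborel. M *v x u) + z s"
    and z': "z' \<in> borel_measurable borel" "\<And>s. 0 \<le> s \<Longrightarrow> s \<le> t \<Longrightarrow> z s = z' s"
  shows "norm (x t - x 0 - t *\<^sub>R (M *v x 0) - z t)
    \<le> 2 * B * (LINT s:{0..t}|lborel. norm (z' s)) + 2 * B\<^sup>2 * t\<^sup>2 * norm (x 0)"
proof -
  define G where "G = (LINT s:{0..t}|lborel. norm (x s))"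
  define W where "W = (LINT s:{0..t}|lborel. norm (z' s))"
  have const: "set_integrable lborel {0..s} (\<lambda>u. c)" for s :: real and c :: "'b :: {banach, second_countable_topology}"
    unfolding set_integrable_def by (intro integrable_scaleR_left integrable_real_indicator) (auto simp: emeasure_lborel_Icc_eq)
  have int_const: "(LINT s:{0..t}|lborel. c) = t *\<^sub>R c" for c :: "'b :: {banach, second_countable_topology}"
    using t by (simp add: set_lebesgue_integral_def)
  have x_int': "set_integrable lborel {0..s} x" if "s \<le> t" for s
    by (rule set_integrable_subset[OF x_int]) (use that in auto)
  have Mx_int: "set_integrable lborel {0..s} (\<lambda>u. M *v x u)" if "s \<le> t" for s
    using integrable_bounded_linear[OF matrix_vector_mul_bounded_linear, of lborel "\<lambda>u. indicator {0..s} u *\<^sub>R x u" M]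
      x_int'[OF that] by (simp add: set_integrable_def matrix_vector_mult_scaleR)
  have norm_x_int: "set_integrable lborel {0..s} (\<lambda>u. norm (x u))" if "s \<le> t" for s
    using x_int'[OF that] by (rule set_integrable_norm)
  have G0: "0 \<le> G"
    unfolding G_def set_lebesgue_integral_def by (intro integral_nonneg_AE) auto
  have drift: "norm (LINT u:{0..s}|lborel. M *v x u) \<le> B * G" if s: "0 \<le> s" "s \<le> t" for s
  proof -
    have "norm (LINT u:{0..s}|lborel. M *v x u) \<le> (LINT u:{0..s}|lborel. norm (M *v x u))"
      using Mx_int[OF s(2)] by (rule set_integral_norm_bound)
    also have "\<dots> \<le> (LINT u:{0..s}|lborel. B * norm (x u))"
      using Mx_int[OF s(2)] x_int'[OF s(2)] B
      by (intro set_integral_mono set_integrable_norm set_integrable_mult_right) auto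
    also have "\<dots> = B * (LINT u:{0..s}|lborel. norm (x u))"
      by simp
    also have "\<dots> \<le> B * G"
      unfolding G_def set_lebesgue_integral_def using B norm_x_int[OF s(2)] norm_x_int[of t] s
      by (intro mult_left_mono integral_mono) (auto simp: set_integrable_def split: split_indicator)
    finally show ?thesis .
  qed
  have z'_eq: "z' s = x s - x 0 - (LINT u:{0..s}|lborel. M *v x u)" if "0 \<le> s" "s \<le> t" for s
    using x[OF that] z'(2)[OF that] by simp
  have z'_le: "norm (z' s) \<le> norm (x s) + (norm (x 0) + B * G)"
    and x_le: "norm (x s - x 0) \<le> norm (z' s) + B * G" if s: "0 \<le> s" "s \<le> t" for s
  proof -
    show "norm (z' s) \<le> norm (x s) + (norm (x 0) + B * G)"
      unfolding z'_eq[OF s] using drift[OF s]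
      by (smt (verit) norm_triangle_ineq4)
    have "x s - x 0 = z' s + (LINT u:{0..s}|lborel. M *v x u)"
      by (simp add: z'_eq[OF s])
    then show "norm (x s - x 0) \<le> norm (z' s) + B * G"
      using drift[OF s] norm_triangle_ineq[of "z' s" "LINT u:{0..s}|lborel. M *v x u"] by simp
  qed
  have z'_int: "set_integrable lborel {0..t} (\<lambda>s. norm (z' s))"
  proof (rule set_integrable_bound)
    show "set_integrable lborel {0..t} (\<lambda>s. norm (x s) + (norm (x 0) + B * G))"
      using norm_x_int const by (intro set_integral_add) auto
    show "set_borel_measurable lborel {0..t} (\<lambda>s. norm (z' s))"
      using z' by (simp add: set_borel_measurable_def)
    show "AE s in lborel. s \<in> {0..t} \<longrightarrow> norm (norm (z' s)) \<le> norm (norm (x s) + (norm (x 0) + B * G))"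
      using z'_le B G0 by (intro always_eventually) auto
  qed
  have "G \<le> (LINT s:{0..t}|lborel. norm (z' s) + (norm (x 0) + B * G))"
    unfolding G_def
  proof (rule set_integral_mono)
    fix s assume "s \<in> {0..t}"
    then have s: "0 \<le> s" "s \<le> t" by auto
    show "norm (x s) \<le> norm (z' s) + (norm (x 0) + B * (LINT s:{0..t}|lborel. norm (x s)))"
      using x_le[OF s] norm_triangle_ineq2[of "x s" "x 0"] by (simp add: G_def)
  qed (use norm_x_int[of t] set_integral_add(1)[OF z'_int const] in auto)
  also have "\<dots> = W + t * (norm (x 0) + B * G)"
    using set_integral_add(2)[OF z'_int const[of t "norm (x 0) + B * G"]] by (simp add: int_const W_def)
  finally have "G \<le> W + t * norm (x 0) + (B * t) * G"
    by (simp add: algebra_simps)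
  moreover have "(B * t) * G \<le> 1 / 2 * G"
    using t G0 by (intro mult_right_mono)
  ultimately have G: "G \<le> 2 * (W + t * norm (x 0))"
    by simp
  have W0: "0 \<le> W"
    unfolding W_def set_lebesgue_integral_def by (intro integral_nonneg_AE) auto
  have diff_int: "set_integrable lborel {0..t} (\<lambda>u. M *v (x u - x 0))"
    using set_integral_diff(1)[OF Mx_int[of t] const] by (simp add: matrix_vector_mult_diff_distrib)
  have "x t - x 0 - t *\<^sub>R (M *v x 0) - z t = (LINT u:{0..t}|lborel. M *v x u) - (LINT u:{0..t}|lborel. M *v x 0)"
    using x[of t] t by (simp add: int_const)
  also have "\<dots> = (LINT u:{0..t}|lborel. M *v (x u - x 0))"
    using set_integral_diff(2)[OF Mx_int[of t] const] by (simp add: matrix_vector_mult_diff_distrib)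
  finally have "norm (x t - x 0 - t *\<^sub>R (M *v x 0) - z t) = norm (LINT u:{0..t}|lborel. M *v (x u - x 0))"
    by simp
  also have "\<dots> \<le> (LINT u:{0..t}|lborel. norm (M *v (x u - x 0)))"
    using diff_int by (rule set_integral_norm_bound)
  also have "\<dots> \<le> (LINT u:{0..t}|lborel. B * (norm (z' u) + B * G))"
  proof (rule set_integral_mono)
    fix u assume "u \<in> {0..t}"
    then have "norm (x u - x 0) \<le> norm (z' u) + B * G"
      by (intro x_le) auto
    then show "norm (M *v (x u - x 0)) \<le> B * (norm (z' u) + B * G)"
      using B by (meson mult_left_mono order_trans)
  qed (use diff_int z'_int const in \<open>auto intro!: set_integral_add set_integrable_norm set_integrable_mult_right\<close>)
  also have "\<dots> = B * (LINT u:{0..t}|lborel. norm (z' u) + B * G)"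
    by simp
  also have "\<dots> = B * W + (B * t) * (B * G)"
    unfolding set_integral_add(2)[OF z'_int const[of t "B * G"]] by (simp add: int_const W_def algebra_simps)
  also have "\<dots> \<le> B * W + (B * t) * (B * (2 * (W + t * norm (x 0))))"
    using G B t by (intro add_left_mono mult_left_mono) auto
  also have "\<dots> = B * W + (B * t) * (2 * (B * W)) + 2 * B\<^sup>2 * t\<^sup>2 * norm (x 0)"
    by (simp add: power2_eq_square algebra_simps)
  also have "\<dots> \<le> B * W + 1 / 2 * (2 * (B * W)) + 2 * B\<^sup>2 * t\<^sup>2 * norm (x 0)"
    using t B W0 by (intro add_mono mult_right_mono) auto
  finally show ?thesis
    by (simp add: W_def)
qed

context levy_process
begin

text \<open>A jointly measurable version of \<open>Z\<close>, as a limit of step functions in time. The value on a step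
  is the one at its right end point, so that right continuity of the paths gives convergence. The
  maximum with \<open>0\<close> keeps all times in the range where \<open>Z\<close> is known to be measurable.\<close>

definition Z_version :: "real \<Rightarrow> 'w \<Rightarrow> real^'n" where
  "Z_version s w = lim (\<lambda>n. Z (max 0 ((of_int \<lfloor>real (Suc n) * s\<rfloor> + 1) / real (Suc n))) w)"

lemma measurable_Z_version:
  "(\<lambda>(s, w). Z_version s w) \<in> borel_measurable (borel \<Otimes>\<^sub>M P)"
proof -
  have "(\<lambda>p. Z (max 0 ((of_int \<lfloor>real (Suc n) * fst p\<rfloor> + 1) / real (Suc n))) (snd p))
      \<in> borel_measurable (borel \<Otimes>\<^sub>M P)" for n
  proof (rule measurable_compose_countable[where g="\<lambda>p. \<lfloor>real (Suc n) * fst p\<rfloor>"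
        and f="\<lambda>i p. Z (max 0 ((of_int i + 1) / real (Suc n))) (snd p)"])
    fix i :: int
    show "(\<lambda>p. Z (max 0 ((of_int i + 1) / real (Suc n))) (snd p)) \<in> borel_measurable (borel \<Otimes>\<^sub>M P)"
      by (rule measurable_compose[OF measurable_snd]) (simp add: measurable_at)
    show "(\<lambda>p :: real \<times> 'w. \<lfloor>real (Suc n) * fst p\<rfloor>) \<in> (borel \<Otimes>\<^sub>M P) \<rightarrow>\<^sub>M count_space UNIV"
      by measurable
  qed
  then show ?thesis
    unfolding Z_version_def split_beta by (rule borel_measurable_lim_metric)
qed

lemma AE_Z_version: "AE w in P. \<forall>s\<ge>0. Z_version s w = Z s w"
  using cadlag_paths
proof eventually_elim
  case (elim w)
  show ?case
  proof (intro allI impI)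
    fix s :: real assume s: "0 \<le> s"
    let ?r = "\<lambda>n. max 0 ((of_int \<lfloor>real (Suc n) * s\<rfloor> + 1) / real (Suc n))"
    have r: "s < ?r n" "?r n \<le> s + 1 / real (Suc n)" for n
    proof -
      have "s < (of_int \<lfloor>real (Suc n) * s\<rfloor> + 1) / real (Suc n)"
        by (subst pos_less_divide_eq) (simp_all add: mult.commute)
      then show "s < ?r n" by simp
      have "(of_int \<lfloor>real (Suc n) * s\<rfloor> + 1) / real (Suc n) \<le> (real (Suc n) * s + 1) / real (Suc n)"
        by (intro divide_right_mono add_right_mono of_int_floor_le) simp
      then have "(of_int \<lfloor>real (Suc n) * s\<rfloor> + 1) / real (Suc n) \<le> s + 1 / real (Suc n)"
        by (simp add: add_divide_distrib)
      then show "?r n \<le> s + 1 / real (Suc n)"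
        using s by simp
    qed
    have "?r \<longlonglongrightarrow> s"
    proof (rule tendsto_sandwich[where f="\<lambda>_. s" and h="\<lambda>n. s + 1 / real (Suc n)"])
      show "\<forall>\<^sub>F n in sequentially. s \<le> ?r n"
        using r(1) by (intro always_eventually allI less_imp_le)
      show "\<forall>\<^sub>F n in sequentially. ?r n \<le> s + 1 / real (Suc n)"
        using r(2) by (intro always_eventually allI)
      show "(\<lambda>n. s + 1 / real (Suc n)) \<longlonglongrightarrow> s"
        using tendsto_add[OF tendsto_const[of s] LIMSEQ_inverse_real_of_nat]
        by (simp add: inverse_eq_divide)
    qed (rule tendsto_const)
    then have "filterlim ?r (at_right s) sequentially"
      unfolding filterlim_at using r(1) by (intro conjI always_eventually allI) (auto simp: less_imp_neq[symmetric])
    moreover have "((\<lambda>u. Z u w) \<longlongrightarrow> Z s w) (at_right s)"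
      using elim s by (simp add: continuous_within)
    ultimately have "(\<lambda>n. Z (?r n) w) \<longlonglongrightarrow> Z s w"
      by (rule filterlim_compose[rotated])
    then show "Z_version s w = Z s w"
      unfolding Z_version_def by (rule limI)
  qed
qed

text \<open>The integral of the norm of the path up to time \<open>t\<close>. It has the default value \<open>0\<close> on paths that
  are not integrable.\<close>

definition Z_absolute_integral :: "real \<Rightarrow> 'w \<Rightarrow> real" where
  "Z_absolute_integral t w = (LINT s:{0..t}|lborel. norm (Z_version s w))"

lemma measurable_Z_version_swap:
  "(\<lambda>p. Z_version (snd p) (fst p)) \<in> borel_measurable (P \<Otimes>\<^sub>M lborel)"
  using measurable_compose[OF measurable_Pair[OF measurable_snd measurable_fst] measurable_Z_version]
  by simp

lemma Z_absolute_integral_nonneg: "0 \<le> Z_absolute_integral t w"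
  unfolding Z_absolute_integral_def set_lebesgue_integral_def by (intro integral_nonneg_AE) auto

lemma measurable_Z_absolute_integral: "Z_absolute_integral t \<in> borel_measurable P"
proof -
  have "(\<lambda>p. indicator {0..t} (snd p) *\<^sub>R norm (Z_version (snd p) (fst p))) \<in> borel_measurable (P \<Otimes>\<^sub>M lborel)"
    using measurable_Z_version_swap by measurable
  then show ?thesis
    unfolding Z_absolute_integral_def set_lebesgue_integral_def
    by (intro lborel.borel_measurable_lebesgue_integral) (simp add: split_beta)
qed

lemma Z_absolute_integral_moment:
  assumes t: "0 < t" and k: "1 \<le> k"
    and fin: "\<And>s. 0 \<le> s \<Longrightarrow> s \<le> t \<Longrightarrow> finite_moment k P (Z s)"
    and c: "\<And>s. 0 \<le> s \<Longrightarrow> s \<le> t \<Longrightarrow> expectation (\<lambda>w. norm (Z s w) ^ k) \<le> c"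
  shows "integrable P (\<lambda>w. Z_absolute_integral t w ^ k)"
    "expectation (\<lambda>w. Z_absolute_integral t w ^ k) \<le> t ^ k * c"
proof -
  have c0: "0 \<le> c"
  proof -
    have "0 \<le> expectation (\<lambda>w. norm (Z 0 w) ^ k)"
      by (intro integral_nonneg_AE) auto
    from order_trans[OF this c[of 0]] t show ?thesis by simp
  qed
  interpret PL: pair_sigma_finite P lborel ..
  note [measurable] = measurable_Z_version_swap measurable_Z_absolute_integral
  let ?f = "\<lambda>w s. ennreal (indicator {0..t} s * norm (Z_version s w) ^ k)"
  have f: "(\<lambda>p. ?f (fst p) (snd p)) \<in> borel_measurable (P \<Otimes>\<^sub>M lborel)"
    by measurable
  have f_swap: "(\<integral>\<^sup>+ w. (\<integral>\<^sup>+ s. ?f w s \<partial>lborel) \<partial>P) = (\<integral>\<^sup>+ s. (\<integral>\<^sup>+ w. ?f w s \<partial>P) \<partial>lborel)"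
    using f by (intro PL.Fubini'[symmetric]) (simp add: split_beta)
  have inner: "(\<integral>\<^sup>+ w. ?f w s \<partial>P) \<le> ennreal c * indicator {0..t} s" for s
  proof (cases "s \<in> {0..t}")
    case True
    then have "(\<integral>\<^sup>+ w. ?f w s \<partial>P) = (\<integral>\<^sup>+ w. ennreal (norm (Z s w) ^ k) \<partial>P)"
      using AE_Z_version by (intro nn_integral_cong_AE) (auto elim: eventually_mono)
    also have "\<dots> = ennreal (expectation (\<lambda>w. norm (Z s w) ^ k))"
      using fin[of s] True by (intro nn_integral_eq_integral) (auto simp: finite_moment_def)
    also have "\<dots> \<le> ennreal c"
      using c True by (intro ennreal_leI) auto
    finally show ?thesis
      using True by simp
  qed simp
  have "(\<integral>\<^sup>+ s. (\<integral>\<^sup>+ w. ?f w s \<partial>P) \<partial>lborel) \<le> (\<integral>\<^sup>+ s. ennreal c * indicator {0..t} s \<partial>lborel)"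
    by (intro nn_integral_mono inner)
  also have "\<dots> = ennreal (c * t)"
    using c0 t by (simp add: nn_integral_cmult_indicator ennreal_mult)
  finally have total: "(\<integral>\<^sup>+ w. (\<integral>\<^sup>+ s. ?f w s \<partial>lborel) \<partial>P) \<le> ennreal (c * t)"
    by (simp add: f_swap)
  have fm: "(\<lambda>w. \<integral>\<^sup>+ s. ?f w s \<partial>lborel) \<in> borel_measurable P"
    using f by (intro lborel.borel_measurable_nn_integral) (simp add: split_beta)
  have "AE w in P. (\<integral>\<^sup>+ s. ?f w s \<partial>lborel) \<noteq> \<infinity>"
    using total by (intro nn_integral_noteq_infinite fm) (auto simp: top_unique)
  then have pointwise: "AE w in P. ennreal (Z_absolute_integral t w ^ k) \<le> ennreal (t ^ (k - 1)) * (\<integral>\<^sup>+ s. ?f w s \<partial>lborel)"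
    using AE_space
  proof eventually_elim
    case (elim w)
    have m: "(\<lambda>s. norm (Z_version s w)) \<in> borel_measurable borel"
      using measurable_compose[OF measurable_Pair1'[OF elim(2), of lborel] measurable_Z_version_swap]
      by simp
    have int: "integrable lborel (\<lambda>s. indicator {0..t} s * norm (Z_version s w) ^ k)"
      using elim(1) m by (intro integrableI_bounded) (auto simp: less_top)
    have "Z_absolute_integral t w ^ k \<le> t ^ (k - 1) * (LINT s:{0..t}|lborel. norm (Z_version s w) ^ k)"
      unfolding Z_absolute_integral_def using t k m int
      by (intro power_integral_le) (auto simp: set_integrable_def)
    then have "ennreal (Z_absolute_integral t w ^ k)
        \<le> ennreal (t ^ (k - 1) * (LINT s:{0..t}|lborel. norm (Z_version s w) ^ k))"
      by (rule ennreal_leI)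
    also have "\<dots> = ennreal (t ^ (k - 1)) * ennreal (LINT s:{0..t}|lborel. norm (Z_version s w) ^ k)"
      using t by (intro ennreal_mult') auto
    also have "ennreal (LINT s:{0..t}|lborel. norm (Z_version s w) ^ k) = (\<integral>\<^sup>+ s. ?f w s \<partial>lborel)"
      unfolding set_lebesgue_integral_def using int by (subst nn_integral_eq_integral) auto
    finally show ?case .
  qed
  have "(\<integral>\<^sup>+ w. ennreal (Z_absolute_integral t w ^ k) \<partial>P)
      \<le> (\<integral>\<^sup>+ w. ennreal (t ^ (k - 1)) * (\<integral>\<^sup>+ s. ?f w s \<partial>lborel) \<partial>P)"
    by (rule nn_integral_mono_AE[OF pointwise])
  also have "\<dots> = ennreal (t ^ (k - 1)) * (\<integral>\<^sup>+ w. (\<integral>\<^sup>+ s. ?f w s \<partial>lborel) \<partial>P)"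
    by (rule nn_integral_cmult[OF fm])
  also have "\<dots> \<le> ennreal (t ^ (k - 1)) * ennreal (c * t)"
    by (intro mult_left_mono total) simp
  also have "\<dots> = ennreal (t ^ k * c)"
    using t c0 k by (cases k) (simp_all add: ennreal_mult[symmetric] mult_ac)
  finally have le: "(\<integral>\<^sup>+ w. ennreal (Z_absolute_integral t w ^ k) \<partial>P) \<le> ennreal (t ^ k * c)" .
  show int: "integrable P (\<lambda>w. Z_absolute_integral t w ^ k)"
    using le Z_absolute_integral_nonneg by (intro integrableI_bounded) (auto simp: le_less_trans)
  show "expectation (\<lambda>w. Z_absolute_integral t w ^ k) \<le> t ^ k * c"
    using le t c0 int Z_absolute_integral_nonneg by (subst (asm) nn_integral_eq_integral) auto
qed

end

section \<open>Moments of stationary laws and null sequences\<close>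

text \<open>The equality of the laws makes the truncated moments of \<open>U'\<close> and \<open>U\<close> comparable even when the
  moment of \<open>U\<close> is infinite. With \<open>f n\<close> the expectation of \<open>min (\<theta>\<^sup>n U\<^sup>k) R\<close>, the inequality
  gives \<open>f n \<le> f (n + 1) + \<theta>\<^sup>n E D\<close>, and \<open>f n\<close> tends to \<open>0\<close> by dominated convergence.\<close>

lemma (in prob_space) contraction_moment:
  fixes U U' Y :: "'a \<Rightarrow> real"
  assumes k: "1 \<le> k" and [measurable]: "U \<in> borel_measurable M" "U' \<in> borel_measurable M" "Y \<in> borel_measurable M"
    and nonneg: "\<And>w. 0 \<le> U w" "\<And>w. 0 \<le> U' w" "\<And>w. 0 \<le> Y w"
    and law: "distr M borel U' = distr M borel U"
    and le: "AE w in M. U' w \<le> \<rho> * U w + Y w" and \<rho>: "0 \<le> \<rho>" "\<rho> < 1"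
    and Y: "integrable M (\<lambda>w. Y w ^ k)"
  shows "integrable M (\<lambda>w. U w ^ k)"
proof -
  define \<epsilon> where "\<epsilon> = (1 - \<rho>) / 2"
  define \<theta> where "\<theta> = \<rho> + \<epsilon>"
  have \<epsilon>: "0 < \<epsilon>" and \<theta>: "0 \<le> \<theta>" "\<theta> < 1"
    using \<rho> by (simp_all add: \<epsilon>_def \<theta>_def field_simps)
  define D where "D w = (\<rho> / \<epsilon> + 1) ^ k * Y w ^ k" for w
  have D0: "0 \<le> D w" for w
    using \<rho> \<epsilon> nonneg by (simp add: D_def)
  have D: "integrable M D"
    unfolding D_def using Y by simp
  \<comment> \<open>The contraction passes to \<open>k\<close>-th powers with a factor \<open>\<theta>\<close> between \<open>\<rho>\<close> and \<open>1\<close>.\<close>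
  have step: "AE w in M. U' w ^ k \<le> \<theta> * U w ^ k + D w"
    using le
  proof eventually_elim
    case (elim w)
    show ?case
    \<comment> \<open>Either \<open>U\<close> dominates and \<open>\<rho>\<close> is enlarged slightly, or \<open>U\<close> is bounded by a multiple of \<open>Y\<close>.\<close>
    proof (cases "Y w \<le> \<epsilon> * U w")
      case True
      with elim have "U' w \<le> \<theta> * U w"
        by (simp add: \<theta>_def algebra_simps)
      then have "U' w ^ k \<le> \<theta> ^ k * U w ^ k"
        using nonneg by (simp add: power_mono flip: power_mult_distrib)
      also have "\<dots> \<le> \<theta> ^ 1 * U w ^ k"
        using \<theta> k nonneg by (intro mult_right_mono power_decreasing) auto
      finally show ?thesis
        using D0[of w] by simp
    next
      case False
      then have "U w \<le> Y w / \<epsilon>"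
        using \<epsilon> by (simp add: pos_le_divide_eq mult.commute)
      then have "\<rho> * U w \<le> \<rho> * (Y w / \<epsilon>)"
        using \<rho>(1) by (rule mult_left_mono)
      with elim have "U' w \<le> (\<rho> / \<epsilon> + 1) * Y w"
        by (simp add: algebra_simps)
      then have "U' w ^ k \<le> D w"
        using nonneg by (simp add: D_def power_mono flip: power_mult_distrib)
      moreover have "0 \<le> \<theta> * U w ^ k"
        using \<theta> nonneg by simp
      ultimately show ?thesis
        by simp
    qed
  qed
  have int_min: "integrable M (\<lambda>w. min (c * f w ^ k) R)"
    if "0 \<le> R" "0 \<le> c" "\<And>w. 0 \<le> f w" "f \<in> borel_measurable M" for c R and f :: "'a \<Rightarrow> real"
    using that by (intro integrable_const_bound[where B=R]) (auto intro!: always_eventually)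
  have bound: "expectation (\<lambda>w. min (U w ^ k) R) \<le> expectation D / (1 - \<theta>)" if R: "0 \<le> R" for R
  proof -
    define f where "f n = expectation (\<lambda>w. min (\<theta> ^ n * U w ^ k) R)" for n
    have f_step: "f n \<le> f (Suc n) + \<theta> ^ n * expectation D" for n
    proof -
      have "f n = (LINT x|distr M borel U. min (\<theta> ^ n * x ^ k) R)"
        unfolding f_def by (subst integral_distr) auto
      also have "\<dots> = expectation (\<lambda>w. min (\<theta> ^ n * U' w ^ k) R)"
        unfolding law[symmetric] by (subst integral_distr) auto
      also have "\<dots> \<le> expectation (\<lambda>w. min (\<theta> ^ Suc n * U w ^ k) R + \<theta> ^ n * D w)"
      proof (rule integral_mono_AE)
        show "integrable M (\<lambda>w. min (\<theta> ^ n * U' w ^ k) R)"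
          using R \<theta> nonneg by (intro int_min) auto
        show "integrable M (\<lambda>w. min (\<theta> ^ Suc n * U w ^ k) R + \<theta> ^ n * D w)"
          using R \<theta> nonneg D by (intro Bochner_Integration.integrable_add int_min) auto
        show "AE w in M. min (\<theta> ^ n * U' w ^ k) R \<le> min (\<theta> ^ Suc n * U w ^ k) R + \<theta> ^ n * D w"
          using step
        proof eventually_elim
          case (elim w)
          then have "\<theta> ^ n * U' w ^ k \<le> \<theta> ^ n * (\<theta> * U w ^ k + D w)"
            using \<theta> by (intro mult_left_mono) auto
          then have "\<theta> ^ n * U' w ^ k \<le> \<theta> ^ Suc n * U w ^ k + \<theta> ^ n * D w"
            by (simp add: algebra_simps)
          moreover have "0 \<le> \<theta> ^ n * D w"
            using \<theta> D0 by simp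
          ultimately show ?case
            by (auto simp: min_def)
        qed
      qed
      also have "\<dots> = f (Suc n) + \<theta> ^ n * expectation D"
        unfolding f_def using int_min[of R "\<theta> ^ Suc n" U] R \<theta> nonneg D by simp
      finally show ?thesis .
    qed
    have "f 0 \<le> f n + (\<Sum>i<n. \<theta> ^ i) * expectation D" for n
    proof (induction n)
      case (Suc n)
      with f_step[of n] show ?case by (simp add: algebra_simps)
    qed simp
    moreover have "(\<lambda>n. f n + (\<Sum>i<n. \<theta> ^ i) * expectation D) \<longlonglongrightarrow> 0 + 1 / (1 - \<theta>) * expectation D"
    proof (intro tendsto_add tendsto_mult_right)
      show "(\<lambda>n. \<Sum>i<n. \<theta> ^ i) \<longlonglongrightarrow> 1 / (1 - \<theta>)"
        using geometric_sums[of \<theta>] \<theta> by (simp add: sums_def)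
      have "f \<longlonglongrightarrow> expectation (\<lambda>w. 0)"
        unfolding f_def
      proof (rule integral_dominated_convergence[where w="\<lambda>_. R"])
        show "AE w in M. (\<lambda>n. min (\<theta> ^ n * U w ^ k) R) \<longlonglongrightarrow> 0"
        proof (intro always_eventually allI)
          fix w
          have "(\<lambda>n. \<theta> ^ n * U w ^ k) \<longlonglongrightarrow> 0 * U w ^ k"
            using \<theta> by (intro tendsto_mult_right LIMSEQ_power_zero) simp
          then have "(\<lambda>n. min (\<theta> ^ n * U w ^ k) R) \<longlonglongrightarrow> min (0 * U w ^ k) R"
            by (intro tendsto_min tendsto_const)
          then show "(\<lambda>n. min (\<theta> ^ n * U w ^ k) R) \<longlonglongrightarrow> 0"
            using R by simp
        qed
        show "AE w in M. norm (min (\<theta> ^ n * U w ^ k) R) \<le> R" for n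
          using R \<theta> nonneg by (auto intro!: always_eventually)
      qed auto
      then show "f \<longlonglongrightarrow> 0" by simp
    qed
    ultimately have "f 0 \<le> 0 + 1 / (1 - \<theta>) * expectation D"
      by (intro LIMSEQ_le_const) auto
    then show ?thesis
      by (simp add: f_def)
  qed
  define g where "g n = expectation (\<lambda>w. min (U w ^ k) (real n))" for n :: nat
  have int_g: "integrable M (\<lambda>w. min (U w ^ k) (real n))" for n :: nat
    using int_min[of "real n" 1 U] nonneg by simp
  have mono_g: "mono g"
    unfolding g_def by (intro monoI integral_mono int_g) auto
  have "\<forall>n. g n \<le> expectation D / (1 - \<theta>)"
    unfolding g_def by (intro allI bound) simp
  with mono_g obtain L where "g \<longlonglongrightarrow> L"
    by (rule incseq_convergent)
  then have "(\<lambda>n. expectation (\<lambda>w. min (U w ^ k) (real n))) \<longlonglongrightarrow> L"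
    by (simp add: g_def[abs_def])
  then show ?thesis
  proof (rule integrable_monotone_convergence[OF int_g, rotated 2])
    show "AE w in M. mono (\<lambda>n. min (U w ^ k) (real n))"
      by (auto intro!: always_eventually monoI)
    show "AE w in M. (\<lambda>n. min (U w ^ k) (real n)) \<longlonglongrightarrow> U w ^ k"
    proof (rule always_eventually, rule allI, rule tendsto_eventually)
      fix w
      show "\<forall>\<^sub>F n in sequentially. min (U w ^ k) (real n) = U w ^ k"
        by (rule eventually_sequentiallyI[of "nat \<lceil>U w ^ k\<rceil>"]) linarith
    qed
  qed auto
qed

text \<open>Sequences of random variables whose \<open>k\<close>-th absolute moments are finite and tend to \<open>0\<close>.\<close>

definition moment_null ::
    "nat \<Rightarrow> 'a measure \<Rightarrow> (nat \<Rightarrow> 'a \<Rightarrow> 'b::{real_normed_vector, second_countable_topology}) \<Rightarrow> bool" where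
  "moment_null k N A \<longleftrightarrow>
     (\<forall>n. A n \<in> borel_measurable N \<and> integrable N (\<lambda>w. norm (A n w) ^ k)) \<and>
     (\<lambda>n. LINT w|N. norm (A n w) ^ k) \<longlonglongrightarrow> 0"

lemma moment_nullD:
  assumes "moment_null k N A"
  shows "A n \<in> borel_measurable N" "integrable N (\<lambda>w. norm (A n w) ^ k)"
    "(\<lambda>n. LINT w|N. norm (A n w) ^ k) \<longlonglongrightarrow> 0"
  using assms by (auto simp: moment_null_def)

lemma moment_null_dominated:
  assumes D: "moment_null k N D" and A: "\<And>n. A n \<in> borel_measurable N"
    and le: "\<And>n. AE w in N. norm (A n w) \<le> norm (D n w)"
  shows "moment_null k N A"
proof -
  have int: "integrable N (\<lambda>w. norm (A n w) ^ k)" for n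
  proof (rule Bochner_Integration.integrable_bound[OF moment_nullD(2)[OF D, of n]])
    show "(\<lambda>w. norm (A n w) ^ k) \<in> borel_measurable N"
      using A by measurable
    show "AE w in N. norm (norm (A n w) ^ k) \<le> norm (norm (D n w) ^ k)"
      using le[of n] by eventually_elim (simp add: power_mono)
  qed
  have "(\<lambda>n. LINT w|N. norm (A n w) ^ k) \<longlonglongrightarrow> 0"
  proof (rule tendsto_sandwich[OF _ _ tendsto_const moment_nullD(3)[OF D]])
    show "\<forall>\<^sub>F n in sequentially. 0 \<le> (LINT w|N. norm (A n w) ^ k)"
      by (intro always_eventually allI integral_nonneg_AE) auto
    show "\<forall>\<^sub>F n in sequentially. (LINT w|N. norm (A n w) ^ k) \<le> (LINT w|N. norm (D n w) ^ k)"
    proof (rule always_eventually, rule allI)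
      fix n
      have "AE w in N. norm (A n w) ^ k \<le> norm (D n w) ^ k"
        using le[of n] by eventually_elim (simp add: power_mono)
      then show "(LINT w|N. norm (A n w) ^ k) \<le> (LINT w|N. norm (D n w) ^ k)"
        by (intro integral_mono_AE int moment_nullD(2)[OF D])
    qed
  qed
  then show ?thesis
    using A int by (simp add: moment_null_def)
qed

lemma moment_null_add:
  assumes A: "moment_null k N A" and B: "moment_null k N B"
  shows "moment_null k N (\<lambda>n w. A n w + B n w)"
proof -
  note [measurable] = moment_nullD(1)[OF A] moment_nullD(1)[OF B]
  have le: "norm (A n w + B n w) ^ k \<le> 2 ^ k * (norm (A n w) ^ k + norm (B n w) ^ k)" for n w
    by (rule order_trans[OF power_mono[OF norm_triangle_ineq] power_add_le]) auto
  have int': "integrable N (\<lambda>w. 2 ^ k * (norm (A n w) ^ k + norm (B n w) ^ k))" for n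
    using moment_nullD(2)[OF A] moment_nullD(2)[OF B] by auto
  have int: "integrable N (\<lambda>w. norm (A n w + B n w) ^ k)" for n
    using le by (intro Bochner_Integration.integrable_bound[OF int'[of n]]) (auto intro!: always_eventually)
  have "(\<lambda>n. LINT w|N. norm (A n w + B n w) ^ k) \<longlonglongrightarrow> 0"
  proof (rule tendsto_sandwich)
    show "\<forall>\<^sub>F n in sequentially. 0 \<le> (LINT w|N. norm (A n w + B n w) ^ k)"
      by (intro always_eventually allI integral_nonneg_AE) auto
    show "\<forall>\<^sub>F n in sequentially. (LINT w|N. norm (A n w + B n w) ^ k)
        \<le> 2 ^ k * ((LINT w|N. norm (A n w) ^ k) + (LINT w|N. norm (B n w) ^ k))"
    proof (intro always_eventually allI)
      fix n
      have "(LINT w|N. norm (A n w + B n w) ^ k) \<le> (LINT w|N. 2 ^ k * (norm (A n w) ^ k + norm (B n w) ^ k))"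
        by (intro integral_mono int int' le)
      then show "(LINT w|N. norm (A n w + B n w) ^ k)
        \<le> 2 ^ k * ((LINT w|N. norm (A n w) ^ k) + (LINT w|N. norm (B n w) ^ k))"
        using moment_nullD(2)[OF A] moment_nullD(2)[OF B] by simp
    qed
    show "(\<lambda>n. 2 ^ k * ((LINT w|N. norm (A n w) ^ k) + (LINT w|N. norm (B n w) ^ k))) \<longlonglongrightarrow> 0"
      using tendsto_mult_left[OF tendsto_add[OF moment_nullD(3)[OF A] moment_nullD(3)[OF B]], of "2 ^ k"] by simp
  qed simp
  then show ?thesis
    using int by (simp add: moment_null_def)
qed

lemma moment_null_scale:
  assumes A: "moment_null k N A"
  shows "moment_null k N (\<lambda>n w. c *\<^sub>R A n w)"
proof -
  note [measurable] = moment_nullD(1)[OF A]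
  have "(\<lambda>n. LINT w|N. norm (c *\<^sub>R A n w) ^ k) \<longlonglongrightarrow> 0"
    using tendsto_mult_left[OF moment_nullD(3)[OF A], of "\<bar>c\<bar> ^ k"] by (simp add: power_mult_distrib)
  then show ?thesis
    using moment_nullD(2)[OF A] by (simp add: moment_null_def power_mult_distrib)
qed

lemma moment_null_vanishing_factor:
  assumes "1 \<le> k" and f: "f \<in> borel_measurable N" "integrable N (\<lambda>w. norm (f w) ^ k)"
    and c: "c \<longlonglongrightarrow> 0"
  shows "moment_null k N (\<lambda>n w. c n *\<^sub>R f w)"
proof -
  have "(\<lambda>n. \<bar>c n\<bar> ^ k * (LINT w|N. norm (f w) ^ k)) \<longlonglongrightarrow> \<bar>0\<bar> ^ k * (LINT w|N. norm (f w) ^ k)"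
    by (intro tendsto_intros c)
  then have "(\<lambda>n. LINT w|N. norm (c n *\<^sub>R f w) ^ k) \<longlonglongrightarrow> 0"
    using \<open>1 \<le> k\<close> by (simp add: power_mult_distrib power_0_left)
  then show ?thesis
    using f by (simp add: moment_null_def power_mult_distrib)
qed

context levy_process
begin

lemma small_time_finite_moments:
  assumes k: "1 \<le> k" and fin: "finite_moment k P (Z 1)"
  obtains \<delta> where "0 < \<delta>"
    "\<And>t. 0 \<le> t \<Longrightarrow> t \<le> \<delta> \<Longrightarrow> finite_moment k P (Z t)"
    "\<And>t. 0 < t \<Longrightarrow> t \<le> \<delta> \<Longrightarrow> integrable P (\<lambda>w. Z_absolute_integral t w ^ k)"
proof -
  obtain \<delta> where \<delta>: "0 < \<delta>" "\<And>t. 0 \<le> t \<Longrightarrow> t \<le> \<delta> \<Longrightarrow> finite_moment k P (Z t)"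
    "\<And>t. 0 \<le> t \<Longrightarrow> t \<le> \<delta> \<Longrightarrow> expectation (\<lambda>w. norm (Z t w) ^ k) \<le> 1"
    by (rule small_time_moment[OF k fin zero_less_one], rule that)
  have int: "integrable P (\<lambda>w. Z_absolute_integral t w ^ k)" if t: "0 < t" "t \<le> \<delta>" for t
    using t \<delta> by (intro Z_absolute_integral_moment(1)[where c=1] k) auto
  show thesis
    by (rule that[OF \<delta>(1,2) int])
qed

lemma moment_null_Z:
  fixes t :: "nat \<Rightarrow> real"
  assumes k: "1 \<le> k" and fin: "finite_moment k P (Z 1)"
    and t: "\<And>n. 0 < t n" "t \<longlonglongrightarrow> 0"
    and finZ: "\<And>n. finite_moment k P (Z (t n))"
    and int: "\<And>n. integrable P (\<lambda>w. Z_absolute_integral (t n) w ^ k)"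
  shows "moment_null k P (\<lambda>n. Z (t n))" "moment_null k P (\<lambda>n w. Z_absolute_integral (t n) w / t n)"
proof -
  have small: "\<forall>\<^sub>F n in sequentially. expectation (\<lambda>w. norm (Z (t n) w) ^ k) < e
      \<and> expectation (\<lambda>w. norm (Z_absolute_integral (t n) w / t n) ^ k) < e"
    if e: "0 < e" for e :: real
  proof -
    have e2: "0 < e / 2" using e by simp
    obtain \<eta> where \<eta>: "0 < \<eta>" "\<And>t. 0 \<le> t \<Longrightarrow> t \<le> \<eta> \<Longrightarrow> finite_moment k P (Z t)"
      "\<And>t. 0 \<le> t \<Longrightarrow> t \<le> \<eta> \<Longrightarrow> expectation (\<lambda>w. norm (Z t w) ^ k) \<le> e / 2"
      by (rule small_time_moment[OF k fin e2], rule that)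
    have "\<forall>\<^sub>F n in sequentially. t n < \<eta>"
      using t \<eta> by (intro order_tendstoD(2)[where y=0]) auto
    then show ?thesis
    proof eventually_elim
      case (elim n)
      then have tn: "0 < t n" "t n \<le> \<eta>" using t by auto
      have "expectation (\<lambda>w. Z_absolute_integral (t n) w ^ k) \<le> t n ^ k * (e / 2)"
        using tn \<eta> by (intro Z_absolute_integral_moment(2) k) auto
      then have "expectation (\<lambda>w. Z_absolute_integral (t n) w ^ k) / t n ^ k \<le> e / 2"
        using tn by (simp add: pos_divide_le_eq mult.commute)
      moreover have "expectation (\<lambda>w. norm (Z_absolute_integral (t n) w / t n) ^ k)
          = expectation (\<lambda>w. Z_absolute_integral (t n) w ^ k) / t n ^ k"
        using tn Z_absolute_integral_nonneg by (simp add: power_divide)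
      moreover have "expectation (\<lambda>w. norm (Z (t n) w) ^ k) \<le> e / 2"
        using tn \<eta> by auto
      ultimately show ?case
        using e by linarith
    qed
  qed
  have null: "a \<longlonglongrightarrow> 0" if "\<And>n. 0 \<le> a n" "\<And>e. 0 < e \<Longrightarrow> \<forall>\<^sub>F n in sequentially. a n < e" for a :: "nat \<Rightarrow> real"
  proof (rule order_tendstoI)
    fix e :: real assume "e < 0"
    then show "\<forall>\<^sub>F n in sequentially. e < a n"
      using that(1) by (auto intro!: always_eventually intro: less_le_trans)
  qed (rule that(2))
  have "(\<lambda>n. expectation (\<lambda>w. norm (Z (t n) w) ^ k)) \<longlonglongrightarrow> 0"
    by (rule null) (auto intro: integral_nonneg_AE eventually_mono[OF small])
  then show "moment_null k P (\<lambda>n. Z (t n))"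
    using finZ by (simp add: moment_null_def finite_moment_def)
  have "(\<lambda>n. expectation (\<lambda>w. norm (Z_absolute_integral (t n) w / t n) ^ k)) \<longlonglongrightarrow> 0"
    by (rule null) (auto intro: integral_nonneg_AE eventually_mono[OF small])
  moreover have "integrable P (\<lambda>w. norm (Z_absolute_integral (t n) w / t n) ^ k)" for n
    using int t(1)[of n] Z_absolute_integral_nonneg by (simp add: power_divide)
  ultimately show "moment_null k P (\<lambda>n w. Z_absolute_integral (t n) w / t n)"
    using measurable_Z_absolute_integral by (simp add: moment_null_def)
qed

end

section \<open>The stationary solution\<close>

lemma (in pair_prob_space) distr_pair_snd: "distr (M1 \<Otimes>\<^sub>M M2) M2 snd = M2"
proof (intro measure_eqI)
  fix A assume "A \<in> sets (distr (M1 \<Otimes>\<^sub>M M2) M2 snd)"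
  then have A: "A \<in> sets M2" by simp
  then have "snd -` A \<inter> space (M1 \<Otimes>\<^sub>M M2) = space M1 \<times> A"
    by (auto simp: space_pair_measure dest: sets.sets_into_space)
  then show "emeasure (distr (M1 \<Otimes>\<^sub>M M2) M2 snd) A = emeasure M2 A"
    using A by (simp add: emeasure_distr M2.emeasure_pair_measure_Times M1.emeasure_space_1)
qed simp

text \<open>A steady-state distribution together with a stationary solution of the equation on the product
  space, whose first coordinate is the initial value and whose second coordinate carries the noise.\<close>

locale stationary_solution = levy_process P Z
  for P :: "'w measure" and Z :: "real \<Rightarrow> 'w \<Rightarrow> real^'n" +
  fixes M :: "real^'n^'n" and \<mu> :: "(real^'n) measure"
    and X :: "real \<Rightarrow> (real^'n) \<times> 'w \<Rightarrow> real^'n"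
  assumes prob_space_\<mu>: "prob_space \<mu>" and sets_\<mu>: "sets \<mu> = sets borel"
    and solution: "sde_solution M (\<mu> \<Otimes>\<^sub>M P) (\<lambda>t (x, w). Z t w) X"
    and initial: "AE (x, w) in \<mu> \<Otimes>\<^sub>M P. X 0 (x, w) = x"
    and law_X: "0 \<le> t \<Longrightarrow> distr (\<mu> \<Otimes>\<^sub>M P) borel (X t) = \<mu>"
begin

sublocale initial: prob_space \<mu>
  by (rule prob_space_\<mu>)

sublocale joint: pair_prob_space \<mu> P ..

abbreviation N :: "((real^'n) \<times> 'w) measure" where
  "N \<equiv> \<mu> \<Otimes>\<^sub>M P"

lemma measurable_X: "0 \<le> t \<Longrightarrow> X t \<in> borel_measurable N"
  using solution by (simp add: sde_solution_def)

lemma measurable_initial: "fst \<in> borel_measurable N"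
  using measurable_fst[of \<mu> P] by (simp add: measurable_def sets_\<mu> sets_eq_imp_space_eq[OF sets_\<mu>])

lemma distr_initial: "distr N borel fst = \<mu>"
  using distr_pair_fst[of \<mu>] distr_cong[OF refl sets_\<mu> refl, of N fst] by simp

lemma measurable_noise: "0 \<le> t \<Longrightarrow> (\<lambda>p. Z t (snd p)) \<in> borel_measurable N"
  by (rule measurable_compose[OF measurable_snd measurable_at])

lemma distr_noise: "distr N P snd = P"
  by (rule joint.distr_pair_snd)

lemma integral_noise:
  fixes f :: "'w \<Rightarrow> real"
  assumes "f \<in> borel_measurable P"
  shows "integrable N (\<lambda>p. f (snd p)) \<longleftrightarrow> integrable P f" "(LINT p|N. f (snd p)) = (LINT w|P. f w)"
  using assms integrable_distr_eq[of snd N P f] integral_distr[of snd N P f]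
  by (simp_all add: distr_noise)

lemma AE_noise: "AE w in P. Q w \<Longrightarrow> AE p in N. Q (snd p)"
  using AE_distrD[of snd N P Q] unfolding distr_noise by simp

text \<open>The operator norm of \<open>M\<close>.\<close>

definition drift_bound :: real where
  "drift_bound = onorm ((*v) M)"

lemma drift_bound: "norm (M *v v) \<le> drift_bound * norm v" "0 \<le> drift_bound"
  unfolding drift_bound_def by (auto intro: onorm onorm_pos_le)

text \<open>What is left of \<open>X t\<close> after an Euler step of size \<open>t\<close> from the initial value.\<close>

definition remainder :: "real \<Rightarrow> (real^'n) \<times> 'w \<Rightarrow> real^'n" where
  "remainder t p = X t p - fst p - t *\<^sub>R (M *v fst p) - Z t (snd p)"

lemma measurable_drift: "(\<lambda>p. M *v fst p) \<in> borel_measurable N"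
  by (rule borel_measurable_continuous_on[OF _ measurable_initial])
     (intro linear_continuous_on matrix_vector_mul_bounded_linear)

lemma measurable_remainder: "0 \<le> t \<Longrightarrow> remainder t \<in> borel_measurable N"
  unfolding remainder_def using measurable_X measurable_initial measurable_drift measurable_noise
  by measurable

lemma X_eq: "X t p = fst p + t *\<^sub>R (M *v fst p) + Z t (snd p) + remainder t p"
  by (simp add: remainder_def)

lemma AE_remainder_bound:
  assumes t: "0 < t" "drift_bound * t \<le> 1 / 2"
  shows "AE p in N. norm (remainder t p)
    \<le> 2 * drift_bound * Z_absolute_integral t (snd p) + 2 * drift_bound\<^sup>2 * t\<^sup>2 * norm (fst p)"
proof -
  have "AE p in N. \<forall>t\<ge>0. set_integrable lborel {0..t} (\<lambda>s. X s p) \<and>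
        X t p = X 0 p + (LINT s:{0..t}|lborel. M *v X s p) + Z t (snd p)"
    using solution by (simp add: sde_solution_def split_beta)
  moreover have "AE p in N. X 0 p = fst p"
    using initial by (simp add: split_beta)
  ultimately show ?thesis
    using AE_noise[OF AE_Z_version] AE_space
  proof eventually_elim
    case (elim p)
    have "(\<lambda>s. Z_version s (snd p)) \<in> borel_measurable borel"
      using measurable_compose[OF measurable_Pair1'[of "snd p" P lborel] measurable_Z_version_swap] elim(4)
      by (simp add: space_pair_measure mem_Times_iff)
    then have "norm (X t p - X 0 p - t *\<^sub>R (M *v X 0 p) - Z t (snd p))
        \<le> 2 * drift_bound * (LINT s:{0..t}|lborel. norm (Z_version s (snd p)))
          + 2 * drift_bound\<^sup>2 * t\<^sup>2 * norm (X 0 p)"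
      using elim t drift_bound
      by (intro path_remainder_bound[where z="\<lambda>s. Z s (snd p)" and z'="\<lambda>s. Z_version s (snd p)"]) auto
    then show ?case
      using elim(2) by (simp add: remainder_def Z_absolute_integral_def)
  qed
qed

lemma finite_moment_stationary:
  assumes k: "1 \<le> k" and stable: "stable_matrix M" and fin: "finite_moment k P (Z 1)"
  shows "finite_moment k \<mu> (\<lambda>x. x)"
proof -
  obtain V b c h0 where c: "0 < c" "0 < h0" and V: "\<And>x. norm x \<le> V x" "\<And>x. V x \<le> b * norm x"
    "\<And>x y. V (x + y) \<le> V x + V y"
    and contr: "\<And>h x. 0 < h \<Longrightarrow> h \<le> h0 \<Longrightarrow> V (x + h *\<^sub>R (M *v x)) \<le> (1 - c * h) * V x"
    by (rule stable_matrix_lyapunov_norm[OF stable], rule that)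
  obtain \<delta> where \<delta>: "0 < \<delta>" "\<And>t. 0 \<le> t \<Longrightarrow> t \<le> \<delta> \<Longrightarrow> finite_moment k P (Z t)"
    "\<And>t. 0 < t \<Longrightarrow> t \<le> \<delta> \<Longrightarrow> integrable P (\<lambda>w. Z_absolute_integral t w ^ k)"
    by (rule small_time_finite_moments[OF k fin], rule that)
  define B where "B = drift_bound"
  define b' where "b' = \<bar>b\<bar>"
  have B: "0 \<le> B" using drift_bound by (simp add: B_def)
  have Vb: "V x \<le> b' * norm x" for x
    by (rule order_trans[OF V(2)]) (auto simp: b'_def intro: mult_right_mono)
  have b': "0 \<le> b'" by (simp add: b'_def)
  \<comment> \<open>The last bound makes the part of the remainder that is proportional to \<open>\<parallel>\<xi>\<parallel>\<close> use up at most half of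
    the contraction.\<close>
  define h where "h = Min {h0, \<delta>, 1 / (2 * (B + 1)), 1 / c, c / (2 * (2 * b' * B\<^sup>2 + 1))}"
  have p: "0 < 2 * b' * B\<^sup>2 + 1"
    using b' by (intro add_nonneg_pos) auto
  have h: "0 < h" "h \<le> h0" "h \<le> \<delta>" "h \<le> 1 / (2 * (B + 1))" "h \<le> 1 / c" "h \<le> c / (2 * (2 * b' * B\<^sup>2 + 1))"
    using c \<delta>(1) B p unfolding h_def by (auto simp: Min_gr_iff)
  have h': "B * h \<le> 1 / 2" "c * h \<le> 1" "2 * b' * B\<^sup>2 * h \<le> c / 2"
  proof -
    have "h * (2 * (B + 1)) \<le> 1"
      using h(4) B by (subst pos_le_divide_eq[symmetric]) auto
    then show "B * h \<le> 1 / 2"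
      using h(1) by (simp add: algebra_simps)
    show "c * h \<le> 1"
      using h(5) c pos_le_divide_eq[of c h 1] by (simp add: mult.commute)
    have "h * (2 * (2 * b' * B\<^sup>2 + 1)) \<le> c"
      using h(6) p by (subst pos_le_divide_eq[symmetric]) auto
    then show "2 * b' * B\<^sup>2 * h \<le> c / 2"
      using h(1) by (simp add: algebra_simps)
  qed
  have V0: "0 \<le> V x" for x
    by (rule order_trans[OF norm_ge_zero V(1)])
  have "continuous_on UNIV V"
  proof (rule continuous_on_iff[THEN iffD2], intro ballI allI impI)
    fix x :: "real^'n" and e :: real assume e: "0 < e"
    have diff: "V y - V x \<le> b' * norm (y - x)" for x y
      using V(3)[of x "y - x"] Vb[of "y - x"] by simp
    have "dist (V y) (V x) < e" if "dist y x < e / (b' + 1)" for y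
    proof -
      have "\<bar>V y - V x\<bar> \<le> b' * norm (y - x)"
        using diff[of y x] diff[of x y] by (simp add: norm_minus_commute abs_le_iff)
      also have "\<dots> \<le> (b' + 1) * norm (y - x)"
        by (intro mult_right_mono) auto
      also have "\<dots> < e"
        using that b' by (simp add: dist_norm pos_less_divide_eq mult.commute)
      finally show ?thesis by (simp add: dist_real_def)
    qed
    then show "\<exists>d>0. \<forall>y\<in>UNIV. dist y x < d \<longrightarrow> dist (V y) (V x) < e"
      using e b' by (intro exI[of _ "e / (b' + 1)"]) auto
  qed
  then have Vm: "V \<in> borel_measurable borel"
    by (rule borel_measurable_continuous_onI)
  define Y where "Y p = b' * (norm (Z h (snd p)) + 2 * B * Z_absolute_integral h (snd p))" for p :: "(real^'n) \<times> 'w"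
  have mW: "(\<lambda>p. Z_absolute_integral h (snd p)) \<in> borel_measurable N"
    by (rule measurable_compose[OF measurable_snd measurable_Z_absolute_integral])
  have mZ: "(\<lambda>p. Z h (snd p)) \<in> borel_measurable N"
    using h by (intro measurable_noise) auto
  have Y0: "0 \<le> Y p" for p
    unfolding Y_def using b' B Z_absolute_integral_nonneg by (intro mult_nonneg_nonneg add_nonneg_nonneg) auto
  have mY: "Y \<in> borel_measurable N"
    unfolding Y_def using mW mZ by measurable
  have "integrable N (\<lambda>p. b' ^ k * (2 ^ k * (norm (Z h (snd p)) ^ k + (2 * B) ^ k * Z_absolute_integral h (snd p) ^ k)))"
  proof -
    have "Z h \<in> borel_measurable P"
      using h by (simp add: measurable_at)
    then have "(\<lambda>w. norm (Z h w) ^ k) \<in> borel_measurable P"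
      by measurable
    from integral_noise(1)[OF this] have "integrable N (\<lambda>p. norm (Z h (snd p)) ^ k)"
      using \<delta>(2)[of h] h by (simp add: finite_moment_def)
    moreover have "integrable N (\<lambda>p. Z_absolute_integral h (snd p) ^ k)"
      using \<delta>(3)[of h] h integral_noise(1)[of "\<lambda>w. Z_absolute_integral h w ^ k"] measurable_Z_absolute_integral
      by simp
    ultimately show ?thesis
      by auto
  qed
  then have intY: "integrable N (\<lambda>p. Y p ^ k)"
  proof (rule Bochner_Integration.integrable_bound)
    have "Y p ^ k \<le> b' ^ k * (2 ^ k * (norm (Z h (snd p)) ^ k + (2 * B) ^ k * Z_absolute_integral h (snd p) ^ k))" for p
      unfolding Y_def power_mult_distrib[of b'] power_mult_distrib[of "2 * B", symmetric]
      using b' B Z_absolute_integral_nonneg by (intro mult_left_mono power_add_le) auto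
    then show "AE p in N. norm (Y p ^ k)
        \<le> norm (b' ^ k * (2 ^ k * (norm (Z h (snd p)) ^ k + (2 * B) ^ k * Z_absolute_integral h (snd p) ^ k)))"
      using Y0 by (intro always_eventually allI) (simp add: order_trans[OF _ abs_ge_self])
  qed (use mY in measurable)
  have "integrable N (\<lambda>p. V (fst p) ^ k)"
  proof (rule joint.P.contraction_moment[where U'="\<lambda>p. V (X h p)" and Y=Y and \<rho>="1 - c * h / 2", OF k])
    show "(\<lambda>p. V (fst p)) \<in> borel_measurable N" "(\<lambda>p. V (X h p)) \<in> borel_measurable N"
      using h by (auto intro!: measurable_compose[OF _ Vm] measurable_X measurable_initial)
    have "distr N borel (\<lambda>p. V (X h p)) = distr (distr N borel (X h)) borel V"
      using h Vm by (subst distr_distr) (auto intro: measurable_X simp: comp_def)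
    also have "\<dots> = distr (distr N borel fst) borel V"
      using h by (simp only: law_X distr_initial)
    also have "\<dots> = distr N borel (\<lambda>p. V (fst p))"
      using Vm by (subst distr_distr) (auto intro: measurable_initial simp: comp_def)
    finally show "distr N borel (\<lambda>p. V (X h p)) = distr N borel (\<lambda>p. V (fst p))" .
    show "AE p in N. V (X h p) \<le> (1 - c * h / 2) * V (fst p) + Y p"
      using AE_remainder_bound[of h]
    proof (rule eventually_mono)
      show "0 < h" "drift_bound * h \<le> 1 / 2"
        using h h' by (auto simp: B_def)
      fix p assume rem: "norm (remainder h p)
        \<le> 2 * drift_bound * Z_absolute_integral h (snd p) + 2 * drift_bound\<^sup>2 * h\<^sup>2 * norm (fst p)"
      have "V (X h p) \<le> V (fst p + h *\<^sub>R (M *v fst p)) + V (Z h (snd p)) + V (remainder h p)"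
        unfolding X_eq[of h p] by (rule order_trans[OF V(3)] add_right_mono V(3))+
      also have "\<dots> \<le> (1 - c * h) * V (fst p) + b' * norm (Z h (snd p))
          + b' * (2 * B * Z_absolute_integral h (snd p) + 2 * B\<^sup>2 * h\<^sup>2 * norm (fst p))"
        using rem b' h by (intro add_mono contr Vb order_trans[OF Vb] mult_left_mono) (auto simp: B_def)
      also have "\<dots> = (1 - c * h) * V (fst p) + Y p + h * (2 * b' * B\<^sup>2 * h) * norm (fst p)"
        by (simp add: Y_def algebra_simps power2_eq_square)
      also have "\<dots> \<le> (1 - c * h) * V (fst p) + Y p + h * (c / 2) * V (fst p)"
        using h h' c V b' by (intro add_left_mono mult_mono) auto
      finally show "V (X h p) \<le> (1 - c * h / 2) * V (fst p) + Y p"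
        by (simp add: algebra_simps)
    qed
  qed (use V0 Y0 mY intY h' c h in auto)
  then have "integrable N (\<lambda>p. norm (fst p) ^ k)"
    by (rule Bochner_Integration.integrable_bound)
       (use measurable_initial V(1) V0 in \<open>auto intro!: always_eventually power_mono simp: power_abs\<close>)
  then show ?thesis
    using finite_moment_distr[OF measurable_initial, of k] measurable_initial
    by (simp add: distr_initial finite_moment_def)
qed

lemma indep_initial_noise:
  assumes "0 \<le> t"
  shows "joint.P.indep_var borel fst borel (\<lambda>p. Z t (snd p))"
proof -
  have Zt: "Z t \<in> borel_measurable P"
    using assms by (rule measurable_at)
  interpret D: prob_space "distr P borel (Z t)"
    by (rule prob_space_distr[OF Zt])
  have "distr N borel fst \<Otimes>\<^sub>M distr N borel (\<lambda>p. Z t (snd p)) = \<mu> \<Otimes>\<^sub>M distr P borel (Z t)"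
  proof -
    have "distr N borel (\<lambda>p. Z t (snd p)) = distr (distr N P snd) borel (Z t)"
      using Zt by (subst distr_distr) (auto simp: comp_def)
    then show ?thesis
      by (simp add: distr_initial distr_noise)
  qed
  also have "\<mu> \<Otimes>\<^sub>M distr P borel (Z t) = distr \<mu> borel (\<lambda>x. x) \<Otimes>\<^sub>M distr P borel (Z t)"
    using distr_id2[OF sets_\<mu>[symmetric]] by simp
  also have "distr \<mu> borel (\<lambda>x. x) \<Otimes>\<^sub>M distr P borel (Z t)
      = distr N (borel \<Otimes>\<^sub>M borel) (\<lambda>(x, w). (x, Z t w))"
    using Zt D.sigma_finite_measure_axioms measurable_ident_sets[OF sets_\<mu>]
    by (intro pair_measure_distr) auto
  finally show ?thesis
    using measurable_initial measurable_noise[OF assms]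
    by (simp add: joint.P.indep_var_distribution_eq case_prod_beta')
qed

lemma cumulant_tensor_X: "0 \<le> t \<Longrightarrow> cumulant_tensor N (X t) is = cumulant_tensor \<mu> (\<lambda>x. x) is"
  using cumulant_tensor_distr[OF measurable_X, of t "is"] by (simp add: law_X)

lemma cumulant_tensor_initial: "cumulant_tensor N fst is = cumulant_tensor \<mu> (\<lambda>x. x) is"
  using cumulant_tensor_distr[OF measurable_initial, of "is"] by (simp add: distr_initial)

lemma finite_moment_X: "0 \<le> t \<Longrightarrow> finite_moment k N (X t) \<longleftrightarrow> finite_moment k \<mu> (\<lambda>x. x)"
  using finite_moment_distr[OF measurable_X, of t k] by (simp add: law_X)

lemma finite_moment_initial: "finite_moment k N fst \<longleftrightarrow> finite_moment k \<mu> (\<lambda>x. x)"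
  using finite_moment_distr[OF measurable_initial, of k] by (simp add: distr_initial)

lemma law_noise: "0 \<le> t \<Longrightarrow> distr N borel (\<lambda>p. Z t (snd p)) = distr P borel (Z t)"
  using distr_distr[of "Z t" P borel snd N] by (simp add: distr_noise measurable_at comp_def)

lemma cumulant_tensor_noise:
  "0 \<le> t \<Longrightarrow> cumulant_tensor N (\<lambda>p. Z t (snd p)) is = cumulant_tensor P (Z t) is"
  using cumulant_tensor_distr[OF measurable_noise, of t "is"] cumulant_tensor_distr[OF measurable_at, of t "is"]
  by (simp add: law_noise)

lemma finite_moment_noise:
  "0 \<le> t \<Longrightarrow> finite_moment k N (\<lambda>p. Z t (snd p)) \<longleftrightarrow> finite_moment k P (Z t)"
  using finite_moment_distr[OF measurable_noise, of t k] finite_moment_distr[OF measurable_at, of t k]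
  by (simp add: law_noise)

lemma moment_null_noise:
  assumes A: "moment_null k P A"
  shows "moment_null k N (\<lambda>n p. A n (snd p))"
proof -
  have [measurable]: "A n \<in> borel_measurable P" for n
    using A by (rule moment_nullD)
  have "(\<lambda>w. norm (A n w) ^ k) \<in> borel_measurable P" for n
    by measurable
  from integral_noise[OF this] show ?thesis
    using A measurable_compose[OF measurable_snd moment_nullD(1)[OF A]]
    by (simp add: moment_null_def)
qed

text \<open>The arguments \<open>X t\<close> of the cumulant are replaced by \<open>F = \<xi> + Z t\<close> one slot after the other; as
  \<open>X t = F + t H\<close>, the replacement in slot \<open>m\<close> costs \<open>t\<close> times the cumulant with \<open>H\<close> in slot \<open>m\<close>.\<close>

lemma cumulant_increment:
  assumes k: "k = length is" "1 \<le> k" and t: "0 < t" and fin: "finite_moment k \<mu> (\<lambda>x. x)"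
    and finZ: "finite_moment k P (Z t)"
    and finH: "finite_moment k N (\<lambda>p. M *v fst p + (1 / t) *\<^sub>R remainder t p)"
  shows "cumulant_tensor P (Z t) is + t * (\<Sum>m<k. cumulant_upto k N (\<lambda>j p.
      (if j < m then fst p + Z t (snd p) else if j = m then M *v fst p + (1 / t) *\<^sub>R remainder t p else X t p) $ (is ! j))) = 0"
proof -
  let ?F = "\<lambda>p. fst p + Z t (snd p)" and ?H = "\<lambda>p. M *v fst p + (1 / t) *\<^sub>R remainder t p"
  define T where "T m = cumulant_upto k N (\<lambda>j p. (if j < m then ?F p else X t p) $ (is ! j))" for m
  define S where "S m = cumulant_upto k N (\<lambda>j p. (if j < m then ?F p else if j = m then ?H p else X t p) $ (is ! j))" for m
  have finF: "finite_moment k N ?F"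
    using fin finZ t by (intro finite_moment_add) (simp_all add: finite_moment_initial finite_moment_noise)
  have finX: "finite_moment k N (X t)"
    using fin t by (simp add: finite_moment_X)
  have comp: "(\<lambda>p. Y p $ i) \<in> borel_measurable N" "integrable N (\<lambda>p. \<bar>Y p $ i\<bar> ^ k)"
    if "finite_moment k N Y" for Y :: "_ \<Rightarrow> real^'n" and i
    using finite_moment_component[OF that] .
  have X_F: "X t p = ?F p + t *\<^sub>R ?H p" for p
    using t by (simp add: X_eq[of t p] scaleR_add_right)
  have step: "T m = T (Suc m) + t * S m" if m: "m < k" for m
  proof -
    let ?f = "\<lambda>j p. (if j < m then ?F p else X t p) $ (is ! j)"
    let ?g = "\<lambda>b p. (if b then ?F p else ?H p) $ (is ! m)"
    \<comment> \<open>The combination \<open>F + t H\<close> in slot \<open>m\<close> is written as a sum indexed by the two truth values.\<close>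
    have "cumulant_upto k N ?f = (\<Sum>b\<in>(UNIV :: bool set). (if b then 1 else t) * cumulant_upto k N (?f(m := ?g b)))"
    proof (rule joint.P.cumulant_upto_linear[OF m])
      show "AE p in N. ?f m p = (\<Sum>b\<in>UNIV. (if b then 1 else t) * ?g b p)"
        by (simp add: UNIV_bool X_F)
      show f: "?f i \<in> borel_measurable N" "integrable N (\<lambda>p. \<bar>?f i p\<bar> ^ k)" for i
        using comp[OF finF] comp[OF finX] by (cases "i < m"; simp)+
      show "?f m \<in> borel_measurable N"
        by (rule f)
      show "?g b \<in> borel_measurable N" "integrable N (\<lambda>p. \<bar>?g b p\<bar> ^ k)" for b
        using comp[OF finF] comp[OF finH] by (cases b; simp)+
    qed simp
    also have "?f(m := ?g True) = (\<lambda>j p. (if j < Suc m then ?F p else X t p) $ (is ! j))"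
      by (auto simp: fun_eq_iff less_Suc_eq)
    moreover have "?f(m := ?g False)
        = (\<lambda>j p. (if j < m then ?F p else if j = m then ?H p else X t p) $ (is ! j))"
      by (auto simp: fun_eq_iff)
    ultimately show ?thesis
      by (simp add: T_def S_def UNIV_bool)
  qed
  have "T 0 = T m + t * (\<Sum>i<m. S i)" if "m \<le> k" for m
    using that
  proof (induction m)
    case (Suc m)
    then show ?case
      using step[of m] by (simp add: algebra_simps)
  qed simp
  then have "T 0 = T k + t * (\<Sum>i<k. S i)"
    by simp
  moreover have "T 0 = cumulant_tensor \<mu> (\<lambda>x. x) is"
    using t k(1) cumulant_tensor_X[of t "is"] by (simp add: T_def cumulant_tensor_eq)
  moreover have "T k = cumulant_tensor \<mu> (\<lambda>x. x) is + cumulant_tensor P (Z t) is"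
  proof -
    have "T k = cumulant_tensor N ?F is"
      unfolding T_def cumulant_tensor_eq k(1)[symmetric]
      by (intro cumulant_upto_cong_moments Bochner_Integration.integral_cong refl prod.cong) auto
    also have "\<dots> = cumulant_tensor N fst is + cumulant_tensor N (\<lambda>p. Z t (snd p)) is"
      using t fin finZ k by (intro joint.P.cumulant_tensor_add_indep indep_initial_noise)
        (auto simp: finite_moment_initial finite_moment_noise)
    finally show ?thesis
      using t by (simp add: cumulant_tensor_initial cumulant_tensor_noise)
  qed
  ultimately show ?thesis
    by (simp add: S_def)
qed

text \<open>The sum defining \<open>M \<xi>\<close> in slot \<open>m\<close> is pulled out by multilinearity.\<close>

lemma cumulant_drift_slot:
  assumes k: "k = length is" and m: "m < k" and fin: "finite_moment k \<mu> (\<lambda>x. x)"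
  shows "cumulant_upto k N (\<lambda>j p. (if j = m then M *v fst p else fst p) $ (is ! j))
    = mode_product (cumulant_tensor \<mu> (\<lambda>x. x)) m M is"
proof -
  let ?f = "\<lambda>j p. (if j = m then M *v fst p else fst p) $ (is ! j)"
  have finI: "finite_moment k N fst"
    using fin by (simp add: finite_moment_initial)
  have comp: "(\<lambda>p. fst p $ i) \<in> borel_measurable N" "integrable N (\<lambda>p. \<bar>fst p $ i\<bar> ^ k)" for i
    using finite_moment_component[OF finI] .
  have f_m: "?f m p = (\<Sum>l\<in>UNIV. M $ (is ! m) $ l * fst p $ l)" for p
    by (simp add: matrix_vector_mult_def)
  have "cumulant_upto k N ?f = (\<Sum>l\<in>UNIV. M $ (is ! m) $ l * cumulant_upto k N (?f(m := (\<lambda>p. fst p $ l))))"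
  proof (rule joint.P.cumulant_upto_linear[OF m])
    show "AE p in N. ?f m p = (\<Sum>l\<in>UNIV. M $ (is ! m) $ l * fst p $ l)"
      by (intro always_eventually allI f_m)
    show "?f m \<in> borel_measurable N"
      unfolding f_m using comp by measurable
  qed (use comp in auto)
  also have "\<dots> = (\<Sum>l\<in>UNIV. M $ (is ! m) $ l * cumulant_tensor \<mu> (\<lambda>x. x) (is[m := l]))"
  proof (intro sum.cong refl arg_cong2[where f="(*)"])
    fix l
    have "cumulant_upto k N (?f(m := (\<lambda>p. fst p $ l))) = cumulant_tensor N fst (is[m := l])"
      unfolding cumulant_tensor_eq length_list_update k[symmetric]
    proof (intro cumulant_upto_cong_moments Bochner_Integration.integral_cong refl prod.cong)
      fix B p i assume "B \<subseteq> {..<k}" "i \<in> B"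
      then show "(?f(m := (\<lambda>p. fst p $ l))) i p = fst p $ (is[m := l] ! i)"
        using k m by (auto simp: nth_list_update)
    qed
    then show "cumulant_upto k N (?f(m := (\<lambda>p. fst p $ l))) = cumulant_tensor \<mu> (\<lambda>x. x) (is[m := l])"
      by (simp add: cumulant_tensor_initial)
  qed
  finally show ?thesis
    by (simp add: mode_product_def mult.commute)
qed

lemma component_tendsto:
  fixes A :: "nat \<Rightarrow> _ \<Rightarrow> real^'n"
  assumes "moment_null k N (\<lambda>n p. A n p - L p)"
    and "L \<in> borel_measurable N" "\<And>n. A n \<in> borel_measurable N"
  shows "(\<lambda>n. LINT p|N. \<bar>A n p $ i - L p $ i\<bar> ^ k) \<longlonglongrightarrow> 0"
proof -
  have "(\<lambda>x :: real^'n. x $ i) \<in> borel_measurable borel"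
    by (intro borel_measurable_continuous_onI continuous_intros)
  then have m: "(\<lambda>p. (A n p - L p) $ i) \<in> borel_measurable N" for n
    by (rule measurable_compose[rotated]) (use assms in measurable)
  have "moment_null k N (\<lambda>n p. (A n p - L p) $ i)"
  proof (rule moment_null_dominated[OF assms(1) m])
    show "AE p in N. norm ((A n p - L p) $ i) \<le> norm (A n p - L p)" for n
      unfolding real_norm_def by (intro always_eventually allI component_le_norm_cart)
  qed
  from moment_nullD(3)[OF this] show ?thesis
    by simp
qed

lemma cumulant_equation:
  assumes k: "k = length is" "1 \<le> k" and fin: "finite_moment k \<mu> (\<lambda>x. x)"
    and finZ: "finite_moment k P (Z 1)"
  shows "(\<Sum>m<k. mode_product (cumulant_tensor \<mu> (\<lambda>x. x)) m M is) + cumulant_tensor P (Z 1) is = 0"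
proof -
  obtain \<delta> where \<delta>: "0 < \<delta>" "\<And>t. 0 \<le> t \<Longrightarrow> t \<le> \<delta> \<Longrightarrow> finite_moment k P (Z t)"
    "\<And>t. 0 < t \<Longrightarrow> t \<le> \<delta> \<Longrightarrow> integrable P (\<lambda>w. Z_absolute_integral t w ^ k)"
    by (rule small_time_finite_moments[OF k(2) finZ], rule that)
  have pos: "0 < min \<delta> (1 / (2 * (drift_bound + 1)))"
    using \<delta>(1) drift_bound(2) by simp
  obtain n0 where n0: "1 / real (Suc n0) < min \<delta> (1 / (2 * (drift_bound + 1)))"
    using nat_approx_posE[OF pos] by blast
  \<comment> \<open>For reciprocals \<open>t\<close> of natural numbers, \<open>cum (Z 1) = cum (Z t) / t\<close> follows from additivity
    alone.\<close>
  define t where "t n = 1 / real (Suc (n + n0))" for n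
  have t: "0 < t n" "t n \<le> \<delta>" "drift_bound * t n \<le> 1 / 2" "t n \<le> 1" for n
  proof -
    show "0 < t n" "t n \<le> 1" by (simp_all add: t_def)
    have "t n \<le> 1 / real (Suc n0)"
      unfolding t_def by (intro divide_left_mono) auto
    with n0 have "t n \<le> \<delta>" "t n \<le> 1 / (2 * (drift_bound + 1))" by auto
    then show "t n \<le> \<delta>" by simp
    have "t n * (2 * (drift_bound + 1)) \<le> 1"
      using \<open>t n \<le> 1 / (2 * (drift_bound + 1))\<close> drift_bound(2)
      by (subst pos_le_divide_eq[symmetric]) auto
    then show "drift_bound * t n \<le> 1 / 2"
      using \<open>0 < t n\<close> by (simp add: algebra_simps)
  qed
  have t0: "t \<longlonglongrightarrow> 0"
    unfolding t_def using LIMSEQ_ignore_initial_segment[OF LIMSEQ_inverse_real_of_nat, of n0]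
    by (simp add: inverse_eq_divide)
  have t_nonneg: "0 \<le> t n" for n
    using t(1) by (rule less_imp_le)
  define H where "H n p = M *v fst p + (1 / t n) *\<^sub>R remainder (t n) p" for n p
  define F where "F n p = fst p + Z (t n) (snd p)" for n and p :: "(real^'n) \<times> 'w"
  have meas: "fst \<in> borel_measurable N" "(\<lambda>p. M *v fst p) \<in> borel_measurable N"
    "X (t n) \<in> borel_measurable N" "remainder (t n) \<in> borel_measurable N"
    "(\<lambda>p. Z (t n) (snd p)) \<in> borel_measurable N" for n
    using t_nonneg by (auto intro: measurable_initial measurable_drift measurable_X measurable_remainder measurable_noise)
  have measF: "F n \<in> borel_measurable N" and measH: "H n \<in> borel_measurable N" for n
    unfolding F_def H_def using meas by measurable
  have finI: "finite_moment k N fst"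
    using fin by (simp add: finite_moment_initial)
  have finM: "finite_moment k N (\<lambda>p. M *v fst p)"
  proof -
    have "integrable N (\<lambda>p. norm (M *v fst p) ^ k)"
    proof (rule Bochner_Integration.integrable_bound)
      show "integrable N (\<lambda>p. drift_bound ^ k * norm (fst p) ^ k)"
        using finI by (simp add: finite_moment_def)
      show "AE p in N. norm (norm (M *v fst p) ^ k) \<le> norm (drift_bound ^ k * norm (fst p) ^ k)"
        using drift_bound by (auto intro!: always_eventually power_mono simp flip: power_mult_distrib)
    qed (use meas in measurable)
    then show ?thesis
      using meas by (simp add: finite_moment_def)
  qed
  have null_Z: "moment_null k N (\<lambda>n p. Z (t n) (snd p))"
    by (rule moment_null_noise) (intro moment_null_Z(1) k finZ t t0 \<delta> t_nonneg)
  have null_R: "moment_null k N (\<lambda>n p. (1 / t n) *\<^sub>R remainder (t n) p)"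
  proof (rule moment_null_dominated)
    have "moment_null k N (\<lambda>n p. Z_absolute_integral (t n) (snd p) / t n)"
      by (rule moment_null_noise[where A="\<lambda>n w. Z_absolute_integral (t n) w / t n"])
         (intro moment_null_Z(2) k finZ t t0 \<delta> t_nonneg)
    then have "moment_null k N (\<lambda>n p. (2 * drift_bound) *\<^sub>R (Z_absolute_integral (t n) (snd p) / t n))"
      by (rule moment_null_scale)
    moreover have "moment_null k N (\<lambda>n p. (2 * drift_bound\<^sup>2 * t n) *\<^sub>R norm (fst p))"
      using k finI tendsto_mult_left[OF t0, of "2 * drift_bound\<^sup>2"]
      by (intro moment_null_vanishing_factor) (auto simp: finite_moment_def)
    ultimately show "moment_null k N (\<lambda>n p. (2 * drift_bound) *\<^sub>R (Z_absolute_integral (t n) (snd p) / t n)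
        + (2 * drift_bound\<^sup>2 * t n) *\<^sub>R norm (fst p))"
      by (rule moment_null_add)
    show "AE p in N. norm ((1 / t n) *\<^sub>R remainder (t n) p)
        \<le> norm ((2 * drift_bound) *\<^sub>R (Z_absolute_integral (t n) (snd p) / t n)
          + (2 * drift_bound\<^sup>2 * t n) *\<^sub>R norm (fst p))" for n
      using AE_remainder_bound[OF t(1,3), of n]
    proof eventually_elim
      case (elim p)
      have "norm ((1 / t n) *\<^sub>R remainder (t n) p) = norm (remainder (t n) p) / t n"
        using t(1)[of n] by simp
      also have "\<dots> \<le> (2 * drift_bound * Z_absolute_integral (t n) (snd p)
          + 2 * drift_bound\<^sup>2 * (t n)\<^sup>2 * norm (fst p)) / t n"
        using elim t_nonneg by (intro divide_right_mono)
      also have "\<dots> = (2 * drift_bound) *\<^sub>R (Z_absolute_integral (t n) (snd p) / t n)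
          + (2 * drift_bound\<^sup>2 * t n) *\<^sub>R norm (fst p)"
        using t(1)[of n] by (simp add: add_divide_distrib power2_eq_square)
      finally show ?case
        by (simp add: order_trans[OF _ abs_ge_self])
    qed
  qed (use meas in measurable)
  have null_H: "moment_null k N (\<lambda>n p. H n p - M *v fst p)"
    using null_R by (simp add: H_def)
  have null_F: "moment_null k N (\<lambda>n p. F n p - fst p)"
    using null_Z by (simp add: F_def)
  have null_tR: "moment_null k N (\<lambda>n p. remainder (t n) p)"
    using meas t t_nonneg
    by (intro moment_null_dominated[OF null_R]) (auto intro!: always_eventually simp: pos_le_divide_eq mult_left_le)
  have null_X: "moment_null k N (\<lambda>n p. X (t n) p - fst p)"
  proof -
    have "moment_null k N (\<lambda>n p. t n *\<^sub>R (M *v fst p))"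
      using finM k t0 by (intro moment_null_vanishing_factor) (auto simp: finite_moment_def)
    from moment_null_add[OF moment_null_add[OF this null_Z] null_tR] show ?thesis
      by (simp add: X_eq[of "t n" for n] add.assoc)
  qed
  have finH: "finite_moment k N (H n)" for n
    unfolding H_def
    using finM null_R by (intro finite_moment_add) (auto simp: finite_moment_def moment_null_def)
  have finF: "finite_moment k N (F n)" for n
    unfolding F_def using finI null_Z
    by (intro finite_moment_add) (auto simp: finite_moment_def moment_null_def)
  have finX: "finite_moment k N (X (t n))" for n
    using fin t_nonneg by (simp add: finite_moment_X)
  define S where "S n m = cumulant_upto k N (\<lambda>j p. (if j < m then F n p else if j = m then H n p else X (t n) p) $ (is ! j))" for n m
  have eq: "cumulant_tensor P (Z 1) is + (\<Sum>m<k. S n m) = 0" for n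
  proof -
    have "cumulant_tensor P (Z (t n)) is + t n * (\<Sum>m<k. S n m) = 0"
      unfolding S_def F_def H_def
      by (rule cumulant_increment) (use k t fin \<delta>(2) t_nonneg finH[unfolded H_def] in auto)
    moreover have "cumulant_tensor P (Z 1) is = real (Suc (n + n0)) * cumulant_tensor P (Z (t n)) is"
    proof -
      have "real (Suc (n + n0)) * t n = 1" "is \<noteq> []"
        using k by (auto simp: t_def)
      with cumulant_tensor_multiple[of "t n" "is" "n + n0"] show ?thesis
        using k t \<delta>(2) t_nonneg by auto
    qed
    moreover have "real (Suc (n + n0)) * (t n * (\<Sum>m<k. S n m)) = (\<Sum>m<k. S n m)"
      by (simp add: t_def)
    ultimately show ?thesis
      by (metis distrib_left mult_zero_right)
  qed
  have "(\<lambda>n. S n m) \<longlonglongrightarrow> mode_product (cumulant_tensor \<mu> (\<lambda>x. x)) m M is" if m: "m < k" for m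
  proof -
    have "(\<lambda>n. S n m) \<longlonglongrightarrow> cumulant_upto k N (\<lambda>j p. (if j = m then M *v fst p else fst p) $ (is ! j))"
      unfolding S_def
    proof (rule joint.P.cumulant_upto_tendsto)
      show "(\<lambda>p. (if j = m then M *v fst p else fst p) $ (is ! j)) \<in> borel_measurable N"
        "integrable N (\<lambda>p. \<bar>(if j = m then M *v fst p else fst p) $ (is ! j)\<bar> ^ k)" for j
        using finite_moment_component[OF finI] finite_moment_component[OF finM] by (cases "j = m"; simp)+
      show "(\<lambda>p. (if j < m then F n p else if j = m then H n p else X (t n) p) $ (is ! j)) \<in> borel_measurable N"
        "integrable N (\<lambda>p. \<bar>(if j < m then F n p else if j = m then H n p else X (t n) p) $ (is ! j)\<bar> ^ k)" for n j
        using finite_moment_component[OF finF] finite_moment_component[OF finH] finite_moment_component[OF finX]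
        by (cases "j < m"; cases "j = m"; simp)+
      show "(\<lambda>n. LINT p|N. \<bar>(if j < m then F n p else if j = m then H n p else X (t n) p) $ (is ! j)
          - (if j = m then M *v fst p else fst p) $ (is ! j)\<bar> ^ k) \<longlonglongrightarrow> 0" for j
        using component_tendsto[OF null_F meas(1) measF] component_tendsto[OF null_H meas(2) measH]
          component_tendsto[OF null_X meas(1) meas(3)]
        by (cases "j < m"; cases "j = m"; simp)
    qed
    then show ?thesis
      using cumulant_drift_slot[OF k(1) m fin] by simp
  qed
  then have "(\<lambda>n. cumulant_tensor P (Z 1) is + (\<Sum>m<k. S n m))
      \<longlonglongrightarrow> cumulant_tensor P (Z 1) is + (\<Sum>m<k. mode_product (cumulant_tensor \<mu> (\<lambda>x. x)) m M is)"
    by (intro tendsto_intros) auto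
  then have "(\<lambda>n. 0 :: real) \<longlonglongrightarrow> cumulant_tensor P (Z 1) is + (\<Sum>m<k. mode_product (cumulant_tensor \<mu> (\<lambda>x. x)) m M is)"
    by (simp only: eq)
  then show ?thesis
    by (simp add: LIMSEQ_const_iff add.commute)
qed

end

theorem proposition1:
  fixes M :: "real^'n^'n"
    and P :: "'w measure"
    and Z :: "real \<Rightarrow> 'w \<Rightarrow> real^'n"
    and \<mu> :: "(real^'n) measure"
    and k :: nat
  assumes "k \<ge> 1"
    and "stable_matrix M"
    and "levy_process P Z"
    and "finite_moment k P (Z 1)"
    and "steady_state_distribution M P Z \<mu>"
  shows "finite_moment k \<mu> (\<lambda>x. x) \<and>
    (\<forall>is. length is = k \<longrightarrow>
      (\<Sum>m<k. mode_product (cumulant_tensor \<mu> (\<lambda>x. x)) m M is) + cumulant_tensor P (Z 1) is = 0)"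
proof -
  obtain X where "prob_space \<mu>" "sets \<mu> = sets borel"
    "sde_solution M (\<mu> \<Otimes>\<^sub>M P) (\<lambda>t (x, w). Z t w) X"
    "AE (x, w) in \<mu> \<Otimes>\<^sub>M P. X 0 (x, w) = x"
    "\<forall>t\<ge>0. distr (\<mu> \<Otimes>\<^sub>M P) borel (X t) = \<mu>"
    using assms(5) unfolding steady_state_distribution_def by blast
  then interpret stationary_solution P Z M \<mu> X
    using assms(3) by (simp add: stationary_solution_def stationary_solution_axioms_def)
  have "finite_moment k \<mu> (\<lambda>x. x)"
    using assms by (intro finite_moment_stationary) auto
  then show ?thesis
    using assms cumulant_equation by auto
qed

end
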